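(* Let $Z$, $N$, $H$, $B$, $A$, $\bar p_j$, $\bar H_j$ and $\bar\Lambda=(\bar\Lambda_{jk})_{j,k\in\mathcal{J}}$ be as in the context. Then, on $(0,\infty)$, $$A(\mathrm{d}t)=\sum_{j\in\mathcal{J}}\bar p_j(t-)\Big(\big(1+\Delta\bar H_j(t)\big)B_j(\mathrm{d}t)+\sum_{k\in\mathcal{J},\,k\ne j}b_{jk}(t)\,\bar\Lambda_{jk}(\mathrm{d}t)\Big),$$ and for all $t\ge0$ and $j\in\mathcal{J}$, $$\frac{\bar p_j(t)}{\mathbb{E}[H(0)]}=\Big[\prod_{(0,t]}\big(\mathrm{Id}+\bar\Lambda(\mathrm{d}s)\big)\Big]_{z_0j},$$ where $\prod_{(0,t]}$ denotes the (matrix) product integral.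
   Context: Let $(\Omega,\mathcal{F},\mathbb{F},\mathbb{P})$ be a filtered probability space and $Z=(Z_t)_{t\ge0}$ a non-explosive (right-continuous, piecewise constant) jump process on a finite state space $\mathcal{J}$ with deterministic initial state $Z_0\equiv z_0$; no Markov assumption is made. For $j\neq k$ let $N_{jk}(t)=\#\{s\in(0,t]: Z_{s-}=j,\ Z_s=k\}$ and assume $\mathbb{E}[N_{jk}(t)]<\infty$ for all $t$. $H=(H(t))_{t\ge0}$ is a real stochastic process adapted to $\mathbb{F}$, right-continuous, of finite variation, and uniformly bounded on compacts (otherwise general; e.g. a stochastic discount factor $\exp\{-\int_0^t\delta(u)\,\mathrm{d}u\}$). Payments: $B_j$, $j\in\mathcal{J}$, are deterministic right-continuous real functions of finite variation; $b_{jk}$, $j\neq k$, are deterministic measurable real functions bounded on compacts; $b_0\in\mathbb{R}$. Put $B^\circ(0)=b_0$, $B^\circ(\mathrm{d}t)=\sum_{j}\mathbf{1}\{Z_{t-}=j\}B_j(\mathrm{d}t)+\sum_{j\neq k}b_{jk}(t)N_{jk}(\mathrm{d}t)$, $B(0)=B^\circ(0)$, $B(\mathrm{d}t)=H(t)B^\circ(\mathrm{d}t)$, and $A(t)=\mathbb{E}[B(t)]$. Definitions: for $j,k\in\mathcal{J}$, $j\ne k$, $$\bar p_j(t)=\mathbb{E}[H(t)\mathbf 1\{Z_t=j\}],\qquad \bar H_j(\mathrm{d}t)=\frac{1}{\bar p_j(t-)}\mathbb{E}[\mathbf 1\{Z_{t-}=j\}H(\mathrm{d}t)],$$ $$\bar\Lambda_{jk}(\mathrm{d}t)=\frac{1}{\bar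 p_j(t-)}\mathbb{E}[H(t)N_{jk}(\mathrm{d}t)],\qquad \bar\Lambda_{jj}=\bar H_j-\sum_{\ell\in\mathcal{J},\,\ell\ne j}\bar\Lambda_{j\ell}.$$ Here $\mathbb{E}[\mathbf 1\{Z_{t-}=j\}H(\mathrm{d}t)]$ and $\mathbb{E}[H(t)N_{jk}(\mathrm{d}t)]$ are the increments of $t\mapsto\mathbb{E}[\int_{(0,t]}\mathbf 1\{Z_{s-}=j\}H(\mathrm{d}s)]$ and $t\mapsto\mathbb{E}[\int_{(0,t]}H(s)N_{jk}(\mathrm{d}s)]$, and $\Delta\bar H_j(t)=\bar H_j(t)-\bar H_j(t-)$. It is understood that these definitions make sense: the expectations exist, $\mathbb{E}[H(0)]\neq0$, and $\bar H_j$, $\bar\Lambda_{jk}$ are well-defined right-continuous functions of finite variation on compacts satisfying $\bar p_j(t-)\bar H_j(\mathrm{d}t)=\mathbb{E}[\mathbf 1\{Z_{t-}=j\}H(\mathrm{d}t)]$ and $\bar p_j(t-)\bar\Lambda_{jk}(\mathrm{d}t)=\mathbb{E}[H(t)N_{jk}(\mathrm{d}t)]$. Product integral: for a right-continuous matrix function $\Lambda$ of locally finite variation, $\prod_{(0,t]}(\mathrm{Id}+\Lambda(\mathrm{d}s))$ is the limit over refining partitions $0=s_0<\dots<s_m=t$ of $(\mathrm{Id}+\Lambda(s_1)-\Lambda(s_0))\cdots(\mathrm{Id}+\Lambda(s_m)-\Lambda(s_{m-1}))$; equivalently the unique solution $P$ of $P(t)=\mathrm{Id}+\int_{(0,t]}P(s-)\Lambda(\mathrm{d}s)$.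 *)

theory Defs
  imports "HOL-Probability.Probability"
begin

text \<open>
  Time is \<open>real\<close>, and only arguments \<open>t \<ge> 0\<close> are relevant.
  The finite state space is a type of class \<open>finite\<close>.
\<close>

section \<open>Functions of finite variation and Lebesgue--Stieltjes integrals\<close>

definition left_lim :: "(real \<Rightarrow> real) \<Rightarrow> real \<Rightarrow> real" where
  "left_lim f t = Lim (at_left t) f"

definition variation_sums :: "(real \<Rightarrow> real) \<Rightarrow> real \<Rightarrow> real \<Rightarrow> real set" where
  "variation_sums f a b =
     {(\<Sum>i<n. \<bar>f (x (Suc i)) - f (x i)\<bar>) |n x. incseq x \<and> range x \<subseteq> {a..b}}"

definition total_variation :: "(real \<Rightarrow> real) \<Rightarrow> real \<Rightarrow> real \<Rightarrow> real" where
  "total_variation f a b = Sup (variation_sums f a b)"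

definition rcfv :: "(real \<Rightarrow> real) \<Rightarrow> bool" where
  "rcfv f \<longleftrightarrow> (\<forall>t\<ge>0. continuous (at_right t) f) \<and> (\<forall>t\<ge>0. bdd_above (variation_sums f 0 t))"

text \<open>
  Jordan decomposition \<open>f(t) - f(0) = pos_var f t - neg_var f t\<close> on \<open>[0,\<infinity>)\<close>; the two parts are
  extended by \<open>0\<close> to negative times so that \<^const>\<open>interval_measure\<close> applies.
\<close>

definition pos_var :: "(real \<Rightarrow> real) \<Rightarrow> real \<Rightarrow> real" where
  "pos_var f t = (total_variation f 0 (max 0 t) + (f (max 0 t) - f 0)) / 2"

definition neg_var :: "(real \<Rightarrow> real) \<Rightarrow> real \<Rightarrow> real" where
  "neg_var f t = (total_variation f 0 (max 0 t) - (f (max 0 t) - f 0)) / 2"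

definition ls_integrable :: "(real \<Rightarrow> real) \<Rightarrow> (real \<Rightarrow> real) \<Rightarrow> real \<Rightarrow> real \<Rightarrow> bool" where
  "ls_integrable g f a b \<longleftrightarrow>
     set_integrable (interval_measure (pos_var f)) {a<..b} g \<and>
     set_integrable (interval_measure (neg_var f)) {a<..b} g"

text \<open>\<open>ls_integral g f a b\<close> is the integral of \<open>g\<close> against \<open>f(ds)\<close> over \<open>(a,b]\<close>, for \<open>0 \<le> a \<le> b\<close>.\<close>

definition ls_integral :: "(real \<Rightarrow> real) \<Rightarrow> (real \<Rightarrow> real) \<Rightarrow> real \<Rightarrow> real \<Rightarrow> real" where
  "ls_integral g f a b =
     (LINT s:{a<..b}|interval_measure (pos_var f). g s) -
     (LINT s:{a<..b}|interval_measure (neg_var f). g s)"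

section \<open>Product integrals\<close>

definition partition_product ::
  "(real \<Rightarrow> real^'s^'s) \<Rightarrow> real \<Rightarrow> real \<Rightarrow> real set \<Rightarrow> real^('s::finite)^'s" where
  "partition_product L a b D =
     (let xs = sorted_list_of_set ({a, b} \<union> D)
      in foldr (**) (map2 (\<lambda>r s. mat 1 + (L s - L r)) xs (tl xs)) (mat 1))"

text \<open>
  Partitions of \<open>[a,b]\<close> are given by their finite sets of interior points, so refinement is
  inclusion and the limit is taken along \<^const>\<open>finite_subsets_at_top\<close>.
\<close>

definition has_product_integral ::
  "(real \<Rightarrow> real^'s^'s) \<Rightarrow> real \<Rightarrow> real \<Rightarrow> real^('s::finite)^'s \<Rightarrow> bool" where
  "has_product_integral L a b P \<longleftrightarrow>
     (partition_product L a b \<longlongrightarrow> P) (finite_subsets_at_top {a<..<b})"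

definition product_integral ::
  "(real \<Rightarrow> real^'s^'s) \<Rightarrow> real \<Rightarrow> real \<Rightarrow> real^('s::finite)^'s" where
  "product_integral L a b = Lim (finite_subsets_at_top {a<..<b}) (partition_product L a b)"

section \<open>Jump processes\<close>

text \<open>
  On every \<open>[0,T]\<close> there are finitely many times \<open>D\<close> outside of which the path does not move:
  it is constant on \<open>[s,t]\<close> as soon as \<open>(s,t]\<close> misses \<open>D\<close>.  Since \<open>s\<close> itself may lie in \<open>D\<close>,
  this includes right-continuity; finiteness of \<open>D\<close> is non-explosion.
\<close>

definition jump_path :: "(real \<Rightarrow> 's) \<Rightarrow> bool" where
  "jump_path z \<longleftrightarrow>
     (\<forall>T\<ge>0. \<exists>D. finite D \<and>
        (\<forall>s t. 0 \<le> s \<and> s \<le> t \<and> t \<le> T \<and> {s<..t} \<inter> D = {} \<longrightarrow> z s = z t))"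

definition left_state :: "(real \<Rightarrow> 's) \<Rightarrow> real \<Rightarrow> 's" where
  "left_state z t = (THE j. \<forall>\<^sub>F s in at_left t. z s = j)"

definition jump_count :: "(real \<Rightarrow> 'a \<Rightarrow> 's) \<Rightarrow> 's \<Rightarrow> 's \<Rightarrow> real \<Rightarrow> 'a \<Rightarrow> real" where
  "jump_count Z j k t \<omega> = real (card {s \<in> {0<..t}. left_state (\<lambda>u. Z u \<omega>) s = j \<and> Z s \<omega> = k})"

section \<open>Payments\<close>

definition undiscounted_payments ::
  "(real \<Rightarrow> 'a \<Rightarrow> 's::finite) \<Rightarrow> real \<Rightarrow> ('s \<Rightarrow> real \<Rightarrow> real) \<Rightarrow> ('s \<Rightarrow> 's \<Rightarrow> real \<Rightarrow> real) \<Rightarrow>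
    real \<Rightarrow> 'a \<Rightarrow> real" where
  "undiscounted_payments Z b0 B b t \<omega> =
     b0 + (\<Sum>j\<in>UNIV. ls_integral (\<lambda>s. of_bool (left_state (\<lambda>u. Z u \<omega>) s = j)) (B j) 0 t)
        + (\<Sum>j\<in>UNIV. \<Sum>k\<in>UNIV - {j}. ls_integral (b j k) (\<lambda>s. jump_count Z j k s \<omega>) 0 t)"

text \<open>The payment \<open>b0\<close> at time \<open>0\<close> is not multiplied by \<open>H(0)\<close>.\<close>

definition payments ::
  "(real \<Rightarrow> 'a \<Rightarrow> 's::finite) \<Rightarrow> (real \<Rightarrow> 'a \<Rightarrow> real) \<Rightarrow>
    real \<Rightarrow> ('s \<Rightarrow> real \<Rightarrow> real) \<Rightarrow> ('s \<Rightarrow> 's \<Rightarrow> real \<Rightarrow> real) \<Rightarrow> real \<Rightarrow> 'a \<Rightarrow> real" where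
  "payments Z H b0 B b t \<omega> =
     b0 + ls_integral (\<lambda>s. H s \<omega>) (\<lambda>s. undiscounted_payments Z b0 B b s \<omega>) 0 t"

definition expected_payments ::
  "'a measure \<Rightarrow> (real \<Rightarrow> 'a \<Rightarrow> 's::finite) \<Rightarrow> (real \<Rightarrow> 'a \<Rightarrow> real) \<Rightarrow>
    real \<Rightarrow> ('s \<Rightarrow> real \<Rightarrow> real) \<Rightarrow> ('s \<Rightarrow> 's \<Rightarrow> real \<Rightarrow> real) \<Rightarrow> real \<Rightarrow> real" where
  "expected_payments M Z H b0 B b t = (\<integral>\<omega>. payments Z H b0 B b t \<omega> \<partial>M)"

section \<open>The weighted occupation and transition quantities\<close>

definition p_bar ::
  "'a measure \<Rightarrow> (real \<Rightarrow> 'a \<Rightarrow> 's) \<Rightarrow> (real \<Rightarrow> 'a \<Rightarrow> real) \<Rightarrow> 's \<Rightarrow> real \<Rightarrow> real" where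
  "p_bar M Z H j t = (\<integral>\<omega>. H t \<omega> * of_bool (Z t \<omega> = j) \<partial>M)"

definition stay_integral ::
  "(real \<Rightarrow> 'a \<Rightarrow> 's) \<Rightarrow> (real \<Rightarrow> 'a \<Rightarrow> real) \<Rightarrow> 's \<Rightarrow> real \<Rightarrow> 'a \<Rightarrow> real" where
  "stay_integral Z H j t \<omega> =
     ls_integral (\<lambda>s. of_bool (left_state (\<lambda>u. Z u \<omega>) s = j)) (\<lambda>s. H s \<omega>) 0 t"

definition jump_integral ::
  "(real \<Rightarrow> 'a \<Rightarrow> 's) \<Rightarrow> (real \<Rightarrow> 'a \<Rightarrow> real) \<Rightarrow> 's \<Rightarrow> 's \<Rightarrow> real \<Rightarrow> 'a \<Rightarrow> real" where
  "jump_integral Z H j k t \<omega> = ls_integral (\<lambda>s. H s \<omega>) (\<lambda>s. jump_count Z j k s \<omega>) 0 t"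

definition expected_stay ::
  "'a measure \<Rightarrow> (real \<Rightarrow> 'a \<Rightarrow> 's) \<Rightarrow> (real \<Rightarrow> 'a \<Rightarrow> real) \<Rightarrow> 's \<Rightarrow> real \<Rightarrow> real" where
  "expected_stay M Z H j t = (\<integral>\<omega>. stay_integral Z H j t \<omega> \<partial>M)"

definition expected_jump ::
  "'a measure \<Rightarrow> (real \<Rightarrow> 'a \<Rightarrow> 's) \<Rightarrow> (real \<Rightarrow> 'a \<Rightarrow> real) \<Rightarrow> 's \<Rightarrow> 's \<Rightarrow> real \<Rightarrow> real" where
  "expected_jump M Z H j k t = (\<integral>\<omega>. jump_integral Z H j k t \<omega> \<partial>M)"

text \<open>
  The function with value \<open>0\<close> at time \<open>0\<close> and increments \<open>G(dt) / p(t-)\<close>; the quotient is read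
  as \<open>0\<close> where \<open>p(t-) = 0\<close>.
\<close>

definition ls_quotient :: "(real \<Rightarrow> real) \<Rightarrow> (real \<Rightarrow> real) \<Rightarrow> real \<Rightarrow> real" where
  "ls_quotient p G t = ls_integral (\<lambda>s. 1 / left_lim p s) G 0 t"

text \<open>
  The quotient makes sense: the defining integrals exist, and multiplying by \<open>p(t-)\<close> recovers
  \<open>G(dt)\<close>, that is, \<open>G(dt)\<close> does not charge the times with \<open>p(t-) = 0\<close>.
\<close>

definition ls_quotient_wf :: "(real \<Rightarrow> real) \<Rightarrow> (real \<Rightarrow> real) \<Rightarrow> bool" where
  "ls_quotient_wf p G \<longleftrightarrow>
     rcfv G \<and> (\<forall>t\<ge>0. ls_integrable (\<lambda>s. 1 / left_lim p s) G 0 t) \<and>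
     rcfv (ls_quotient p G) \<and>
     (\<forall>t\<ge>0. ls_integral (left_lim p) (ls_quotient p G) 0 t = G t - G 0)"

definition H_bar ::
  "'a measure \<Rightarrow> (real \<Rightarrow> 'a \<Rightarrow> 's) \<Rightarrow> (real \<Rightarrow> 'a \<Rightarrow> real) \<Rightarrow> 's \<Rightarrow> real \<Rightarrow> real" where
  "H_bar M Z H j = ls_quotient (p_bar M Z H j) (expected_stay M Z H j)"

definition transition_bar ::
  "'a measure \<Rightarrow> (real \<Rightarrow> 'a \<Rightarrow> 's) \<Rightarrow> (real \<Rightarrow> 'a \<Rightarrow> real) \<Rightarrow> 's \<Rightarrow> 's \<Rightarrow> real \<Rightarrow> real" where
  "transition_bar M Z H j k = ls_quotient (p_bar M Z H j) (expected_jump M Z H j k)"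

definition Lambda_bar ::
  "'a measure \<Rightarrow> (real \<Rightarrow> 'a \<Rightarrow> 's) \<Rightarrow> (real \<Rightarrow> 'a \<Rightarrow> real) \<Rightarrow> real \<Rightarrow> real^('s::finite)^'s" where
  "Lambda_bar M Z H t =
     (\<chi> j k. if k = j then H_bar M Z H j t - (\<Sum>l\<in>UNIV - {j}. transition_bar M Z H j l t)
            else transition_bar M Z H j k t)"

end

theory Submission
  imports Defs
begin

text \<open>
  Why the theorem holds.  Along a single path, \<open>H(t) 1{Z(t) = j}\<close> changes in two ways: between jumps
  of \<open>Z\<close> only \<open>H\<close> moves, and at a jump time \<open>t\<close> the mass \<open>H(t)\<close> leaves one state and enters another.
  Hence
    \<open>H(t) 1{Z(t) = j} - H(0) 1{Z(0) = j} = \<integral> 1{Z(s-) = j} H(ds) + \<Sum>k. \<integral> H(s) N\<^sub>k\<^sub>j(ds) - \<Sum>k. \<integral> H(s) N\<^sub>j\<^sub>k(ds)\<close>,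
  the sums extending over \<open>k \<noteq> j\<close> (\<open>weighted_indicator_decomposition\<close>).  Taking expectations and
  inserting \<open>p(t-) F(dt) = G(dt)\<close>, which relates the rates \<open>F\<close> to the expected integrals \<open>G\<close>, turns
  this into the forward equation \<open>p(dt) = p(t-) \<Lambda>(dt)\<close> for the row vector \<open>p\<close>
  (\<open>forward_equation\<close>).

  A linear Stieltjes equation is solved by the product integral.  The partition products converge
  because inserting one point into a partition costs at most a multiple of the resulting decrease of
  the sum of squared increments of the variation \<open>V\<close> of \<open>\<Lambda>\<close>; these sums decrease under refinement, so
  the products form a Cauchy net.  The limit is identified by comparing \<open>p\<close> with the products along
  partitions in whose half-open intervals \<open>V\<close> increases by at most \<open>\<epsilon>\<close>
  (\<open>linear_equation_product_integral\<close>).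

  For the payments, Fubini's theorem reduces the part paid during sojourns to
  \<open>E[1{Z(s-) = j} H(s)] = p\<^sub>j(s-) (1 + \<Delta>F\<^sub>j(s))\<close> (\<open>integral_occupied_H\<close>), where \<open>F\<^sub>j\<close> is the rate belonging
  to \<open>E[1{Z(s-) = j} H(ds)]\<close>: the left limit contributes \<open>p\<^sub>j(s-)\<close> and the jump of \<open>H\<close> contributes its
  expected increment.  The part paid at jumps is
  \<open>E[\<integral> b(s) H(s) N\<^sub>j\<^sub>k(ds)] = \<integral> b(s) p\<^sub>j(s-) \<Lambda>\<^sub>j\<^sub>k(ds)\<close> (\<open>integral_sum_jumps\<close>), which holds by definition when
  \<open>b\<close> is the indicator of an interval \<open>(0,u]\<close>.

  This last argument is typical: all rules for Stieltjes integrals (linearity in the integrator,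
  associativity, exchange with the expectation) follow by comparing two functionals of the integrand
  that are linear and continuous under bounded convergence, and such functionals agree as soon as they
  agree on the intervals \<open>(0,u]\<close> (\<open>functional_unique\<close>).
\<close>

section \<open>Total variation\<close>

lemma variation_sum_le:
  assumes "a \<le> b" "v \<in> variation_sums f a b"
    and dom: "\<And>s t. a \<le> s \<Longrightarrow> s \<le> t \<Longrightarrow> t \<le> b \<Longrightarrow> \<bar>f t - f s\<bar> \<le> W t - W s"
  shows "v \<le> W b - W a"
proof -
  obtain n x where x: "incseq x" "range x \<subseteq> {a..b}"
    and v: "v = (\<Sum>i<n. \<bar>f (x (Suc i)) - f (x i)\<bar>)"
    using assms(2) unfolding variation_sums_def by blast
  have ab: "a \<le> x i" "x i \<le> b" for i
    using rangeI[of x i, THEN subsetD[OF x(2)]] by auto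
  have "v \<le> (\<Sum>i<n. W (x (Suc i)) - W (x i))"
    unfolding v using x(1) ab by (intro sum_mono dom) (auto simp: incseq_SucD)
  also have "\<dots> = W (x n) - W (x 0)"
    by (rule sum_lessThan_telescope)
  also have "\<dots> \<le> W b - W a"
    using dom[of a "x 0"] dom[of "x n" b] ab[of 0] ab[of n] by linarith
  finally show ?thesis .
qed

lemma zero_in_variation_sums:
  assumes "a \<le> b"
  shows "0 \<in> variation_sums f a b"
  unfolding variation_sums_def using assms
  by (intro CollectI exI[of _ 0] exI[of _ "\<lambda>_. a"]) (auto simp: incseq_def)

lemma total_variation_le:
  assumes "a \<le> b"
    and dom: "\<And>s t. a \<le> s \<Longrightarrow> s \<le> t \<Longrightarrow> t \<le> b \<Longrightarrow> \<bar>f t - f s\<bar> \<le> W t - W s"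
  shows "total_variation f a b \<le> W b - W a"
  unfolding total_variation_def
  using zero_in_variation_sums[OF assms(1), of f]
  by (intro cSup_least) (auto intro: variation_sum_le[OF assms(1) _ dom])

text \<open>
  Finite variation is only ever verified by exhibiting increasing functions whose increments
  dominate those of the given one; they may depend on the time horizon \<open>T\<close>.
\<close>

lemma rcfvI:
  assumes "\<And>t. 0 \<le> t \<Longrightarrow> continuous (at_right t) f"
    and "\<And>s t T. 0 \<le> s \<Longrightarrow> s \<le> t \<Longrightarrow> t \<le> T \<Longrightarrow> \<bar>f t - f s\<bar> \<le> W T t - W T s"
  shows "rcfv f"
  unfolding rcfv_def
proof (intro conjI allI impI)
  fix t :: real assume "0 \<le> t"
  show "bdd_above (variation_sums f 0 t)"
    by (rule bdd_aboveI[of _ "W t t - W t 0"], rule variation_sum_le) (use \<open>0 \<le> t\<close> assms in auto)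
qed (use assms in auto)

lemma rcfv_continuous: "rcfv f \<Longrightarrow> 0 \<le> t \<Longrightarrow> continuous (at_right t) f"
  by (simp add: rcfv_def)

lemma rcfv_tendsto_right: "rcfv f \<Longrightarrow> 0 \<le> t \<Longrightarrow> (f \<longlongrightarrow> f t) (at_right t)"
  using rcfv_continuous by (simp add: continuous_within)

text \<open>Appending the points \<open>s\<close> and \<open>t\<close> to a chain in \<open>[0,s]\<close> gives a chain in \<open>[0,t]\<close>.\<close>

lemma abs_diff_le_total_variation:
  assumes f: "rcfv f" and st: "0 \<le> s" "s \<le> t"
  shows "\<bar>f t - f s\<bar> \<le> total_variation f 0 t - total_variation f 0 s"
proof -
  have bdd: "bdd_above (variation_sums f 0 t)"
    using f st by (auto simp: rcfv_def)
  have "v \<le> total_variation f 0 t - \<bar>f t - f s\<bar>" if v_in: "v \<in> variation_sums f 0 s" for v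
  proof -
    obtain n x where x: "incseq x" "range x \<subseteq> {0..s}"
      and v: "v = (\<Sum>i<n. \<bar>f (x (Suc i)) - f (x i)\<bar>)"
      using v_in unfolding variation_sums_def by blast
    have x0: "0 \<le> x i" "x i \<le> s" for i
      using rangeI[of x i, THEN subsetD[OF x(2)]] by auto
    define y where "y i = (if i \<le> n then x i else if i = Suc n then s else t)" for i
    have "incseq y"
      using x0 st by (intro incseq_SucI) (auto simp: y_def intro: incseq_SucD[OF x(1)])
    moreover have "range y \<subseteq> {0..t}"
      using x0 st by (auto simp: y_def intro: order_trans[OF x0(2)])
    ultimately have "(\<Sum>i<n + 2. \<bar>f (y (Suc i)) - f (y i)\<bar>) \<in> variation_sums f 0 t"
      unfolding variation_sums_def by blast
    then have "(\<Sum>i<n + 2. \<bar>f (y (Suc i)) - f (y i)\<bar>) \<le> total_variation f 0 t"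
      unfolding total_variation_def by (intro cSup_upper bdd)
    moreover have "(\<Sum>i<n. \<bar>f (y (Suc i)) - f (y i)\<bar>) = v"
      unfolding v by (intro sum.cong) (auto simp: y_def)
    ultimately show ?thesis
      by (simp add: y_def)
  qed
  then have "total_variation f 0 s \<le> total_variation f 0 t - \<bar>f t - f s\<bar>"
    unfolding total_variation_def[of f 0 s]
    using zero_in_variation_sums[OF st(1), of f] by (intro cSup_least) auto
  then show ?thesis by simp
qed

lemma total_variation_mono:
  "rcfv f \<Longrightarrow> 0 \<le> s \<Longrightarrow> s \<le> t \<Longrightarrow> total_variation f 0 s \<le> total_variation f 0 t"
  using abs_diff_le_total_variation[of f s t] by linarith

lemma total_variation_refl: "total_variation f 0 0 = 0"
proof (rule antisym)
  have dom: "\<bar>f t - f s\<bar> \<le> 0 - (0::real)" if "0 \<le> s" "s \<le> t" "t \<le> 0" for s t :: real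
  proof -
    have "s = 0" "t = 0" using that by linarith+
    then show ?thesis by simp
  qed
  show "total_variation f 0 0 \<le> 0"
    using total_variation_le[of 0 0 f "\<lambda>_. 0", OF _ dom] by simp
  have "v \<le> 0" if "v \<in> variation_sums f 0 0" for v
    using variation_sum_le[of 0 0 v f "\<lambda>_. 0", OF _ that dom] by simp
  then show "0 \<le> total_variation f 0 0"
    unfolding total_variation_def
    by (intro cSup_upper bdd_aboveI[of _ 0] zero_in_variation_sums) auto
qed

text \<open>
  If the variation \<open>V\<close> had a jump \<open>c > 0\<close> immediately after \<open>t\<close>, lowering \<open>V\<close> by \<open>c\<close> beyond \<open>t\<close>
  would still dominate the increments of \<open>f\<close>, because \<open>f\<close> itself does not jump there; this would
  contradict the minimality of \<open>V\<close>.
\<close>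

lemma total_variation_right_continuous:
  assumes f: "rcfv f" and t: "0 \<le> t"
  shows "continuous (at_right t) (total_variation f 0)"
proof -
  define V where "V = total_variation f 0"
  have V_mono: "V r \<le> V s" if "0 \<le> r" "r \<le> s" for r s
    unfolding V_def using total_variation_mono[OF f] that by auto
  have V_dom: "\<bar>f s - f r\<bar> \<le> V s - V r" if "0 \<le> r" "r \<le> s" for r s
    unfolding V_def using abs_diff_le_total_variation[OF f] that by auto
  define R where "R = Inf (V ` {t<..})"
  have bdd: "bdd_below (V ` {t<..})"
    by (rule bdd_belowI[of _ "V t"]) (use V_mono t in auto)
  have R_le: "R \<le> V u" if "t < u" for u
    unfolding R_def using that bdd by (intro cInf_lower) auto
  define W where "W s = (if s \<le> t then V s else V s - (R - V t))" for s
  have W_dom: "\<bar>f s - f r\<bar> \<le> W s - W r" if rs: "0 \<le> r" "r \<le> s" for r s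
  proof (cases "r \<le> t \<and> t < s")
    case False
    then show ?thesis using V_dom[OF rs] rs by (auto simp: W_def)
  next
    case True
    have "\<bar>f s - f r\<bar> \<le> W s - W r + \<bar>f u - f t\<bar>" if "t < u" "u \<le> s" for u
      using True rs t that V_dom[of u s] V_dom[of r t] R_le[of u] by (simp add: W_def)
    then have "\<forall>\<^sub>F u in at_right t. \<bar>f s - f r\<bar> \<le> W s - W r + \<bar>f u - f t\<bar>"
      using True by (auto simp: eventually_at_right_field intro!: exI[of _ s])
    moreover have "((\<lambda>u. W s - W r + \<bar>f u - f t\<bar>) \<longlongrightarrow> W s - W r + \<bar>f t - f t\<bar>) (at_right t)"
      by (intro tendsto_intros rcfv_tendsto_right f t)
    ultimately have "\<bar>f s - f r\<bar> \<le> W s - W r + \<bar>f t - f t\<bar>"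
      by (intro tendsto_lowerbound[of _ _ "at_right t"]) auto
    then show ?thesis by simp
  qed
  have "V (t + 1) \<le> W (t + 1) - W 0"
    unfolding V_def by (rule total_variation_le) (use t W_dom in auto)
  moreover have "V 0 = 0"
    by (simp add: V_def total_variation_refl)
  ultimately have "R \<le> V t"
    using t by (simp add: W_def)
  have "(V \<longlongrightarrow> V t) (at_right t)"
  proof (rule order_tendstoI)
    fix a assume "a < V t"
    then have "a < V u" if "t < u" for u
      using V_mono[of t u] t that by linarith
    then show "\<forall>\<^sub>F u in at_right t. a < V u"
      by (auto simp: eventually_at_right_field intro!: exI[of _ "t + 1"])
  next
    fix a assume "V t < a"
    with \<open>R \<le> V t\<close> have "Inf (V ` {t<..}) < a" by (simp add: R_def)
    then obtain u where "t < u" "V u < a"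
      using bdd by (subst (asm) cInf_less_iff) auto
    then have "V y < a" if "t < y" "y < u" for y
      using V_mono[of y u] t that by linarith
    with \<open>t < u\<close> show "\<forall>\<^sub>F u in at_right t. V u < a"
      by (auto simp: eventually_at_right_field)
  qed
  then show ?thesis
    by (simp add: continuous_within V_def)
qed

lemma continuous_at_right_max_zero:
  fixes g :: "real \<Rightarrow> real"
  assumes "\<And>t. 0 \<le> t \<Longrightarrow> continuous (at_right t) g"
  shows "continuous (at_right a) (\<lambda>t. g (max 0 t))"
proof (cases "0 \<le> a")
  case True
  have "((\<lambda>t. g (max 0 t)) \<longlongrightarrow> g a) (at_right a) \<longleftrightarrow> (g \<longlongrightarrow> g a) (at_right a)"
    using True by (intro tendsto_cong) (auto simp: eventually_at_right_field intro!: exI[of _ "a + 1"])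
  with assms[OF True] show ?thesis
    using True by (simp add: continuous_within)
next
  case False
  have "((\<lambda>t. g (max 0 t)) \<longlongrightarrow> g 0) (at_right a) \<longleftrightarrow> ((\<lambda>_. g 0) \<longlongrightarrow> g 0) (at_right a)"
    using False by (intro tendsto_cong) (auto simp: eventually_at_right_field intro!: exI[of _ 0])
  with False show ?thesis
    by (simp add: continuous_within)
qed

lemma
  assumes f: "rcfv f"
  shows pos_var_mono: "s \<le> t \<Longrightarrow> pos_var f s \<le> pos_var f t"
    and neg_var_mono: "s \<le> t \<Longrightarrow> neg_var f s \<le> neg_var f t"
    and pos_var_right_continuous: "continuous (at_right t) (pos_var f)"
    and neg_var_right_continuous: "continuous (at_right t) (neg_var f)"
proof -
  show "pos_var f s \<le> pos_var f t" "neg_var f s \<le> neg_var f t" if "s \<le> t"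
    using abs_diff_le_total_variation[OF f, of "max 0 s" "max 0 t"] that
    unfolding pos_var_def neg_var_def by (auto simp: max_def abs_le_iff split: if_splits)
  show "continuous (at_right t) (pos_var f)" "continuous (at_right t) (neg_var f)"
    unfolding pos_var_def[abs_def] neg_var_def[abs_def]
    using total_variation_right_continuous[OF f] rcfv_continuous[OF f]
    by (auto intro!: continuous_intros continuous_at_right_max_zero)
qed

lemma pos_var_minus_neg_var: "0 \<le> t \<Longrightarrow> pos_var f t - neg_var f t = f t - f 0"
  by (simp add: pos_var_def neg_var_def field_simps)

lemma pos_var_plus_neg_var: "0 \<le> t \<Longrightarrow> pos_var f t + neg_var f t = total_variation f 0 t"
  by (simp add: pos_var_def neg_var_def field_simps)

text \<open>Monotone functions have one-sided limits, and \<open>f\<close> is a difference of two of them.\<close>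

lemma mono_tendsto_left:
  fixes g :: "real \<Rightarrow> real"
  assumes "\<And>s t. s \<le> t \<Longrightarrow> g s \<le> g t"
  shows "(g \<longlongrightarrow> Sup (g ` {..<t})) (at_left t)"
proof (rule order_tendstoI)
  have bdd: "bdd_above (g ` {..<t})"
    by (rule bdd_aboveI[of _ "g t"]) (auto intro: assms)
  fix a
  show "\<forall>\<^sub>F u in at_left t. a < g u" if a: "a < Sup (g ` {..<t})"
  proof -
    obtain u where "u < t" "a < g u"
      using a bdd by (subst (asm) less_cSup_iff) auto
    then have "a < g y" if "u < y" for y
      using assms[of u y] that by linarith
    with \<open>u < t\<close> show ?thesis
      by (auto simp: eventually_at_left_field)
  qed
  show "\<forall>\<^sub>F u in at_left t. g u < a" if a: "Sup (g ` {..<t}) < a"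
  proof -
    have "g y < a" if "y < t" for y
      using cSup_upper[OF _ bdd, of "g y"] that a by force
    then show ?thesis
      by (auto simp: eventually_at_left_field intro!: exI[of _ "t - 1"])
  qed
qed

lemma tendsto_left_lim:
  assumes "rcfv f" "0 < t"
  shows "(f \<longlongrightarrow> left_lim f t) (at_left t)"
proof -
  obtain p q where "(pos_var f \<longlongrightarrow> p) (at_left t)" "(neg_var f \<longlongrightarrow> q) (at_left t)"
    using mono_tendsto_left[of "pos_var f" t] mono_tendsto_left[of "neg_var f" t]
      pos_var_mono[OF assms(1)] neg_var_mono[OF assms(1)] by blast
  then have "((\<lambda>s. f 0 + (pos_var f s - neg_var f s)) \<longlongrightarrow> f 0 + (p - q)) (at_left t)"
    by (intro tendsto_intros)
  moreover have "\<forall>\<^sub>F s in at_left t. f 0 + (pos_var f s - neg_var f s) = f s"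
    using assms(2) pos_var_minus_neg_var
    by (auto simp: eventually_at_left_field intro!: exI[of _ 0])
  ultimately have "(f \<longlongrightarrow> f 0 + (p - q)) (at_left t)"
    by (simp add: tendsto_cong)
  then show ?thesis
    unfolding left_lim_def using tendsto_Lim[of "at_left t"] by force
qed

lemma rcfv_cong:
  assumes f: "rcfv f" and eq: "\<And>t. 0 \<le> t \<Longrightarrow> g t = f t"
  shows "rcfv g"
proof (rule rcfvI[where W = "\<lambda>_. total_variation f 0"])
  fix t :: real assume t: "0 \<le> t"
  have "\<forall>\<^sub>F s in at_right t. f s = g s"
    using t eq by (auto simp: eventually_at_right_field intro!: exI[of _ "t + 1"])
  with rcfv_tendsto_right[OF f t] have "(g \<longlongrightarrow> f t) (at_right t)"
    by (rule Lim_transform_eventually)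
  then show "continuous (at_right t) g"
    using eq[OF t] by (simp add: continuous_within)
next
  fix s t T :: real assume "0 \<le> s" "s \<le> t"
  then show "\<bar>g t - g s\<bar> \<le> total_variation f 0 t - total_variation f 0 s"
    using abs_diff_le_total_variation[OF f, of s t] eq[of s] eq[of t] by simp
qed

lemma rcfv_const: "rcfv (\<lambda>_. c)"
  by (rule rcfvI[where W = "\<lambda>_ _. 0"]) auto

lemma rcfv_linear:
  assumes f: "rcfv f" and g: "rcfv g"
  shows "rcfv (\<lambda>t. c * f t + d * g t)"
proof (rule rcfvI[where W = "\<lambda>_ t. \<bar>c\<bar> * total_variation f 0 t + \<bar>d\<bar> * total_variation g 0 t"])
  show "continuous (at_right t) (\<lambda>t. c * f t + d * g t)" if "0 \<le> t" for t
    using rcfv_continuous[OF f that] rcfv_continuous[OF g that] by (intro continuous_intros)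
  fix s t :: real assume st: "0 \<le> s" "s \<le> t"
  have "\<bar>(c * f t + d * g t) - (c * f s + d * g s)\<bar> = \<bar>c * (f t - f s) + d * (g t - g s)\<bar>"
    by (simp add: algebra_simps)
  also have "\<dots> \<le> \<bar>c\<bar> * \<bar>f t - f s\<bar> + \<bar>d\<bar> * \<bar>g t - g s\<bar>"
    by (metis abs_mult abs_triangle_ineq)
  also have "\<dots> \<le> \<bar>c\<bar> * (total_variation f 0 t - total_variation f 0 s) +
      \<bar>d\<bar> * (total_variation g 0 t - total_variation g 0 s)"
    by (intro add_mono mult_left_mono abs_diff_le_total_variation f g st) auto
  finally show "\<bar>(c * f t + d * g t) - (c * f s + d * g s)\<bar> \<le>
      (\<bar>c\<bar> * total_variation f 0 t + \<bar>d\<bar> * total_variation g 0 t) -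
      (\<bar>c\<bar> * total_variation f 0 s + \<bar>d\<bar> * total_variation g 0 s)"
    by (simp add: algebra_simps)
qed

lemma rcfv_add: "rcfv f \<Longrightarrow> rcfv g \<Longrightarrow> rcfv (\<lambda>t. f t + g t)"
  using rcfv_linear[of f g 1 1] by simp

lemma rcfv_diff: "rcfv f \<Longrightarrow> rcfv g \<Longrightarrow> rcfv (\<lambda>t. f t - g t)"
  using rcfv_linear[of f g 1 "-1"] by simp

lemma rcfv_sum: "(\<And>i. i \<in> I \<Longrightarrow> rcfv (f i)) \<Longrightarrow> rcfv (\<lambda>t. \<Sum>i\<in>I. f i t)"
  by (induction I rule: infinite_finite_induct) (auto intro: rcfv_const rcfv_add)

section \<open>Bounded Borel integrands\<close>

text \<open>Integrals over \<open>(0,T]\<close> only see the integrand there, so it is constrained nowhere else.\<close>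

definition bounded_borel :: "real \<Rightarrow> (real \<Rightarrow> real) \<Rightarrow> bool" where
  "bounded_borel T g \<longleftrightarrow>
     (\<lambda>s. indicator {0<..T} s * g s) \<in> borel_measurable borel \<and> (\<exists>C. \<forall>s\<in>{0<..T}. \<bar>g s\<bar> \<le> C)"

lemma bounded_borelI:
  assumes "(\<lambda>s. indicator {0<..T} s * g s) \<in> borel_measurable borel"
    and "\<And>s. s \<in> {0<..T} \<Longrightarrow> \<bar>g s\<bar> \<le> C"
  shows "bounded_borel T g"
  using assms unfolding bounded_borel_def by blast

lemma bounded_borel_measurable:
  "bounded_borel T g \<Longrightarrow> (\<lambda>s. indicator {0<..T} s * g s) \<in> borel_measurable borel"
  by (simp add: bounded_borel_def)

lemma bounded_borel_bound:
  assumes "bounded_borel T g"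
  obtains C where "0 \<le> C" "\<forall>s\<in>{0<..T}. \<bar>g s\<bar> \<le> C"
proof -
  obtain C where "\<forall>s\<in>{0<..T}. \<bar>g s\<bar> \<le> C"
    using assms unfolding bounded_borel_def by blast
  then show ?thesis
    by (intro that[of "\<bar>C\<bar>"]) force+
qed

lemma borel_bounded_borel:
  assumes "g \<in> borel_measurable borel" "\<And>s. s \<in> {0<..T} \<Longrightarrow> \<bar>g s\<bar> \<le> C"
  shows "bounded_borel T g"
  by (rule bounded_borelI[where C = C]) (use assms in auto)

lemma bounded_borel_indicator: "A \<in> sets borel \<Longrightarrow> bounded_borel T (indicator A)"
  by (rule borel_bounded_borel[where C = 1]) auto

lemma bounded_borel_const: "bounded_borel T (\<lambda>_. c)"
  by (rule borel_bounded_borel[where C = "\<bar>c\<bar>"]) auto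

lemma bounded_borel_add:
  assumes g: "bounded_borel T g" and h: "bounded_borel T h"
  shows "bounded_borel T (\<lambda>s. g s + h s)"
proof -
  obtain C where C: "0 \<le> C" "\<forall>s\<in>{0<..T}. \<bar>g s\<bar> \<le> C"
    using g by (rule bounded_borel_bound)
  obtain D where D: "0 \<le> D" "\<forall>s\<in>{0<..T}. \<bar>h s\<bar> \<le> D"
    using h by (rule bounded_borel_bound)
  have "(\<lambda>s. indicator {0<..T} s * g s + indicator {0<..T} s * h s) \<in> borel_measurable borel"
    using g h by (intro borel_measurable_add bounded_borel_measurable)
  then show ?thesis
    using C D by (intro bounded_borelI[of _ _ "C + D"]) (auto simp: distrib_left intro!: abs_triangle_ineq[THEN order_trans] add_mono)
qed

lemma bounded_borel_mult:
  assumes g: "bounded_borel T g" and h: "bounded_borel T h"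
  shows "bounded_borel T (\<lambda>s. g s * h s)"
proof -
  obtain C where C: "0 \<le> C" "\<forall>s\<in>{0<..T}. \<bar>g s\<bar> \<le> C"
    using g by (rule bounded_borel_bound)
  obtain D where D: "0 \<le> D" "\<forall>s\<in>{0<..T}. \<bar>h s\<bar> \<le> D"
    using h by (rule bounded_borel_bound)
  have "(\<lambda>s. (indicator {0<..T} s * g s) * (indicator {0<..T} s * h s)) \<in> borel_measurable borel"
    using g h by (intro borel_measurable_times bounded_borel_measurable)
  also have "(\<lambda>s. (indicator {0<..T} s * g s) * (indicator {0<..T} s * h s)) =
      (\<lambda>s. indicator {0<..T} s * (g s * h s))"
    by (auto simp: fun_eq_iff indicator_def)
  finally show ?thesis
    using C D by (intro bounded_borelI[of _ _ "C * D"]) (auto simp: abs_mult intro!: mult_mono)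
qed

lemma bounded_borel_scale: "bounded_borel T g \<Longrightarrow> bounded_borel T (\<lambda>s. c * g s)"
  by (intro bounded_borel_mult bounded_borel_const)

lemma bounded_borel_diff:
  "bounded_borel T g \<Longrightarrow> bounded_borel T h \<Longrightarrow> bounded_borel T (\<lambda>s. g s - h s)"
  using bounded_borel_add[of T g "\<lambda>s. - 1 * h s"] bounded_borel_scale[of T h "-1"] by simp

lemma bounded_borel_limit:
  assumes "\<And>n. bounded_borel T (U n)" "\<And>n s. s \<in> {0<..T} \<Longrightarrow> \<bar>U n s\<bar> \<le> C"
    and lim: "\<And>s. s \<in> {0<..T} \<Longrightarrow> (\<lambda>n. U n s) \<longlonglongrightarrow> u s"
  shows "bounded_borel T u"
proof (rule bounded_borelI[where C = C])
  show "(\<lambda>s. indicator {0<..T} s * u s) \<in> borel_measurable borel"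
  proof (rule borel_measurable_LIMSEQ_real)
    show "(\<lambda>s. indicator {0<..T} s * U n s) \<in> borel_measurable borel" for n
      using assms(1) by (rule bounded_borel_measurable)
    show "(\<lambda>n. indicator {0<..T} s * U n s) \<longlonglongrightarrow> indicator {0<..T} s * u s" for s
      using lim[of s] by (cases "s \<in> {0<..T}") auto
  qed
  fix s assume s: "s \<in> {0<..T}"
  have "(\<lambda>n. \<bar>U n s\<bar>) \<longlonglongrightarrow> \<bar>u s\<bar>"
    using lim[OF s] by (rule tendsto_rabs)
  then show "\<bar>u s\<bar> \<le> C"
    using assms(2)[OF s] by (intro LIMSEQ_le_const2) auto
qed

text \<open>
  The monotone class theorem in the form used below: properties that are stable under linear
  combinations and bounded convergence pass from intervals \<open>(0,t]\<close> to all bounded Borel integrands.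
\<close>

lemma bounded_borel_induct [consumes 2, case_names interval add scale limit]:
  assumes g: "bounded_borel T g"
    and T: "0 \<le> T"
    and interval: "\<And>t. 0 \<le> t \<Longrightarrow> t \<le> T \<Longrightarrow> P (indicator {0<..t})"
    and add: "\<And>g h. bounded_borel T g \<Longrightarrow> P g \<Longrightarrow> bounded_borel T h \<Longrightarrow> P h \<Longrightarrow> P (\<lambda>s. g s + h s)"
    and scale: "\<And>g c. bounded_borel T g \<Longrightarrow> P g \<Longrightarrow> P (\<lambda>s. c * g s)"
    and limit: "\<And>U u C. (\<And>n. bounded_borel T (U n)) \<Longrightarrow> (\<And>n. P (U n)) \<Longrightarrow>
       (\<And>n s. s \<in> {0<..T} \<Longrightarrow> \<bar>U n s\<bar> \<le> C) \<Longrightarrow>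
       (\<And>s. s \<in> {0<..T} \<Longrightarrow> (\<lambda>n. U n s) \<longlonglongrightarrow> u s) \<Longrightarrow> P u"
  shows "P g"
proof -
  have cong: "P h" if u: "bounded_borel T u" "P u" "\<And>s. s \<in> {0<..T} \<Longrightarrow> u s = h s" for u h :: "real \<Rightarrow> real"
  proof -
    obtain C where "0 \<le> C" "\<forall>s\<in>{0<..T}. \<bar>u s\<bar> \<le> C"
      using u(1) by (rule bounded_borel_bound)
    then show ?thesis
      using u by (rule_tac limit[of "\<lambda>_. u" C]) auto
  qed
  have diff: "P (\<lambda>s. u s - v s)" if "bounded_borel T u" "P u" "bounded_borel T v" "P v" for u v :: "real \<Rightarrow> real"
    using add[OF that(1,2) bounded_borel_scale[OF that(3), of "-1"] scale[OF that(3,4), of "-1"]] by simp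
  have P_zero: "P (\<lambda>_. 0)"
    using scale[OF bounded_borel_indicator interval[of 0], of 0] T by simp
  \<comment> \<open>Dynkin's argument: the intervals \<open>{..a}\<close> are stable under intersection and generate the Borel sets.\<close>
  have P_set: "P (indicator (A \<inter> {0<..T}))" if "A \<in> sets borel" for A :: "real set"
  proof -
    have "Int_stable (range (\<lambda>a::real. {..a}))"
      by (auto simp: Int_stable_def)
    moreover have "range (\<lambda>a::real. {..a}) \<subseteq> Pow UNIV"
      by simp
    moreover have "A \<in> sigma_sets UNIV (range (\<lambda>a. {..a::real}))"
      using that by (simp add: borel_eq_atMost)
    ultimately show ?thesis
    proof (induction rule: sigma_sets_induct_disjoint)
      case (basic A)
      then obtain a where A: "A = {..a}" by auto
      show ?case
      proof (cases "0 \<le> min a T")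
        case True
        then have "A \<inter> {0<..T} = {0<..min a T}" using A by auto
        then show ?thesis using interval[of "min a T"] True by simp
      next
        case False
        then have "A \<inter> {0<..T} = {}" using A by (auto simp: min_def split: if_splits)
        then show ?thesis using P_zero by (simp add: indicator_def[abs_def])
      qed
    next
      case empty
      then show ?case using P_zero by (simp add: indicator_def[abs_def])
    next
      case (compl A)
      then have A: "A \<in> sets borel" by (simp add: borel_eq_atMost)
      have "P (indicator {0<..T})"
        using T by (intro interval) auto
      then have "P (\<lambda>s. indicator {0<..T} s - indicator (A \<inter> {0<..T}) s)"
        using compl(2) A by (rule_tac diff) (auto intro: bounded_borel_indicator)
      also have "(\<lambda>s. indicator {0<..T} s - indicator (A \<inter> {0<..T}) s :: real) = indicator ((UNIV - A) \<inter> {0<..T})"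
        by (auto simp: fun_eq_iff indicator_def)
      finally show ?case .
    next
      case (union A)
      then have A: "A i \<in> sets borel" for i by (auto simp: borel_eq_atMost)
      define U where "U n = (indicator ((\<Union>i<n. A i) \<inter> {0<..T}) :: real \<Rightarrow> real)" for n
      have U: "P (U n)" for n
      proof (induction n)
        case 0
        then show ?case using P_zero by (simp add: U_def indicator_def[abs_def])
      next
        case (Suc n)
        have "s \<notin> A i" if "s \<in> A n" "i < n" for s i
        proof -
          have "A n \<inter> A i = {}"
            using union(1) that by (intro disjoint_family_onD[where I = UNIV]) auto
          with that show ?thesis by auto
        qed
        then have "(\<lambda>s. U n s + indicator (A n \<inter> {0<..T}) s) = U (Suc n)"
          by (auto simp: fun_eq_iff U_def indicator_def lessThan_Suc)
        moreover have "P (\<lambda>s. U n s + indicator (A n \<inter> {0<..T}) s)"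
          using A Suc union(3)
          by (rule_tac add) (auto simp: U_def intro!: bounded_borel_indicator)
        ultimately show ?case by simp
      qed
      show ?case
      proof (rule limit[of U 1])
        show "bounded_borel T (U n)" for n
          unfolding U_def using A by (intro bounded_borel_indicator) auto
        show "(\<lambda>n. U n s) \<longlonglongrightarrow> indicator (\<Union> (range A) \<inter> {0<..T}) s" for s
        proof (cases "s \<in> \<Union> (range A) \<inter> {0<..T}")
          case True
          then obtain i where "s \<in> A i" "s \<in> {0<..T}" by auto
          then have "\<forall>\<^sub>F n in sequentially. U n s = 1"
            by (intro eventually_sequentiallyI[of "Suc i"]) (auto simp: U_def indicator_def)
          with True show ?thesis
            by (simp add: tendsto_eventually)
        next
          case False
          then have "U n s = 0" for n by (auto simp: U_def indicator_def)
          with False show ?thesis by auto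
        qed
      qed (use U in \<open>auto simp: U_def indicator_def\<close>)
    qed
  qed
  have bb_nonneg: "bounded_borel T (\<lambda>s. indicator {0<..T} s * u s)"
    if "u \<in> borel_measurable borel" "\<And>s. 0 \<le> u s" "\<And>s. u s \<le> C" for u C
    using that by (intro bounded_borel_mult bounded_borel_indicator borel_bounded_borel[where C = C]) auto
  have P_nonneg: "P (\<lambda>s. indicator {0<..T} s * u s)"
    if "u \<in> borel_measurable borel" "\<And>s. 0 \<le> u s" "\<And>s. u s \<le> C" for u C
    using that
  proof (induction arbitrary: C rule: borel_measurable_induct_real)
    case (set A)
    then show ?case using P_set[OF set(1)] by (auto simp: indicator_inter_arith[abs_def] mult.commute)
  next
    case (mult u c)
    show ?case
    proof (cases "c = 0")
      case False
      then have "0 < c" using mult by simp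
      then have "u s \<le> C / c" for s
        using mult.prems(1)[of s] by (simp add: field_simps)
      then have "bounded_borel T (\<lambda>s. indicator {0<..T} s * u s)" "P (\<lambda>s. indicator {0<..T} s * u s)"
        using mult by (auto intro!: bounded_borel_mult bounded_borel_indicator borel_bounded_borel[where C = "C / c"] mult.IH)
      then have "P (\<lambda>s. c * (indicator {0<..T} s * u s))"
        by (rule scale)
      then show ?thesis by (simp add: ac_simps)
    qed (use P_zero in simp)
  next
    case (add u v)
    have uv: "u s \<le> C" "v s \<le> C" for s
      using add.prems(1)[of s] add.hyps(2)[of s] add.hyps(4)[of s] by linarith+
    have "P (\<lambda>s. indicator {0<..T} s * v s + indicator {0<..T} s * u s)"
      using add.hyps uv by (rule_tac assms(4)) (blast intro: bb_nonneg add.IH)+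
    then show ?case by (simp add: distrib_left)
  next
    case (seq U)
    have le: "U i s \<le> u s" for i s
      using seq(3,4) by (intro incseq_le[of "\<lambda>i. U i s"]) (auto simp: incseq_def le_fun_def)
    then have U_le: "U i s \<le> C" for i s
      using seq.prems(1)[of s] order_trans by blast
    show ?case
    proof (rule limit[of "\<lambda>i s. indicator {0<..T} s * U i s" C])
      show "bounded_borel T (\<lambda>s. indicator {0<..T} s * U n s)" for n
        using seq U_le by (intro bb_nonneg)
      show "P (\<lambda>s. indicator {0<..T} s * U n s)" for n
        using U_le by (rule seq.IH)
      show "(\<lambda>n. indicator {0<..T} s * U n s) \<longlonglongrightarrow> indicator {0<..T} s * u s" for s
        using seq(4) by (intro tendsto_intros) auto
      show "\<bar>indicator {0<..T} s * U n s\<bar> \<le> C" for n s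
        using seq(2)[of n s] U_le[of n s] order_trans[OF seq(2)[of n s] U_le[of n s]]
        by (auto simp: indicator_def)
    qed
  qed
  obtain C where C: "0 \<le> C" "\<forall>s\<in>{0<..T}. \<bar>g s\<bar> \<le> C"
    using g by (rule bounded_borel_bound)
  \<comment> \<open>Adding the bound \<open>C\<close> makes the integrand nonnegative.\<close>
  define h where "h s = indicator {0<..T} s * g s" for s
  have h: "h \<in> borel_measurable borel"
    unfolding h_def[abs_def] using g by (rule bounded_borel_measurable)
  have hC: "\<bar>h s\<bar> \<le> C" for s
    using C by (auto simp: h_def indicator_def)
  have hC_bounds: "0 \<le> h s + C" "h s + C \<le> C + C" for s
    using hC[of s] by (auto simp: abs_le_iff)
  have bb: "bounded_borel T (\<lambda>s. indicator {0<..T} s * (h s + C))"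
    "bounded_borel T (\<lambda>s. indicator {0<..T} s * C)"
    using h hC_bounds C bb_nonneg[of "\<lambda>s. h s + C" "C + C"] bb_nonneg[of "\<lambda>_. C" C] by auto
  have "P (\<lambda>s. indicator {0<..T} s * (h s + C) - indicator {0<..T} s * C)"
  proof (rule diff)
    show "P (\<lambda>s. indicator {0<..T} s * (h s + C))"
      using h hC_bounds by (rule_tac P_nonneg[of _ "C + C"]) auto
    show "P (\<lambda>s. indicator {0<..T} s * C)"
      using C by (rule_tac P_nonneg[of _ "C"]) auto
  qed (rule bb)+
  moreover note bounded_borel_diff[OF bb]
  ultimately show "P g"
    by (rule_tac cong[rotated]) (auto simp: h_def)
qed

section \<open>Integrals as bounded-convergence functionals\<close>

text \<open>
  Every linear identity between integrals below is obtained by recognising both sides as functionals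
  of the integrand of the following kind and comparing them on intervals only; this replaces
  manipulations of Jordan decompositions, which do not respect sums or products of integrators.
\<close>

definition bounded_convergence_functional :: "real \<Rightarrow> ((real \<Rightarrow> real) \<Rightarrow> real) \<Rightarrow> bool" where
  "bounded_convergence_functional T \<Phi> \<longleftrightarrow>
     (\<forall>g h. bounded_borel T g \<longrightarrow> bounded_borel T h \<longrightarrow> \<Phi> (\<lambda>s. g s + h s) = \<Phi> g + \<Phi> h) \<and>
     (\<forall>g c. bounded_borel T g \<longrightarrow> \<Phi> (\<lambda>s. c * g s) = c * \<Phi> g) \<and>
     (\<forall>U u C. (\<forall>n. bounded_borel T (U n)) \<longrightarrow> (\<forall>n. \<forall>s\<in>{0<..T}. \<bar>U n s\<bar> \<le> C) \<longrightarrow>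
        (\<forall>s\<in>{0<..T}. (\<lambda>n. U n s) \<longlonglongrightarrow> u s) \<longrightarrow> (\<lambda>n. \<Phi> (U n)) \<longlonglongrightarrow> \<Phi> u)"

lemma bounded_convergence_functionalI:
  assumes "\<And>g h. bounded_borel T g \<Longrightarrow> bounded_borel T h \<Longrightarrow> \<Phi> (\<lambda>s. g s + h s) = \<Phi> g + \<Phi> h"
    and "\<And>g c. bounded_borel T g \<Longrightarrow> \<Phi> (\<lambda>s. c * g s) = c * \<Phi> g"
    and "\<And>U u C. (\<And>n. bounded_borel T (U n)) \<Longrightarrow> (\<And>n s. s \<in> {0<..T} \<Longrightarrow> \<bar>U n s\<bar> \<le> C) \<Longrightarrow>
        (\<And>s. s \<in> {0<..T} \<Longrightarrow> (\<lambda>n. U n s) \<longlonglongrightarrow> u s) \<Longrightarrow> bounded_borel T u \<Longrightarrow> (\<lambda>n. \<Phi> (U n)) \<longlonglongrightarrow> \<Phi> u"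
  shows "bounded_convergence_functional T \<Phi>"
  unfolding bounded_convergence_functional_def
proof (intro conjI allI impI)
  fix U :: "nat \<Rightarrow> real \<Rightarrow> real" and u C
  assume U: "\<forall>n. bounded_borel T (U n)" "\<forall>n. \<forall>s\<in>{0<..T}. \<bar>U n s\<bar> \<le> C"
    "\<forall>s\<in>{0<..T}. (\<lambda>n. U n s) \<longlonglongrightarrow> u s"
  then have "bounded_borel T u"
    by (rule_tac bounded_borel_limit[of T U C]) auto
  with U show "(\<lambda>n. \<Phi> (U n)) \<longlonglongrightarrow> \<Phi> u"
    by (intro assms(3)[of U C]) auto
qed (rule assms(1,2); assumption)+

lemma
  assumes "bounded_convergence_functional T \<Phi>"
  shows functional_add: "bounded_borel T g \<Longrightarrow> bounded_borel T h \<Longrightarrow> \<Phi> (\<lambda>s. g s + h s) = \<Phi> g + \<Phi> h"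
    and functional_scale: "bounded_borel T g \<Longrightarrow> \<Phi> (\<lambda>s. c * g s) = c * \<Phi> g"
    and functional_limit: "(\<And>n. bounded_borel T (U n)) \<Longrightarrow> (\<And>n s. s \<in> {0<..T} \<Longrightarrow> \<bar>U n s\<bar> \<le> C) \<Longrightarrow>
        (\<And>s. s \<in> {0<..T} \<Longrightarrow> (\<lambda>n. U n s) \<longlonglongrightarrow> u s) \<Longrightarrow> (\<lambda>n. \<Phi> (U n)) \<longlonglongrightarrow> \<Phi> u"
proof -
  note \<Phi> = assms[unfolded bounded_convergence_functional_def]
  show "bounded_borel T g \<Longrightarrow> bounded_borel T h \<Longrightarrow> \<Phi> (\<lambda>s. g s + h s) = \<Phi> g + \<Phi> h"
    by (rule \<Phi>[THEN conjunct1, rule_format])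
  show "bounded_borel T g \<Longrightarrow> \<Phi> (\<lambda>s. c * g s) = c * \<Phi> g"
    by (rule \<Phi>[THEN conjunct2, THEN conjunct1, rule_format])
  assume "\<And>n. bounded_borel T (U n)" "\<And>n s. s \<in> {0<..T} \<Longrightarrow> \<bar>U n s\<bar> \<le> C"
    "\<And>s. s \<in> {0<..T} \<Longrightarrow> (\<lambda>n. U n s) \<longlonglongrightarrow> u s"
  then show "(\<lambda>n. \<Phi> (U n)) \<longlonglongrightarrow> \<Phi> u"
    by (intro \<Phi>[THEN conjunct2, THEN conjunct2, rule_format, of U C]) auto
qed

lemma functional_unique:
  assumes T: "0 \<le> T" and \<Phi>: "bounded_convergence_functional T \<Phi>" and \<Psi>: "bounded_convergence_functional T \<Psi>"
    and eq: "\<And>t. 0 \<le> t \<Longrightarrow> t \<le> T \<Longrightarrow> \<Phi> (indicator {0<..t}) = \<Psi> (indicator {0<..t})"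
    and g: "bounded_borel T g"
  shows "\<Phi> g = \<Psi> g"
  using g T
proof (induction rule: bounded_borel_induct)
  case (limit U u C)
  have "(\<lambda>n. \<Phi> (U n)) \<longlonglongrightarrow> \<Phi> u"
    by (rule functional_limit[OF \<Phi>, of U C]) (fact limit)+
  moreover have "(\<lambda>n. \<Psi> (U n)) \<longlonglongrightarrow> \<Psi> u"
    by (rule functional_limit[OF \<Psi>, of U C]) (fact limit)+
  ultimately show ?case
    using limit(4) by (simp add: LIMSEQ_unique)
next
  case (add g h)
  then show ?case
    by (simp only: functional_add[OF \<Phi>] functional_add[OF \<Psi>])
next
  case (scale g c)
  then show ?case
    by (simp only: functional_scale[OF \<Phi>] functional_scale[OF \<Psi>])
qed (rule eq)

lemma functional_sum:
  assumes "\<And>i. i \<in> I \<Longrightarrow> bounded_convergence_functional T (\<Phi> i)"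
  shows "bounded_convergence_functional T (\<lambda>g. \<Sum>i\<in>I. \<Phi> i g)"
proof (rule bounded_convergence_functionalI)
  fix U u C
  assume "\<And>n. bounded_borel T (U n)" "\<And>n s. s \<in> {0<..T} \<Longrightarrow> \<bar>U n s\<bar> \<le> C"
    "\<And>s. s \<in> {0<..T} \<Longrightarrow> (\<lambda>n. U n s) \<longlonglongrightarrow> u s"
  then show "(\<lambda>n. \<Sum>i\<in>I. \<Phi> i (U n)) \<longlonglongrightarrow> (\<Sum>i\<in>I. \<Phi> i u)"
    using assms by (intro tendsto_sum, rule_tac functional_limit[where T = T and U = U and C = C]) auto
next
  fix g h :: "real \<Rightarrow> real" assume "bounded_borel T g" "bounded_borel T h"
  then have "(\<Sum>i\<in>I. \<Phi> i (\<lambda>s. g s + h s)) = (\<Sum>i\<in>I. \<Phi> i g + \<Phi> i h)"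
    using assms by (intro sum.cong functional_add) auto
  then show "(\<Sum>i\<in>I. \<Phi> i (\<lambda>s. g s + h s)) = (\<Sum>i\<in>I. \<Phi> i g) + (\<Sum>i\<in>I. \<Phi> i h)"
    by (simp only: sum.distrib)
next
  fix g :: "real \<Rightarrow> real" and c assume "bounded_borel T g"
  then have "(\<Sum>i\<in>I. \<Phi> i (\<lambda>s. c * g s)) = (\<Sum>i\<in>I. c * \<Phi> i g)"
    using assms by (intro sum.cong functional_scale) auto
  then show "(\<Sum>i\<in>I. \<Phi> i (\<lambda>s. c * g s)) = c * (\<Sum>i\<in>I. \<Phi> i g)"
    by (simp only: sum_distrib_left)
qed

lemma functional_linear:
  assumes \<Phi>: "bounded_convergence_functional T \<Phi>" and \<Psi>: "bounded_convergence_functional T \<Psi>"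
  shows "bounded_convergence_functional T (\<lambda>g. c * \<Phi> g + d * \<Psi> g)"
proof (rule bounded_convergence_functionalI)
  fix U u C
  assume "\<And>n. bounded_borel T (U n)" "\<And>n s. s \<in> {0<..T} \<Longrightarrow> \<bar>U n s\<bar> \<le> C"
    "\<And>s. s \<in> {0<..T} \<Longrightarrow> (\<lambda>n. U n s) \<longlonglongrightarrow> u s"
  then show "(\<lambda>n. c * \<Phi> (U n) + d * \<Psi> (U n)) \<longlonglongrightarrow> c * \<Phi> u + d * \<Psi> u"
    by (intro tendsto_intros functional_limit[OF \<Phi>, of U C] functional_limit[OF \<Psi>, of U C])
next
  fix g h :: "real \<Rightarrow> real" assume "bounded_borel T g" "bounded_borel T h"
  then show "c * \<Phi> (\<lambda>s. g s + h s) + d * \<Psi> (\<lambda>s. g s + h s) = c * \<Phi> g + d * \<Psi> g + (c * \<Phi> h + d * \<Psi> h)"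
    by (simp only: functional_add[OF \<Phi>] functional_add[OF \<Psi>]) (simp add: algebra_simps)
next
  fix g :: "real \<Rightarrow> real" and e assume "bounded_borel T g"
  then show "c * \<Phi> (\<lambda>s. e * g s) + d * \<Psi> (\<lambda>s. e * g s) = e * (c * \<Phi> g + d * \<Psi> g)"
    by (simp only: functional_scale[OF \<Phi>] functional_scale[OF \<Psi>]) (simp add: algebra_simps)
qed

text \<open>
  Multiplication by a fixed integrand preserves the class; this is how associativity of the integral
  enters.
\<close>

lemma functional_density:
  assumes \<Phi>: "bounded_convergence_functional T \<Phi>" and h: "bounded_borel T h"
  shows "bounded_convergence_functional T (\<lambda>g. \<Phi> (\<lambda>s. g s * h s))"
proof (rule bounded_convergence_functionalI)
  fix U u C
  assume U: "\<And>n. bounded_borel T (U n)" "\<And>n s. s \<in> {0<..T} \<Longrightarrow> \<bar>U n s\<bar> \<le> C"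
    "\<And>s. s \<in> {0<..T} \<Longrightarrow> (\<lambda>n. U n s) \<longlonglongrightarrow> u s"
  obtain D where D: "0 \<le> D" "\<forall>s\<in>{0<..T}. \<bar>h s\<bar> \<le> D"
    using h by (rule bounded_borel_bound)
  show "(\<lambda>n. \<Phi> (\<lambda>s. U n s * h s)) \<longlonglongrightarrow> \<Phi> (\<lambda>s. u s * h s)"
  proof (rule functional_limit[OF \<Phi>])
    show "\<bar>U n s * h s\<bar> \<le> \<bar>C\<bar> * D" if "s \<in> {0<..T}" for n s
      using U(2)[OF that, of n] D that by (auto simp: abs_mult intro!: mult_mono)
  qed (use U h in \<open>auto intro!: tendsto_intros bounded_borel_mult\<close>)
next
  fix g k :: "real \<Rightarrow> real" assume "bounded_borel T g" "bounded_borel T k"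
  then show "\<Phi> (\<lambda>s. (g s + k s) * h s) = \<Phi> (\<lambda>s. g s * h s) + \<Phi> (\<lambda>s. k s * h s)"
    using h by (simp only: distrib_right functional_add[OF \<Phi>] bounded_borel_mult)
next
  fix g :: "real \<Rightarrow> real" and c assume "bounded_borel T g"
  then show "\<Phi> (\<lambda>s. c * g s * h s) = c * \<Phi> (\<lambda>s. g s * h s)"
    using h by (simp only: mult.assoc functional_scale[OF \<Phi>] bounded_borel_mult)
qed

lemma
  assumes F: "\<And>s t. s \<le> t \<Longrightarrow> F s \<le> F t" "\<And>t. continuous (at_right t) F"
    and ab: "0 \<le> a" "b \<le> T"
  shows set_integrable_interval_measure:
      "bounded_borel T g \<Longrightarrow> set_integrable (interval_measure F) {a<..b} g"
    and interval_measure_functional: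
      "bounded_convergence_functional T (\<lambda>g. LINT s:{a<..b}|interval_measure F. g s)"
proof -
  have fin: "emeasure (interval_measure F) {a<..b} < \<infinity>"
    using F by (simp add: emeasure_interval_measure_Ioc_eq)
  have meas: "(\<lambda>s. indicator {a<..b} s *\<^sub>R g s) \<in> borel_measurable borel" if "bounded_borel T g" for g
  proof -
    have "(\<lambda>s. indicator {a<..b} s * (indicator {0<..T} s * g s)) \<in> borel_measurable borel"
      using bounded_borel_measurable[OF that] by measurable
    also have "(\<lambda>s. indicator {a<..b} s * (indicator {0<..T} s * g s)) = (\<lambda>s. indicator {a<..b} s *\<^sub>R g s)"
      using ab by (auto simp: fun_eq_iff indicator_def)
    finally show ?thesis .
  qed
  have int: "set_integrable (interval_measure F) {a<..b} g" if bb: "bounded_borel T g" for g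
  proof -
    obtain C where "0 \<le> C" "\<forall>s\<in>{0<..T}. \<bar>g s\<bar> \<le> C"
      using bb by (rule bounded_borel_bound)
    then show ?thesis
      unfolding set_integrable_def using fin meas[OF bb] ab
      by (intro integrableI_bounded_set[where A = "{a<..b}" and B = C])
         (auto simp: measurable_cong_sets[OF sets_interval_measure refl])
  qed
  show "set_integrable (interval_measure F) {a<..b} g" if "bounded_borel T g"
    using int[OF that] .
  show "bounded_convergence_functional T (\<lambda>g. LINT s:{a<..b}|interval_measure F. g s)"
  proof (rule bounded_convergence_functionalI)
    fix U u C
    assume U: "\<And>n. bounded_borel T (U n)" "\<And>n s. s \<in> {0<..T} \<Longrightarrow> \<bar>U n s\<bar> \<le> C"
      "\<And>s. s \<in> {0<..T} \<Longrightarrow> (\<lambda>n. U n s) \<longlonglongrightarrow> u s" and u: "bounded_borel T u"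
    show "(\<lambda>n. LINT s:{a<..b}|interval_measure F. U n s) \<longlonglongrightarrow> (LINT s:{a<..b}|interval_measure F. u s)"
      unfolding set_lebesgue_integral_def
    proof (rule integral_dominated_convergence)
      show "integrable (interval_measure F) (\<lambda>s. indicator {a<..b} s *\<^sub>R C)"
        using int[OF bounded_borel_const] by (simp add: set_integrable_def)
      show "AE s in interval_measure F. (\<lambda>n. indicator {a<..b} s *\<^sub>R U n s) \<longlonglongrightarrow> indicator {a<..b} s *\<^sub>R u s"
        using U(3) ab by (intro AE_I2) (auto simp: indicator_def)
      show "AE s in interval_measure F. norm (indicator {a<..b} s *\<^sub>R U n s) \<le> indicator {a<..b} s *\<^sub>R C" for n
        using U(2) ab by (intro AE_I2) (auto simp: indicator_def)
    qed (use meas[OF u] meas[OF U(1)] in \<open>auto simp: measurable_cong_sets[OF sets_interval_measure refl]\<close>)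
  qed (use int in \<open>auto simp: set_integral_add\<close>)
qed

section \<open>Lebesgue--Stieltjes integrals\<close>

lemma ls_integrable_bounded_borel:
  assumes "rcfv f" "0 \<le> a" "bounded_borel b g"
  shows "ls_integrable g f a b"
  unfolding ls_integrable_def using assms
  by (auto intro!: set_integrable_interval_measure[where T = b]
      pos_var_mono neg_var_mono pos_var_right_continuous neg_var_right_continuous)

lemma ls_integral_functional:
  assumes f: "rcfv f" and "0 \<le> a" "b \<le> T"
  shows "bounded_convergence_functional T (\<lambda>g. ls_integral g f a b)"
proof -
  have "bounded_convergence_functional T (\<lambda>g. 1 * (LINT s:{a<..b}|interval_measure (pos_var f). g s) +
      (-1) * (LINT s:{a<..b}|interval_measure (neg_var f). g s))"
    using assms by (intro functional_linear interval_measure_functional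
      pos_var_mono neg_var_mono pos_var_right_continuous neg_var_right_continuous)
  then show ?thesis
    by (simp add: ls_integral_def)
qed

lemma ls_integral_cong:
  assumes "\<And>s. s \<in> {a<..b} \<Longrightarrow> g s = h s"
  shows "ls_integral g f a b = ls_integral h f a b"
proof -
  have "(\<lambda>s. indicator {a<..b} s *\<^sub>R g s) = (\<lambda>s. indicator {a<..b} s *\<^sub>R h s)"
    using assms by (auto simp: fun_eq_iff indicator_def)
  then show ?thesis
    by (simp add: ls_integral_def set_lebesgue_integral_def)
qed

lemma ls_integral_refl [simp]: "ls_integral g f a a = 0"
  by (simp add: ls_integral_def set_lebesgue_integral_def)

lemma ls_integral_const:
  assumes f: "rcfv f" and ab: "0 \<le> a" "a \<le> b"
  shows "ls_integral (\<lambda>_. c) f a b = c * (f b - f a)"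
proof -
  note F = pos_var_mono[OF f] neg_var_mono[OF f] pos_var_right_continuous[OF f] neg_var_right_continuous[OF f]
  have "ls_integral (\<lambda>_. c) f a b = c * (pos_var f b - pos_var f a) - c * (neg_var f b - neg_var f a)"
    using ab F unfolding ls_integral_def
    by (simp add: set_lebesgue_integral_def measure_interval_measure_Ioc)
  also have "\<dots> = c * ((pos_var f b - neg_var f b) - (pos_var f a - neg_var f a))"
    by (simp add: algebra_simps)
  finally show ?thesis
    using ab by (simp add: pos_var_minus_neg_var)
qed

lemma ls_integral_restrict:
  assumes "0 \<le> a" "b \<le> T"
  shows "ls_integral (\<lambda>s. indicator {a<..b} s * g s) f 0 T = ls_integral g f a b"
proof -
  have "(\<lambda>s. indicator {0<..T} s * (indicator {a<..b} s * g s)) = (\<lambda>s. indicator {a<..b} s * g s)"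
    using assms by (auto simp: fun_eq_iff indicator_def)
  then show ?thesis
    by (simp add: ls_integral_def set_lebesgue_integral_def)
qed

lemma ls_integral_indicator:
  assumes "rcfv f" "0 \<le> t" "t \<le> T"
  shows "ls_integral (indicator {0<..t}) f 0 T = f t - f 0"
  using ls_integral_restrict[of 0 t T "\<lambda>_. 1" f] ls_integral_const[of f 0 t 1] assms by simp

lemma ls_integral_diff:
  assumes "rcfv f" "0 \<le> a" "bounded_borel b g" "bounded_borel b h"
  shows "ls_integral (\<lambda>s. g s - h s) f a b = ls_integral g f a b - ls_integral h f a b"
proof -
  note F = ls_integral_functional[OF assms(1,2) order_refl]
  have "ls_integral (\<lambda>s. g s + (-1) * h s) f a b = ls_integral g f a b + ls_integral (\<lambda>s. (-1) * h s) f a b"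
    by (rule functional_add[OF F assms(3) bounded_borel_scale[OF assms(4)]])
  also have "ls_integral (\<lambda>s. (-1) * h s) f a b = (-1) * ls_integral h f a b"
    by (rule functional_scale[OF F assms(4)])
  finally show ?thesis by simp
qed

lemma ls_integral_split:
  assumes f: "rcfv f" and ab: "0 \<le> a" "a \<le> b" and g: "bounded_borel b g"
  shows "ls_integral g f 0 b = ls_integral g f 0 a + ls_integral g f a b"
proof -
  have "ls_integral g f 0 b =
      ls_integral (\<lambda>s. indicator {0<..a} s * g s + indicator {a<..b} s * g s) f 0 b"
    using ab by (intro ls_integral_cong) (auto simp: indicator_def)
  also have "\<dots> = ls_integral (\<lambda>s. indicator {0<..a} s * g s) f 0 b + ls_integral (\<lambda>s. indicator {a<..b} s * g s) f 0 b"
    using f g by (intro functional_add[OF ls_integral_functional] bounded_borel_mult bounded_borel_indicator) auto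
  finally show ?thesis
    using ab by (simp add: ls_integral_restrict)
qed

text \<open>This identifies an integral once a functional with the right values on intervals is at hand.\<close>

lemma ls_integral_eqI:
  assumes "rcfv f" "0 \<le> T" "bounded_convergence_functional T \<Phi>"
    and "\<And>t. 0 \<le> t \<Longrightarrow> t \<le> T \<Longrightarrow> \<Phi> (indicator {0<..t}) = f t - f 0"
    and "bounded_borel T g"
  shows "ls_integral g f 0 T = \<Phi> g"
  by (rule functional_unique[of T "\<lambda>g. ls_integral g f 0 T" \<Phi>])
     (use assms in \<open>auto simp: ls_integral_indicator intro: ls_integral_functional\<close>)

lemma ls_integral_sum_integrator:
  assumes "\<And>i. i \<in> I \<Longrightarrow> rcfv (f i)" "0 \<le> T" "bounded_borel T g"
  shows "ls_integral g (\<lambda>t. \<Sum>i\<in>I. f i t) 0 T = (\<Sum>i\<in>I. ls_integral g (f i) 0 T)"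
  by (rule ls_integral_eqI[where \<Phi> = "\<lambda>g. \<Sum>i\<in>I. ls_integral g (f i) 0 T"])
     (use assms in \<open>auto simp: ls_integral_indicator sum_subtractf intro!: rcfv_sum functional_sum ls_integral_functional\<close>)

lemma ls_integral_linear_integrator:
  assumes "rcfv f" "rcfv h" "0 \<le> T" "bounded_borel T g"
  shows "ls_integral g (\<lambda>t. c * f t + d * h t) 0 T = c * ls_integral g f 0 T + d * ls_integral g h 0 T"
  by (rule ls_integral_eqI[where \<Phi> = "\<lambda>g. c * ls_integral g f 0 T + d * ls_integral g h 0 T"])
     (use assms in \<open>auto simp: ls_integral_indicator algebra_simps
        intro!: rcfv_linear functional_linear ls_integral_functional\<close>)

lemma ls_integral_density:
  assumes "rcfv f" "rcfv F" "0 \<le> T" "bounded_borel T h" "bounded_borel T g"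
    and "\<And>t. 0 \<le> t \<Longrightarrow> t \<le> T \<Longrightarrow> F t - F 0 = ls_integral h f 0 t"
  shows "ls_integral g F 0 T = ls_integral (\<lambda>s. g s * h s) f 0 T"
proof (rule ls_integral_eqI[where \<Phi> = "\<lambda>g. ls_integral (\<lambda>s. g s * h s) f 0 T"])
  show "bounded_convergence_functional T (\<lambda>g. ls_integral (\<lambda>s. g s * h s) f 0 T)"
    by (rule functional_density[OF ls_integral_functional]) (use assms in auto)
qed (use assms in \<open>auto simp: ls_integral_restrict\<close>)

lemma abs_ls_integral_le:
  assumes f: "rcfv f" and ab: "0 \<le> a" "a \<le> b" and g: "bounded_borel b g"
    and C: "\<And>s. s \<in> {a<..b} \<Longrightarrow> \<bar>g s\<bar> \<le> C"
  shows "\<bar>ls_integral g f a b\<bar> \<le> C * (total_variation f 0 b - total_variation f 0 a)"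
proof -
  have bound: "\<bar>LINT s:{a<..b}|interval_measure F. g s\<bar> \<le> C * (F b - F a)"
    if F: "\<And>s t. s \<le> t \<Longrightarrow> F s \<le> F t" "\<And>t. continuous (at_right t) F" for F
  proof -
    have int: "set_integrable (interval_measure F) {a<..b} h" if "bounded_borel b h" for h
      using F ab that by (intro set_integrable_interval_measure[where T = b]) auto
    have "\<bar>LINT s:{a<..b}|interval_measure F. g s\<bar> \<le> (LINT s:{a<..b}|interval_measure F. C)"
      unfolding set_lebesgue_integral_def
    proof (rule integral_abs_bound_integral)
      show "\<bar>indicator {a<..b} s *\<^sub>R g s\<bar> \<le> indicator {a<..b} s *\<^sub>R C" for s
        using C[of s] by (auto simp: indicator_def)
    qed (use int[OF g] int[OF bounded_borel_const[of b C]] in \<open>auto simp: set_integrable_def\<close>)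
    also have "\<dots> = C * (F b - F a)"
      using ab F by (simp add: set_lebesgue_integral_def measure_interval_measure_Ioc)
    finally show ?thesis .
  qed
  have "\<bar>ls_integral g f a b\<bar> \<le> C * (pos_var f b - pos_var f a) + C * (neg_var f b - neg_var f a)"
    unfolding ls_integral_def
    by (intro abs_triangle_ineq4[THEN order_trans] add_mono bound
      pos_var_mono neg_var_mono pos_var_right_continuous neg_var_right_continuous f)
  also have "\<dots> = C * ((pos_var f b + neg_var f b) - (pos_var f a + neg_var f a))"
    by (simp add: algebra_simps)
  finally show ?thesis
    using ab by (simp add: pos_var_plus_neg_var)
qed

text \<open>
  The increments of the integral are dominated by the increments of a multiple of the variation of
  the integrator.  The factor depends on the time horizon, as the integrand is only locally bounded.
\<close>

lemma rcfv_ls_integral: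
  assumes f: "rcfv f" and g: "\<And>T. 0 \<le> T \<Longrightarrow> bounded_borel T g"
  shows "rcfv (\<lambda>t. ls_integral g f 0 t)"
proof -
  define V where "V = total_variation f 0"
  have "\<exists>C. \<forall>s\<in>{0<..T}. \<bar>g s\<bar> \<le> C" if "0 \<le> T" for T
    using g[OF that] by (auto simp: bounded_borel_def)
  then have "\<forall>T\<in>{0..}. \<exists>C. \<forall>s\<in>{0<..T}. \<bar>g s\<bar> \<le> C"
    by simp
  then obtain C where "\<forall>T\<in>{0..}. \<forall>s\<in>{0<..T}. \<bar>g s\<bar> \<le> C T"
    by (rule bchoice[THEN exE])
  then have C: "\<bar>g s\<bar> \<le> C T" if "0 \<le> T" "s \<in> {0<..T}" for T s
    using that by blast
  have inc: "\<bar>ls_integral g f 0 t - ls_integral g f 0 s\<bar> \<le> C T * V t - C T * V s"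
    if "0 \<le> s" "s \<le> t" "t \<le> T" for s t T
  proof -
    have "\<bar>ls_integral g f s t\<bar> \<le> C T * (V t - V s)"
      unfolding V_def using that
      by (rule_tac abs_ls_integral_le[OF f]) (auto intro!: g C)
    moreover have "ls_integral g f 0 t = ls_integral g f 0 s + ls_integral g f s t"
      using that by (rule_tac ls_integral_split[OF f]) (auto intro!: g)
    ultimately show ?thesis
      by (simp add: right_diff_distrib)
  qed
  show ?thesis
  proof (rule rcfvI[where W = "\<lambda>T t. C T * V t"])
    fix t :: real assume t: "0 \<le> t"
    have "((\<lambda>u. C (t + 1) * V u - C (t + 1) * V t) \<longlongrightarrow> C (t + 1) * V t - C (t + 1) * V t) (at_right t)"
      using total_variation_right_continuous[OF f t]
      by (intro tendsto_intros) (simp add: continuous_within V_def)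
    then have lim: "((\<lambda>u. C (t + 1) * V u - C (t + 1) * V t) \<longlongrightarrow> 0) (at_right t)"
      by simp
    have "((\<lambda>u. ls_integral g f 0 u - ls_integral g f 0 t) \<longlongrightarrow> 0) (at_right t)"
    proof (rule Lim_null_comparison[of _ "\<lambda>u. C (t + 1) * V u - C (t + 1) * V t"])
      show "\<forall>\<^sub>F u in at_right t. norm (ls_integral g f 0 u - ls_integral g f 0 t) \<le> C (t + 1) * V u - C (t + 1) * V t"
        using t inc[of t _ "t + 1"] by (auto simp: eventually_at_right_field intro!: exI[of _ "t + 1"])
    qed (rule lim)
    then show "continuous (at_right t) (\<lambda>t. ls_integral g f 0 t)"
      by (simp add: continuous_within LIM_zero_iff)
  qed (rule inc)
qed

text \<open>
  The integral over \<open>(r,t]\<close> tends to \<open>g(t)\<close> times the mass of the point \<open>t\<close> as \<open>r\<close> increases to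
  \<open>t\<close>; the case \<open>g = 1\<close> identifies this mass.
\<close>

lemma ls_integral_jump:
  assumes f: "rcfv f" and t: "0 < t" and g: "bounded_borel t g"
    and r: "\<And>n. 0 \<le> r n" "\<And>n. r n < t" "r \<longlonglongrightarrow> t"
  shows "(\<lambda>n. ls_integral g f 0 t - ls_integral g f 0 (r n)) \<longlonglongrightarrow> g t * (f t - left_lim f t)"
proof -
  have lim: "(\<lambda>n. ls_integral h f 0 t - ls_integral h f 0 (r n)) \<longlonglongrightarrow> ls_integral (\<lambda>s. h t * indicator {t} s) f 0 t"
    if h: "bounded_borel t h" for h
  proof -
    obtain C where C: "0 \<le> C" "\<forall>s\<in>{0<..t}. \<bar>h s\<bar> \<le> C"
      using h by (rule bounded_borel_bound)
    have "(\<lambda>n. ls_integral (\<lambda>s. indicator {r n<..t} s * h s) f 0 t) \<longlonglongrightarrow> ls_integral (\<lambda>s. h t * indicator {t} s) f 0 t"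
    proof (rule functional_limit[OF ls_integral_functional[OF f], where C = C])
      show "(\<lambda>n. indicator {r n<..t} s * h s) \<longlonglongrightarrow> h t * indicator {t} s" if s: "s \<in> {0<..t}" for s
      proof (cases "s = t")
        case False
        then have "\<forall>\<^sub>F n in sequentially. s < r n"
          using order_tendstoD(1)[OF r(3), of s] s by auto
        then have "\<forall>\<^sub>F n in sequentially. indicator {r n<..t} s * h s = 0"
          by eventually_elim auto
        with False show ?thesis
          by (simp add: tendsto_eventually)
      qed (use r in simp)
      show "\<bar>indicator {r n<..t} s * h s\<bar> \<le> C" if "s \<in> {0<..t}" for n s
        using that C by (auto simp: indicator_def)
    qed (use h in \<open>auto intro!: bounded_borel_mult bounded_borel_indicator\<close>)
    moreover have "ls_integral (\<lambda>s. indicator {r n<..t} s * h s) f 0 t = ls_integral h f 0 t - ls_integral h f 0 (r n)" for n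
      using ls_integral_split[OF f r(1)[of n] less_imp_le[OF r(2)[of n]] h] r(1)[of n]
      by (simp add: ls_integral_restrict)
    ultimately show ?thesis by simp
  qed
  have scale: "ls_integral (\<lambda>s. c * indicator {t} s) f 0 t = c * ls_integral (indicator {t}) f 0 t" for c
    using f by (intro functional_scale[OF ls_integral_functional] bounded_borel_indicator) auto
  have "filterlim r (at_left t) sequentially"
    unfolding filterlim_at using r by (auto simp: less_imp_neq)
  then have "(\<lambda>n. f (r n)) \<longlonglongrightarrow> left_lim f t"
    using tendsto_left_lim[OF f t] by (rule filterlim_compose[rotated])
  then have "(\<lambda>n. f t - f (r n)) \<longlonglongrightarrow> f t - left_lim f t"
    by (intro tendsto_intros)
  moreover have "(\<lambda>n. f t - f (r n)) \<longlonglongrightarrow> ls_integral (indicator {t}) f 0 t"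
    using lim[OF bounded_borel_const[of _ 1]] ls_integral_const[OF f, of 0 _ 1] t r(1) by simp
  ultimately have "ls_integral (indicator {t}) f 0 t = f t - left_lim f t"
    using LIMSEQ_unique by blast
  with lim[OF g] show ?thesis
    by (simp add: scale)
qed

section \<open>Paths of jump processes\<close>

lemma left_state_eqI:
  assumes "\<forall>\<^sub>F s in at_left t. z s = j"
  shows "left_state z t = j"
  unfolding left_state_def
proof (rule the_equality)
  fix k assume "\<forall>\<^sub>F s in at_left t. z s = k"
  with assms have "\<forall>\<^sub>F s in at_left t. j = k"
    by eventually_elim simp
  then show "k = j"
    by simp
qed (rule assms)

text \<open>
  The left limit at the right end point \<open>t\<close> is determined by the values before \<open>t\<close> and does not see
  a jump at \<open>t\<close>; this is why the second range includes \<open>t\<close> and the first one does not.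
\<close>

lemma jump_path_pieces:
  assumes z: "jump_path z" and T: "0 \<le> T"
  obtains D where "finite D"
    and "\<forall>s t u. 0 \<le> s \<and> t \<le> T \<and> {s<..<t} \<inter> D = {} \<and> u \<in> {s..<t} \<longrightarrow> z u = z s"
    and "\<forall>s t u. 0 \<le> s \<and> t \<le> T \<and> {s<..<t} \<inter> D = {} \<and> u \<in> {s<..t} \<longrightarrow> left_state z u = z s"
proof -
  obtain D where D: "finite D"
    and const: "\<forall>s t. 0 \<le> s \<and> s \<le> t \<and> t \<le> T \<and> {s<..t} \<inter> D = {} \<longrightarrow> z s = z t"
    using z[unfolded jump_path_def, rule_format, OF T] by blast
  have 1: "z u = z s" if st: "0 \<le> s" "t \<le> T" "{s<..<t} \<inter> D = {}" "u \<in> {s..<t}" for s t u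
  proof -
    have "{s<..u} \<subseteq> {s<..<t}" using st(4) by auto
    then have "{s<..u} \<inter> D = {}" using st(3) by blast
    then show ?thesis using const[rule_format, of s u] st by simp
  qed
  have 2: "left_state z u = z s" if st: "0 \<le> s" "t \<le> T" "{s<..<t} \<inter> D = {}" "u \<in> {s<..t}" for s t u
  proof (rule left_state_eqI)
    have "z v = z s" if "s < v" "v < u" for v
      using that st by (intro 1[of s t v]) auto
    then show "\<forall>\<^sub>F v in at_left u. z v = z s"
      using st(4) by (auto simp: eventually_at_left_field)
  qed
  show ?thesis
    by (rule that[OF D]) (use 1 2 in blast)+
qed

lemma finite_next_left:
  fixes D :: "real set"
  assumes "finite D" "0 < t"
  obtains s where "0 \<le> s" "s < t" "{s<..<t} \<inter> D = {}" "s = 0 \<or> s \<in> D"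
proof -
  define s where "s = Max (insert 0 (D \<inter> {0<..<t}))"
  have fin: "finite (insert 0 (D \<inter> {0<..<t}))"
    using assms by simp
  have "s \<in> insert 0 (D \<inter> {0<..<t})"
    unfolding s_def using fin by (rule Max_in) simp
  moreover have "x \<le> s" if "x \<in> insert 0 (D \<inter> {0<..<t})" for x
    unfolding s_def using fin that by (rule Max_ge)
  ultimately have s: "s = 0 \<or> s \<in> D" "0 \<le> s" "s < t" "\<forall>x\<in>D \<inter> {0<..<t}. x \<le> s"
    using assms(2) by auto
  then have "{s<..<t} \<inter> D = {}"
    by force
  with s show ?thesis
    by (intro that) blast+
qed

lemma jump_path_left:
  assumes z: "jump_path z" and t: "0 < t"
  shows "\<forall>\<^sub>F s in at_left t. z s = left_state z t"
proof -
  obtain D where D: "finite D"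
    "\<forall>s t' u. 0 \<le> s \<and> t' \<le> t \<and> {s<..<t'} \<inter> D = {} \<and> u \<in> {s..<t'} \<longrightarrow> z u = z s"
    "\<forall>s t' u. 0 \<le> s \<and> t' \<le> t \<and> {s<..<t'} \<inter> D = {} \<and> u \<in> {s<..t'} \<longrightarrow> left_state z u = z s"
    by (rule jump_path_pieces[OF z less_imp_le[OF t]])
  obtain s where s: "0 \<le> s" "s < t" "{s<..<t} \<inter> D = {}"
    by (rule finite_next_left[OF D(1) t])
  then have "z u = left_state z t" if "s < u" "u < t" for u
    using D(2)[rule_format, of s t u] D(3)[rule_format, of s t t] that by simp
  with s(2) show ?thesis
    by (auto simp: eventually_at_left_field)
qed

text \<open>
  Go back from \<open>T\<close> to the last point of \<open>D\<close> before it, and so on; every step uses up one point.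
\<close>

lemma constant_across_pieces:
  fixes R :: "real \<Rightarrow> 'b"
  assumes "finite D" "0 \<le> T"
    and step: "\<And>s t. 0 \<le> s \<Longrightarrow> s < t \<Longrightarrow> t \<le> T \<Longrightarrow> {s<..<t} \<inter> D = {} \<Longrightarrow> R t = R s"
  shows "R T = R 0"
proof -
  have "R t = R 0" if "0 \<le> t" "t \<le> T" for t
    using that
  proof (induction "card (D \<inter> {..<t})" arbitrary: t rule: less_induct)
    case less
    show ?case
    proof (cases "t = 0")
      case False
      with less.prems have "0 < t" by simp
      then obtain s where s: "0 \<le> s" "s < t" "{s<..<t} \<inter> D = {}" "s = 0 \<or> s \<in> D"
        by (rule finite_next_left[OF assms(1)])
      have "R t = R s"
        by (rule step[OF s(1,2) less.prems(2) s(3)])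
      also have "R s = R 0"
      proof (cases "s = 0")
        case False
        with s(4) have "s \<in> D \<inter> {..<t}" "s \<notin> D \<inter> {..<s}" "D \<inter> {..<s} \<subseteq> D \<inter> {..<t}"
          using s(2) by auto
        then have "D \<inter> {..<s} \<subset> D \<inter> {..<t}"
          by blast
        then have "card (D \<inter> {..<s}) < card (D \<inter> {..<t})"
          using assms(1) by (intro psubset_card_mono) auto
        then show ?thesis
          by (rule less.hyps) (use s less.prems in linarith)+
      qed simp
      finally show ?thesis .
    qed simp
  qed
  from this[OF assms(2) order_refl] show ?thesis .
qed


section \<open>Approximation along grids\<close>

text \<open>
  For \<open>d = -1\<close> and \<open>d = 1\<close> these are grid points strictly to the left and to the right of \<open>s\<close>, at a
  distance of at most \<open>2/(n+1)\<close>.  Evaluating a process at them leaves only countably many times to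
  consider, which gives joint measurability.
\<close>

definition grid :: "real \<Rightarrow> nat \<Rightarrow> real \<Rightarrow> real" where
  "grid d n s = (of_int \<lceil>real (Suc n) * s\<rceil> + d) / real (Suc n)"

lemma grid_bounds: "s + d / real (Suc n) \<le> grid d n s" "grid d n s < s + (d + 1) / real (Suc n)"
proof -
  define N where "N = real (Suc n)"
  have N: "0 < N" by (simp add: N_def)
  have c: "N * s + d \<le> of_int \<lceil>N * s\<rceil> + d" "of_int \<lceil>N * s\<rceil> + d < N * s + (d + 1)"
    using ceiling_correct[of "N * s"] by linarith+
  have split: "s + x / N = (N * s + x) / N" for x
    using N by (simp add: add_divide_distrib)
  show "s + d / real (Suc n) \<le> grid d n s" "grid d n s < s + (d + 1) / real (Suc n)"
    unfolding grid_def N_def[symmetric] split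
    by (rule divide_right_mono[OF c(1) less_imp_le[OF N]], rule divide_strict_right_mono[OF c(2) N])
qed

lemma grid_less: "grid (-1) n s < s"
  using grid_bounds(2)[of "-1" n s] by simp

lemma grid_greater: "s < grid 1 n s"
  by (rule less_le_trans[OF _ grid_bounds(1)]) simp

lemma grid_nonneg:
  assumes "0 < s"
  shows "0 \<le> grid (-1) n s"
proof -
  have "0 < \<lceil>real (Suc n) * s\<rceil>"
    using assms by simp
  then have "1 \<le> (of_int \<lceil>real (Suc n) * s\<rceil> :: real)"
    by linarith
  then show ?thesis
    by (simp add: grid_def)
qed

lemma grid_tendsto: "(\<lambda>n. grid d n s) \<longlonglongrightarrow> s"
proof (rule tendsto_sandwich[of "\<lambda>n. s + d / real (Suc n)" _ _ "\<lambda>n. s + (d + 1) / real (Suc n)"])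
  have "(\<lambda>n. s + x / real (Suc n)) \<longlonglongrightarrow> s + 0" for x
    by (intro tendsto_add tendsto_const LIMSEQ_Suc[OF lim_const_over_n])
  then show "(\<lambda>n. s + d / real (Suc n)) \<longlonglongrightarrow> s" "(\<lambda>n. s + (d + 1) / real (Suc n)) \<longlonglongrightarrow> s"
    by simp_all
qed (use grid_bounds in \<open>auto intro!: always_eventually less_imp_le simp del: of_nat_Suc\<close>)

lemma filterlim_grid_left: "filterlim (\<lambda>n. grid (-1) n s) (at_left s) sequentially"
  unfolding filterlim_at using grid_tendsto grid_less by (auto simp: less_imp_neq)

lemma filterlim_grid_right: "filterlim (\<lambda>n. grid 1 n s) (at_right s) sequentially"
  unfolding filterlim_at using grid_tendsto grid_greater by (auto simp: less_imp_neq[symmetric])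

lemma jointly_measurable_grid_limits:
  fixes X :: "real \<Rightarrow> 'a \<Rightarrow> real"
  assumes X: "\<And>t. 0 \<le> t \<Longrightarrow> X t \<in> borel_measurable M"
    and lim: "\<And>s \<omega>. 0 < s \<Longrightarrow> \<omega> \<in> space M \<Longrightarrow> (\<lambda>n. X (max 0 (grid d n s)) \<omega>) \<longlonglongrightarrow> Y s \<omega>"
  shows "(\<lambda>(s, \<omega>). indicator {0<..T} s * Y s \<omega>) \<in> borel_measurable (borel \<Otimes>\<^sub>M M)"
proof (rule borel_measurable_LIMSEQ_real)
  have "(\<lambda>p. (\<lambda>i p. X (max 0 ((of_int i + d) / real (Suc n))) (snd p)) \<lceil>real (Suc n) * fst p\<rceil> p)
      \<in> borel_measurable (borel \<Otimes>\<^sub>M M)" for n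
    by (rule measurable_compose_countable)
       (auto intro!: measurable_compose[OF measurable_snd X] simp del: of_nat_Suc)
  then have "(\<lambda>p. X (max 0 (grid d n (fst p))) (snd p)) \<in> borel_measurable (borel \<Otimes>\<^sub>M M)" for n
    by (simp only: grid_def)
  then show "(\<lambda>(s, \<omega>). indicator {0<..T} s * X (max 0 (grid d n s)) \<omega>) \<in> borel_measurable (borel \<Otimes>\<^sub>M M)" for n
    by (simp add: case_prod_beta')
  fix p :: "real \<times> 'a" assume "p \<in> space (borel \<Otimes>\<^sub>M M)"
  then obtain s \<omega> where p: "p = (s, \<omega>)" "\<omega> \<in> space M"
    by (auto simp: space_pair_measure)
  show "(\<lambda>n. case p of (s, \<omega>) \<Rightarrow> indicator {0<..T} s * X (max 0 (grid d n s)) \<omega>)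
      \<longlonglongrightarrow> (case p of (s, \<omega>) \<Rightarrow> indicator {0<..T} s * Y s \<omega>)"
    using lim[OF _ p(2), of s] by (cases "s \<in> {0<..T}") (simp_all add: p)
qed

lemma jointly_measurable_left_limits:
  fixes X :: "real \<Rightarrow> 'a \<Rightarrow> real"
  assumes "\<And>t. 0 \<le> t \<Longrightarrow> X t \<in> borel_measurable M"
    and lim: "\<And>s \<omega>. 0 < s \<Longrightarrow> \<omega> \<in> space M \<Longrightarrow> ((\<lambda>t. X t \<omega>) \<longlongrightarrow> Y s \<omega>) (at_left s)"
  shows "(\<lambda>(s, \<omega>). indicator {0<..T} s * Y s \<omega>) \<in> borel_measurable (borel \<Otimes>\<^sub>M M)"
proof (rule jointly_measurable_grid_limits[OF assms(1), where d = "-1"])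
  fix s :: real and \<omega> assume "0 < s" "\<omega> \<in> space M"
  then show "(\<lambda>n. X (max 0 (grid (-1) n s)) \<omega>) \<longlonglongrightarrow> Y s \<omega>"
    using filterlim_compose[OF lim filterlim_grid_left] by (simp add: grid_nonneg max_absorb2)
qed

lemma jointly_measurable_right_limits:
  fixes X :: "real \<Rightarrow> 'a \<Rightarrow> real"
  assumes "\<And>t. 0 \<le> t \<Longrightarrow> X t \<in> borel_measurable M"
    and lim: "\<And>s \<omega>. 0 < s \<Longrightarrow> \<omega> \<in> space M \<Longrightarrow> ((\<lambda>t. X t \<omega>) \<longlongrightarrow> Y s \<omega>) (at_right s)"
  shows "(\<lambda>(s, \<omega>). indicator {0<..T} s * Y s \<omega>) \<in> borel_measurable (borel \<Otimes>\<^sub>M M)"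
proof (rule jointly_measurable_grid_limits[OF assms(1), where d = 1])
  fix s :: real and \<omega> assume s: "0 < s" "\<omega> \<in> space M"
  have "max 0 (grid 1 n s) = grid 1 n s" for n
    using s(1) grid_greater[of s n] by simp
  then show "(\<lambda>n. X (max 0 (grid 1 n s)) \<omega>) \<longlonglongrightarrow> Y s \<omega>"
    using filterlim_compose[OF lim[OF s] filterlim_grid_right] by simp
qed

lemma borel_measurable_path_of_joint:
  assumes "(\<lambda>(s, \<omega>). indicator {0<..T} s * Y s \<omega> :: real) \<in> borel_measurable (borel \<Otimes>\<^sub>M M)" "\<omega> \<in> space M"
  shows "(\<lambda>s. indicator {0<..T} s * Y s \<omega>) \<in> borel_measurable borel"
  using measurable_compose[OF measurable_Pair2'[OF assms(2)] assms(1)] by simp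

text \<open>Deterministic functions are processes on a one-point space.\<close>

lemma bounded_borel_left_limits:
  assumes "\<And>s. 0 < s \<Longrightarrow> (f \<longlongrightarrow> g s) (at_left s)" "\<And>s. s \<in> {0<..T} \<Longrightarrow> \<bar>g s\<bar> \<le> C"
  shows "bounded_borel T g"
proof (rule bounded_borelI)
  have "(\<lambda>(s, \<omega>::unit). indicator {0<..T} s * g s) \<in> borel_measurable (borel \<Otimes>\<^sub>M count_space UNIV)"
    by (rule jointly_measurable_left_limits[where X = "\<lambda>t _. f t"]) (use assms in auto)
  then show "(\<lambda>s. indicator {0<..T} s * g s) \<in> borel_measurable borel"
    by (rule borel_measurable_path_of_joint[where \<omega> = "()"]) simp
qed (rule assms)

lemma rcfv_bounded:
  assumes "rcfv f" "0 \<le> T" "t \<in> {0..T}"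
  shows "\<bar>f t\<bar> \<le> \<bar>f 0\<bar> + total_variation f 0 T"
  using abs_diff_le_total_variation[OF assms(1), of 0 t] total_variation_mono[OF assms(1), of t T] assms
  by (simp add: total_variation_refl)

lemma bounded_borel_rcfv:
  assumes f: "rcfv f"
  shows "bounded_borel T f"
proof (rule bounded_borelI[where C = "\<bar>f 0\<bar> + total_variation f 0 T"])
  have "(\<lambda>(s, \<omega>::unit). indicator {0<..T} s * f s) \<in> borel_measurable (borel \<Otimes>\<^sub>M count_space UNIV)"
    by (rule jointly_measurable_right_limits[where X = "\<lambda>t _. f t"]) (use rcfv_tendsto_right[OF f] in auto)
  then show "(\<lambda>s. indicator {0<..T} s * f s) \<in> borel_measurable borel"
    by (rule borel_measurable_path_of_joint[where \<omega> = "()"]) simp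
qed (use rcfv_bounded[OF f] in auto)

lemma left_lim_bounded:
  assumes "rcfv f" "s \<in> {0<..T}"
  shows "\<bar>left_lim f s\<bar> \<le> \<bar>f 0\<bar> + total_variation f 0 T"
proof (rule tendsto_upperbound)
  show "((\<lambda>t. \<bar>f t\<bar>) \<longlongrightarrow> \<bar>left_lim f s\<bar>) (at_left s)"
    using assms by (intro tendsto_rabs tendsto_left_lim) auto
  show "\<forall>\<^sub>F t in at_left s. \<bar>f t\<bar> \<le> \<bar>f 0\<bar> + total_variation f 0 T"
    using assms rcfv_bounded[OF assms(1), of T]
    by (auto simp: eventually_at_left_field intro!: exI[of _ 0])
qed simp

lemma bounded_borel_left_lim: "rcfv f \<Longrightarrow> bounded_borel T (left_lim f)"
  by (rule bounded_borel_left_limits[of f _ T "\<bar>f 0\<bar> + total_variation f 0 T"])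
     (simp_all only: tendsto_left_lim left_lim_bounded)

lemma tendsto_left_state:
  assumes "jump_path z" "0 < s"
  shows "((\<lambda>t. of_bool (z t = j) :: real) \<longlongrightarrow> of_bool (left_state z s = j)) (at_left s)"
proof (rule tendsto_eventually)
  show "\<forall>\<^sub>F t in at_left s. of_bool (z t = j) = (of_bool (left_state z s = j) :: real)"
    using jump_path_left[OF assms] by eventually_elim simp
qed

lemma bounded_borel_left_state:
  "jump_path z \<Longrightarrow> bounded_borel T (\<lambda>s. of_bool (left_state z s = j))"
  by (rule bounded_borel_left_limits[of "\<lambda>t. of_bool (z t = j)" _ T 1]) (rule tendsto_left_state, auto)

section \<open>Counting jumps\<close>

context
  fixes J :: "real set"
  assumes J: "\<And>t. finite (J \<inter> {0<..t})"
begin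

lemma rcfv_counting: "rcfv (\<lambda>t. real (card (J \<inter> {0<..t})))"
proof (rule rcfvI[where W = "\<lambda>_ t. real (card (J \<inter> {0<..t}))"])
  fix s t :: real assume "s \<le> t"
  then have "card (J \<inter> {0<..s}) \<le> card (J \<inter> {0<..t})"
    by (intro card_mono J) auto
  then show "\<bar>real (card (J \<inter> {0<..t})) - real (card (J \<inter> {0<..s}))\<bar> \<le>
      real (card (J \<inter> {0<..t})) - real (card (J \<inter> {0<..s}))"
    by simp
next
  fix t :: real assume "0 \<le> t"
  define u where "u = Min (insert (t + 1) (J \<inter> {0<..t + 1} \<inter> {t<..}))"
  have fin: "finite (insert (t + 1) (J \<inter> {0<..t + 1} \<inter> {t<..}))"
    using J by simp
  have "u \<in> insert (t + 1) (J \<inter> {0<..t + 1} \<inter> {t<..})"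
    unfolding u_def using fin by (rule Min_in) simp
  then have "t < u" "u \<le> t + 1"
    by auto
  have "u \<le> x" if "x \<in> J" "t < x" "x \<le> t + 1" for x
    unfolding u_def using fin that \<open>0 \<le> t\<close> by (intro Min_le) auto
  then have "J \<inter> {0<..s} = J \<inter> {0<..t}" if "t < s" "s < u" for s
    using that \<open>u \<le> t + 1\<close> by fastforce
  then have "\<forall>\<^sub>F s in at_right t. real (card (J \<inter> {0<..s})) = real (card (J \<inter> {0<..t}))"
    using \<open>t < u\<close> by (auto simp: eventually_at_right_field intro!: exI[of _ u])
  then show "continuous (at_right t) (\<lambda>t. real (card (J \<inter> {0<..t})))"
    by (simp add: continuous_within tendsto_eventually)
qed

text \<open>
  Both sides agree on the indicator of \<open>(0,t]\<close>, where they count the points of \<open>J\<close> in \<open>(0,t]\<close>.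
\<close>

lemma ls_integral_counting:
  assumes "0 \<le> T" "bounded_borel T g"
  shows "ls_integral g (\<lambda>t. real (card (J \<inter> {0<..t}))) 0 T = (\<Sum>s\<in>J \<inter> {0<..T}. g s)"
proof (rule ls_integral_eqI[OF rcfv_counting assms(1) _ _ assms(2), where \<Phi> = "\<lambda>g. \<Sum>s\<in>J \<inter> {0<..T}. g s"])
  show "bounded_convergence_functional T (\<lambda>g. \<Sum>s\<in>J \<inter> {0<..T}. g s)"
    by (rule functional_sum) (auto intro: bounded_convergence_functionalI)
  fix t :: real assume t: "0 \<le> t" "t \<le> T"
  have "(\<Sum>s\<in>J \<inter> {0<..T}. indicator {0<..t} s) = (\<Sum>s\<in>J \<inter> {0<..T} \<inter> {0<..t}. 1 :: real)"
    using J[of T] by (intro sum.mono_neutral_cong_right) (auto simp: indicator_def)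
  also have "\<dots> = real (card (J \<inter> {0<..T} \<inter> {0<..t}))"
    by simp
  also have "J \<inter> {0<..T} \<inter> {0<..t} = J \<inter> {0<..t}"
    using t by auto
  finally show "(\<Sum>s\<in>J \<inter> {0<..T}. indicator {0<..t} s) = real (card (J \<inter> {0<..t})) - real (card (J \<inter> {0<..0}))"
    by simp
qed

end

definition jump_times :: "(real \<Rightarrow> 's) \<Rightarrow> 's \<Rightarrow> 's \<Rightarrow> real set" where
  "jump_times z j k = {s. left_state z s = j \<and> z s = k}"

lemma jump_count_eq_card: "jump_count Z j k t \<omega> = real (card (jump_times (\<lambda>u. Z u \<omega>) j k \<inter> {0<..t}))"
proof -
  have "{s \<in> {0<..t}. left_state (\<lambda>u. Z u \<omega>) s = j \<and> Z s \<omega> = k} = jump_times (\<lambda>u. Z u \<omega>) j k \<inter> {0<..t}"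
    by (auto simp: jump_times_def)
  then show ?thesis
    by (simp add: jump_count_def)
qed

lemma finite_jump_times:
  assumes z: "jump_path z" and jk: "j \<noteq> k"
  shows "finite (jump_times z j k \<inter> {0<..t})"
proof (cases "0 \<le> t")
  case True
  obtain D where D: "finite D"
    "\<forall>r s. 0 \<le> r \<and> r \<le> s \<and> s \<le> t \<and> {r<..s} \<inter> D = {} \<longrightarrow> z r = z s"
    using z[unfolded jump_path_def, rule_format, OF True] by blast
  have "s \<in> D" if s: "s \<in> jump_times z j k" "0 < s" "s \<le> t" for s
  proof (rule ccontr)
    assume "s \<notin> D"
    obtain r where r: "0 \<le> r" "r < s" "{r<..<s} \<inter> D = {}"
      by (rule finite_next_left[OF D(1) s(2)])
    have "z u = z s" if "r < u" "u < s" for u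
    proof -
      have "{u<..s} \<subseteq> insert s {r<..<s}" using that by auto
      with r \<open>s \<notin> D\<close> have "{u<..s} \<inter> D = {}" by blast
      with D(2)[rule_format, of u s] that r s show ?thesis by simp
    qed
    then have "left_state z s = z s"
      using r by (intro left_state_eqI) (auto simp: eventually_at_left_field)
    with s jk show False
      by (auto simp: jump_times_def)
  qed
  then have "jump_times z j k \<inter> {0<..t} \<subseteq> D"
    by auto
  then show ?thesis
    using D(1) by (rule finite_subset)
qed simp

text \<open>
  Between two consecutive jump times only \<open>h\<close> moves; at a jump time \<open>t\<close> the indicator moves as well,
  and the weight of this move is the new value \<open>h(t)\<close>.  Hence \<open>h\<close> is evaluated at \<open>t\<close> in the jump
  terms while the state is evaluated at \<open>t-\<close> in the first term.
\<close>

lemma weighted_indicator_decomposition: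
  fixes z :: "real \<Rightarrow> 's::finite"
  assumes z: "jump_path z" and h: "rcfv h" and T: "0 \<le> T"
  shows "h T * of_bool (z T = j) - h 0 * of_bool (z 0 = j) =
    ls_integral (\<lambda>s. of_bool (left_state z s = j)) h 0 T +
    (\<Sum>k\<in>UNIV - {j}. \<Sum>s\<in>jump_times z k j \<inter> {0<..T}. h s) -
    (\<Sum>k\<in>UNIV - {j}. \<Sum>s\<in>jump_times z j k \<inter> {0<..T}. h s)"
proof -
  define S where "S k l t = (\<Sum>s\<in>jump_times z k l \<inter> {0<..t}. h s)" for k l t
  define I where "I t = ls_integral (\<lambda>s. of_bool (left_state z s = j)) h 0 t" for t
  define R where "R t = h t * of_bool (z t = j) - I t - (\<Sum>k\<in>UNIV - {j}. S k j t) + (\<Sum>k\<in>UNIV - {j}. S j k t)" for t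
  obtain D where D: "finite D"
    "\<forall>s t u. 0 \<le> s \<and> t \<le> T \<and> {s<..<t} \<inter> D = {} \<and> u \<in> {s..<t} \<longrightarrow> z u = z s"
    "\<forall>s t u. 0 \<le> s \<and> t \<le> T \<and> {s<..<t} \<inter> D = {} \<and> u \<in> {s<..t} \<longrightarrow> left_state z u = z s"
    by (rule jump_path_pieces[OF z T])
  have "R T = R 0"
  proof (rule constant_across_pieces[OF D(1) T, where R = R])
    fix s t assume st: "0 \<le> s" "s < t" "t \<le> T" "{s<..<t} \<inter> D = {}"
    have left: "left_state z u = z s" if "u \<in> {s<..t}" for u
      using D(3)[rule_format, of s t u] st that by simp
    have stay: "z u = z s" if "u \<in> {s..<t}" for u
      using D(2)[rule_format, of s t u] st that by simp
    have "I t - I s = ls_integral (\<lambda>s. of_bool (left_state z s = j)) h s t"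
      using ls_integral_split[OF h st(1) less_imp_le[OF st(2)] bounded_borel_left_state[OF z]]
      by (simp add: I_def)
    also have "\<dots> = ls_integral (\<lambda>_. of_bool (z s = j)) h s t"
      by (rule ls_integral_cong) (simp add: left)
    also have "\<dots> = of_bool (z s = j) * (h t - h s)"
      using st by (intro ls_integral_const h) auto
    finally have I: "I t - I s = of_bool (z s = j) * (h t - h s)" .
    have S: "S k l t - S k l s = h t * of_bool (z s = k \<and> z t = l)" if kl: "k \<noteq> l" for k l
    proof -
      have "jump_times z k l \<inter> {0<..t} = jump_times z k l \<inter> {0<..s} \<union> jump_times z k l \<inter> {s<..t}"
        using st by auto
      also have "jump_times z k l \<inter> {s<..t} = (if z s = k \<and> z t = l then {t} else {})"
      proof (rule set_eqI)
        fix u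
        show "u \<in> jump_times z k l \<inter> {s<..t} \<longleftrightarrow> u \<in> (if z s = k \<and> z t = l then {t} else {})"
        proof (cases "u = t")
          case True
          have "left_state z t = z s" using left[of t] st by simp
          with True show ?thesis using st(2) by (simp add: jump_times_def)
        next
          case False
          have "left_state z u = z u" if "s < u" "u \<le> t"
            using left[of u] stay[of u] False that by simp
          with False kl show ?thesis by (auto simp: jump_times_def)
        qed
      qed
      finally have J: "jump_times z k l \<inter> {0<..t} = jump_times z k l \<inter> {0<..s} \<union> (if z s = k \<and> z t = l then {t} else {})" .
      show ?thesis
        unfolding S_def J using st finite_jump_times[OF z kl] by (subst sum.union_disjoint) auto
    qed
    have "(\<Sum>k\<in>UNIV - {j}. S k j t) - (\<Sum>k\<in>UNIV - {j}. S k j s) = (\<Sum>k\<in>UNIV - {j}. S k j t - S k j s)"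
      by (rule sum_subtractf[symmetric])
    also have "\<dots> = (\<Sum>k\<in>UNIV - {j}. h t * of_bool (z s = k \<and> z t = j))"
      by (rule sum.cong[OF refl], rule S) auto
    also have "\<dots> = (\<Sum>k\<in>UNIV - {j}. if k = z s then h t * of_bool (z t = j) else 0)"
      by (rule sum.cong) auto
    also have "\<dots> = h t * of_bool (z s \<noteq> j \<and> z t = j)"
      by (subst sum.delta) auto
    finally have 1: "(\<Sum>k\<in>UNIV - {j}. S k j t) - (\<Sum>k\<in>UNIV - {j}. S k j s) = h t * of_bool (z s \<noteq> j \<and> z t = j)" .
    have "(\<Sum>k\<in>UNIV - {j}. S j k t) - (\<Sum>k\<in>UNIV - {j}. S j k s) = (\<Sum>k\<in>UNIV - {j}. S j k t - S j k s)"
      by (rule sum_subtractf[symmetric])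
    also have "\<dots> = (\<Sum>k\<in>UNIV - {j}. h t * of_bool (z s = j \<and> z t = k))"
      by (rule sum.cong[OF refl], rule S) auto
    also have "\<dots> = (\<Sum>k\<in>UNIV - {j}. if k = z t then h t * of_bool (z s = j) else 0)"
      by (rule sum.cong) auto
    also have "\<dots> = h t * of_bool (z s = j \<and> z t \<noteq> j)"
      by (subst sum.delta) auto
    finally have 2: "(\<Sum>k\<in>UNIV - {j}. S j k t) - (\<Sum>k\<in>UNIV - {j}. S j k s) = h t * of_bool (z s = j \<and> z t \<noteq> j)" .
    have "R t - R s = (h t * of_bool (z t = j) - h s * of_bool (z s = j)) - (I t - I s)
       - ((\<Sum>k\<in>UNIV - {j}. S k j t) - (\<Sum>k\<in>UNIV - {j}. S k j s))
       + ((\<Sum>k\<in>UNIV - {j}. S j k t) - (\<Sum>k\<in>UNIV - {j}. S j k s))"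
      by (simp add: R_def)
    also have "\<dots> = 0"
      unfolding I 1 2 by (cases "z s = j"; cases "z t = j") auto
    finally show "R t = R s" by simp
  qed
  moreover have "I 0 = 0"
    by (simp add: I_def ls_integral_def set_lebesgue_integral_def)
  ultimately show ?thesis
    by (simp add: R_def I_def S_def)
qed

section \<open>The entrywise norm of a matrix\<close>

text \<open>
  This norm is submultiplicative, and it bounds the increments of a matrix function by those of the
  sum of the variations of its entries.
\<close>

definition entry_norm :: "real^'n^'m \<Rightarrow> real" where
  "entry_norm A = (\<Sum>i\<in>UNIV. \<Sum>j\<in>UNIV. \<bar>A $ i $ j\<bar>)"

lemma entry_norm_nonneg: "0 \<le> entry_norm A"
  by (simp add: entry_norm_def sum_nonneg)

lemma entry_norm_add: "entry_norm (A + B) \<le> entry_norm A + entry_norm B"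
proof -
  have "entry_norm (A + B) \<le> (\<Sum>i\<in>UNIV. \<Sum>j\<in>UNIV. \<bar>A $ i $ j\<bar> + \<bar>B $ i $ j\<bar>)"
    unfolding entry_norm_def by (intro sum_mono) simp
  then show ?thesis
    by (simp add: entry_norm_def sum.distrib)
qed

lemma entry_norm_mult: "entry_norm (A ** B) \<le> entry_norm A * entry_norm (B :: real^'n^'n)"
proof -
  have entry: "(\<Sum>j\<in>UNIV. \<bar>B $ k $ j\<bar>) \<le> entry_norm B" for k
    unfolding entry_norm_def
    by (rule member_le_sum[where f = "\<lambda>k. \<Sum>j\<in>UNIV. \<bar>B $ k $ j\<bar>"]) (auto intro: sum_nonneg)
  have "entry_norm (A ** B) = (\<Sum>i\<in>UNIV. \<Sum>j\<in>UNIV. \<bar>\<Sum>k\<in>UNIV. A $ i $ k * B $ k $ j\<bar>)"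
    by (simp add: entry_norm_def matrix_matrix_mult_def)
  also have "\<dots> \<le> (\<Sum>i\<in>UNIV. \<Sum>j\<in>UNIV. \<Sum>k\<in>UNIV. \<bar>A $ i $ k\<bar> * \<bar>B $ k $ j\<bar>)"
    by (intro sum_mono sum_abs[THEN order_trans]) (simp add: abs_mult)
  also have "\<dots> = (\<Sum>i\<in>UNIV. \<Sum>k\<in>UNIV. \<bar>A $ i $ k\<bar> * (\<Sum>j\<in>UNIV. \<bar>B $ k $ j\<bar>))"
    by (rule sum.cong[OF refl], simp only: sum_distrib_left, rule sum.swap)
  also have "\<dots> \<le> (\<Sum>i\<in>UNIV. \<Sum>k\<in>UNIV. \<bar>A $ i $ k\<bar> * entry_norm B)"
    by (intro sum_mono mult_left_mono entry) simp
  also have "\<dots> = entry_norm A * entry_norm B"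
    by (simp only: entry_norm_def[of A] sum_distrib_right)
  finally show ?thesis .
qed

lemma entry_le_entry_norm: "\<bar>A $ i $ j\<bar> \<le> entry_norm A"
proof -
  have "\<bar>A $ i $ j\<bar> \<le> (\<Sum>j\<in>UNIV. \<bar>A $ i $ j\<bar>)"
    by (rule member_le_sum[where f = "\<lambda>j. \<bar>A $ i $ j\<bar>"]) simp_all
  also have "\<dots> \<le> entry_norm A"
    unfolding entry_norm_def
    by (rule member_le_sum[where f = "\<lambda>i. \<Sum>j\<in>UNIV. \<bar>A $ i $ j\<bar>"]) (simp_all add: sum_nonneg)
  finally show ?thesis .
qed

lemma entry_norm_mat_1: "entry_norm (mat 1 :: real^'n^'n) = real CARD('n)"
  by (simp add: entry_norm_def mat_def if_distrib[of abs] cong: if_cong)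

lemma norm_le_entry_norm: "norm A \<le> entry_norm A"
proof -
  have "norm A \<le> (\<Sum>i\<in>UNIV. norm (A $ i))"
    by (simp add: norm_vec_def L2_set_le_sum)
  also have "\<dots> \<le> entry_norm A"
    unfolding entry_norm_def by (intro sum_mono norm_le_l1_cart)
  finally show ?thesis .
qed

lemma matrix_mult_add_left: "(A + B) ** C = A ** C + B ** (C :: real^'n^'m)"
  by (simp add: matrix_matrix_mult_def vec_eq_iff distrib_right sum.distrib)

lemma matrix_mult_diff_left: "(A - B) ** C = A ** C - B ** (C :: real^'n^'m)"
  by (simp add: matrix_matrix_mult_def vec_eq_iff left_diff_distrib sum_subtractf)

section \<open>Products along partitions\<close>

definition chain_product :: "(real \<Rightarrow> real^'s^'s) \<Rightarrow> real list \<Rightarrow> real^('s::finite)^'s" where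
  "chain_product L xs = foldr (**) (map2 (\<lambda>r s. mat 1 + (L s - L r)) xs (tl xs)) (mat 1)"

lemma partition_product_eq: "partition_product L a b D = chain_product L (sorted_list_of_set ({a, b} \<union> D))"
  by (simp add: partition_product_def chain_product_def Let_def)

lemma chain_product_single: "chain_product L [x] = mat 1"
  by (simp add: chain_product_def)

lemma chain_product_Cons: "chain_product L (x # y # ys) = (mat 1 + (L y - L x)) ** chain_product L (y # ys)"
  by (simp add: chain_product_def)

lemma chain_product_append:
  "chain_product L (xs @ x # ys) = chain_product L (xs @ [x]) ** chain_product L (x # ys)"
proof (induction xs)
  case Nil
  show ?case by (simp add: chain_product_single)
next
  case (Cons a xs)
  show ?case
  proof (cases xs)
    case Nil
    then show ?thesis
      by (simp add: chain_product_Cons chain_product_single)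
  next
    case (Cons c zs)
    with Cons.IH show ?thesis
      by (simp only: append_Cons chain_product_Cons matrix_mul_assoc)
  qed
qed

fun square_sum :: "(real \<Rightarrow> real) \<Rightarrow> real list \<Rightarrow> real" where
  "square_sum V (x # y # ys) = (V y - V x)\<^sup>2 + square_sum V (y # ys)"
| "square_sum V xs = 0"

lemma square_sum_append:
  "square_sum V (xs @ x # ys) = square_sum V (xs @ [x]) + square_sum V (x # ys)"
proof (induction xs)
  case (Cons a xs)
  show ?case
  proof (cases xs)
    case (Cons c zs)
    with Cons.IH show ?thesis
      by (simp only: append_Cons square_sum.simps(1) add.assoc)
  qed simp
qed simp

lemma square_sum_nonneg: "0 \<le> square_sum V xs"
  by (induction V xs rule: square_sum.induct) auto

lemma sorted_insert_between:
  assumes "sorted zs" "distinct zs" "u \<notin> set zs" "x \<in> set zs" "x < u" "y \<in> set zs" "u < (y::real)"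
  obtains xs r s ys where "zs = xs @ r # s # ys" "r < u" "u < s"
    "sorted_list_of_set (insert u (set zs)) = xs @ r # u # s # ys"
proof -
  define xs where "xs = filter (\<lambda>z. z < u) zs"
  define ys where "ys = filter (\<lambda>z. u < z) zs"
  have "zs = xs @ ys"
    unfolding xs_def ys_def using assms(1,3)
  proof (induction zs)
    case (Cons z zs)
    show ?case
    proof (cases "z < u")
      case True
      with Cons show ?thesis by simp
    next
      case False
      with Cons.prems have "u < z" by auto
      moreover have "\<forall>w\<in>set zs. z \<le> w"
        using Cons.prems(1) by simp
      ultimately have "\<forall>w\<in>set zs. u < w \<and> \<not> w < u"
        by force
      then have "filter (\<lambda>z. z < u) zs = []" "filter (\<lambda>z. u < z) zs = zs"
        by (simp_all add: filter_empty_conv filter_id_conv)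
      with \<open>u < z\<close> show ?thesis by simp
    qed
  qed simp
  have "x \<in> set xs" "y \<in> set ys"
    using assms by (auto simp: xs_def ys_def)
  then have "xs \<noteq> []" "ys \<noteq> []" by auto
  then have "xs = butlast xs @ [last xs]" "ys = hd ys # tl ys"
    by simp_all
  then obtain xs' r s ys' where xs: "xs = xs' @ [r]" and ys: "ys = s # ys'"
    by blast
  have "r \<in> set xs" "s \<in> set ys" by (auto simp: xs ys)
  then have rs: "r < u" "u < s" by (auto simp: xs_def ys_def)
  have "distinct (xs @ u # ys)"
    using assms(2,3) by (simp add: xs_def ys_def disjoint_iff)
  moreover have "sorted (xs @ u # ys)"
    unfolding sorted_append xs_def ys_def using assms(1) by (simp add: sorted_wrt_filter less_imp_le)
  ultimately have "sorted_list_of_set (set (xs @ u # ys)) = xs @ u # ys"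
    by (intro sorted_list_of_set.idem_if_sorted_distinct)
  moreover have "set (xs @ u # ys) = insert u (set zs)"
    unfolding \<open>zs = xs @ ys\<close> by simp
  ultimately have sorted_list: "sorted_list_of_set (insert u (set zs)) = xs @ u # ys"
    by (simp only:)
  show ?thesis
  proof (rule that)
    show "zs = xs' @ r # s # ys'"
      unfolding \<open>zs = xs @ ys\<close> unfolding xs ys by simp
    show "sorted_list_of_set (insert u (set zs)) = xs' @ r # u # s # ys'"
      unfolding sorted_list unfolding xs ys by simp
  qed (fact rs)+
qed

text \<open>In the application, \<open>V\<close> is the sum of the total variations of the entries.\<close>

locale dominated_matrix_function =
  fixes L :: "real \<Rightarrow> real^'s^('s::finite)" and V :: "real \<Rightarrow> real" and a b :: real
  assumes ab: "a \<le> b"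
    and dominated: "\<And>r s. a \<le> r \<Longrightarrow> r \<le> s \<Longrightarrow> s \<le> b \<Longrightarrow> entry_norm (L s - L r) \<le> V s - V r"
begin

lemma V_mono: "a \<le> r \<Longrightarrow> r \<le> s \<Longrightarrow> s \<le> b \<Longrightarrow> V r \<le> V s"
  using dominated[of r s] entry_norm_nonneg[of "L s - L r"] by linarith

text \<open>
  By \<open>1 + x \<le> exp x\<close> the bound depends on the increment of \<open>V\<close> only and not on the number of factors.
  The cardinality is the norm of the identity matrix.
\<close>

lemma chain_product_bound:
  assumes "sorted xs" "set xs \<subseteq> {a..b}" "xs \<noteq> []"
  shows "entry_norm (chain_product L xs) \<le> real CARD('s) * exp (V (last xs) - V (hd xs))"
  using assms
proof (induction xs rule: induct_list012)
  case (3 x y ys)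
  let ?P = "chain_product L (y # ys)"
  have IH: "entry_norm ?P \<le> real CARD('s) * exp (V (last (y # ys)) - V y)"
    using 3 by simp
  have xy: "entry_norm (L y - L x) \<le> V y - V x"
    using "3.prems" by (intro dominated) auto
  have "entry_norm (chain_product L (x # y # ys)) \<le> entry_norm ?P + entry_norm (L y - L x) * entry_norm ?P"
    using entry_norm_add[of ?P "(L y - L x) ** ?P"] entry_norm_mult[of "L y - L x" ?P]
    by (simp add: chain_product_Cons matrix_mult_add_left)
  also have "\<dots> = (1 + entry_norm (L y - L x)) * entry_norm ?P"
    by (simp add: algebra_simps)
  also have "\<dots> \<le> exp (V y - V x) * (real CARD('s) * exp (V (last (y # ys)) - V y))"
  proof (intro mult_mono IH)
    show "1 + entry_norm (L y - L x) \<le> exp (V y - V x)"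
      using xy exp_ge_add_one_self[of "V y - V x"] by linarith
  qed (simp_all add: entry_norm_nonneg)
  also have "\<dots> = real CARD('s) * (exp (V y - V x) * exp (V (last (y # ys)) - V y))"
    by (simp only: ac_simps)
  also have "\<dots> = real CARD('s) * exp (V (last (y # ys)) - V x)"
    by (simp add: exp_add[symmetric])
  finally show ?case by simp
qed (simp_all add: chain_product_single entry_norm_mat_1)

text \<open>
  The product of the bounds for the two partition products to the left and to the right of an inserted
  point.
\<close>

definition refinement_const :: real where
  "refinement_const = (real CARD('s))\<^sup>2 * exp (V b - V a)"

lemma refinement_const_nonneg: "0 \<le> refinement_const"
  by (simp add: refinement_const_def)

text \<open>
  Inserting \<open>u\<close> between \<open>r\<close> and \<open>s\<close> changes the product by a multiple of
  \<open>(V u - V r) (V s - V u)\<close>, which is half the decrease of the sum of squares of the increments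
  of \<open>V\<close>.
\<close>

lemma chain_product_insert:
  assumes "sorted (xs @ r # u # s # ys)" "set (xs @ r # u # s # ys) \<subseteq> {a..b}"
  shows "entry_norm (chain_product L (xs @ r # u # s # ys) - chain_product L (xs @ r # s # ys)) \<le>
    refinement_const / 2 * (square_sum V (xs @ r # s # ys) - square_sum V (xs @ r # u # s # ys))"
proof -
  let ?A = "chain_product L (xs @ [r])" and ?B = "chain_product L (s # ys)"
  let ?D = "(L u - L r) ** (L s - L u)"
  have rus: "a \<le> r" "r \<le> u" "u \<le> s" "s \<le> b"
    using assms by (auto simp: sorted_append)
  have hd: "a \<le> hd (xs @ [r])" "hd (xs @ [r]) \<le> r"
    using assms by (cases xs; auto simp: sorted_append)+
  have last: "last (s # ys) \<le> b"
  proof -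
    have "last (s # ys) \<in> set (s # ys)" by (rule last_in_set) simp
    then show ?thesis using assms(2) by auto
  qed
  have A: "entry_norm ?A \<le> real CARD('s) * exp (V r - V a)"
  proof -
    have "entry_norm ?A \<le> real CARD('s) * exp (V (last (xs @ [r])) - V (hd (xs @ [r])))"
      using assms by (intro chain_product_bound) (auto simp: sorted_append)
    also have "\<dots> \<le> real CARD('s) * exp (V r - V a)"
      using V_mono[of a "hd (xs @ [r])"] hd rus by (intro mult_left_mono) auto
    finally show ?thesis .
  qed
  have B: "entry_norm ?B \<le> real CARD('s) * exp (V b - V r)"
  proof -
    have "entry_norm ?B \<le> real CARD('s) * exp (V (last (s # ys)) - V (hd (s # ys)))"
      using assms by (intro chain_product_bound) (auto simp: sorted_append)
    also have "\<dots> \<le> real CARD('s) * exp (V b - V r)"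
    proof (intro mult_left_mono exp_le_cancel_iff[THEN iffD2])
      have "s \<le> last (s # ys)" using assms(1) by (cases ys rule: rev_cases) (auto simp: sorted_append)
      then show "V (last (s # ys)) - V (hd (s # ys)) \<le> V b - V r"
        using V_mono[of "last (s # ys)" b] V_mono[of r s] last rus by simp
    qed simp
    finally show ?thesis .
  qed
  have D: "entry_norm ?D \<le> (V u - V r) * (V s - V u)"
    using entry_norm_mult[of "L u - L r" "L s - L u"] dominated[of r u] dominated[of u s] rus V_mono[of r u]
    by (intro order_trans[OF entry_norm_mult] mult_mono) (auto simp: entry_norm_nonneg)
  have VD: "0 \<le> (V u - V r) * (V s - V u)"
    using V_mono[of r u] V_mono[of u s] rus by simp
  have diff: "chain_product L (xs @ r # u # s # ys) - chain_product L (xs @ r # s # ys) = ?A ** ?D ** ?B"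
  proof -
    have 1: "chain_product L (xs @ r # u # s # ys) = ?A ** ((mat 1 + (L u - L r)) ** ((mat 1 + (L s - L u)) ** ?B))"
      by (subst chain_product_append) (simp only: chain_product_Cons)
    have 2: "chain_product L (xs @ r # s # ys) = ?A ** ((mat 1 + (L s - L r)) ** ?B)"
      by (subst chain_product_append) (simp only: chain_product_Cons)
    have 3: "(mat 1 + (L u - L r)) ** (mat 1 + (L s - L u)) = mat 1 + (L s - L r) + ?D"
      by (simp add: matrix_add_ldistrib matrix_mult_add_left)
    show ?thesis
      unfolding 1 2 matrix_mul_assoc[of "mat 1 + (L u - L r)"] 3
      by (simp add: matrix_add_ldistrib matrix_mult_add_left matrix_mul_assoc)
  qed
  have "entry_norm (chain_product L (xs @ r # u # s # ys) - chain_product L (xs @ r # s # ys))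
      \<le> entry_norm ?A * entry_norm ?D * entry_norm ?B"
    unfolding diff
    by (rule order_trans[OF entry_norm_mult mult_right_mono[OF entry_norm_mult entry_norm_nonneg]])
  also have "\<dots> \<le> (real CARD('s) * exp (V r - V a)) * ((V u - V r) * (V s - V u)) * (real CARD('s) * exp (V b - V r))"
    using A B D VD by (intro mult_mono) (auto simp: entry_norm_nonneg)
  also have "\<dots> = refinement_const * ((V u - V r) * (V s - V u))"
  proof -
    have "exp (V b - V a) = exp (V r - V a) * exp (V b - V r)"
      by (simp add: exp_add[symmetric])
    then show ?thesis by (simp add: refinement_const_def power2_eq_square)
  qed
  also have "\<dots> = refinement_const / 2 * (square_sum V (xs @ r # s # ys) - square_sum V (xs @ r # u # s # ys))"
  proof -
    have "square_sum V (xs @ r # s # ys) - square_sum V (xs @ r # u # s # ys) = (V s - V r)\<^sup>2 - ((V u - V r)\<^sup>2 + (V s - V u)\<^sup>2)"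
      by (subst (1 2) square_sum_append) simp
    also have "\<dots> = 2 * ((V u - V r) * (V s - V u))"
      by (simp add: power2_eq_square algebra_simps)
    finally show ?thesis by simp
  qed
  finally show ?thesis .
qed

definition square_mesh :: "real set \<Rightarrow> real" where
  "square_mesh D = square_sum V (sorted_list_of_set ({a, b} \<union> D))"

lemma partition_product_refine:
  assumes "finite D" "D \<subseteq> {a<..<b}" "finite E" "E \<subseteq> {a<..<b}"
  shows "entry_norm (partition_product L a b (D \<union> E) - partition_product L a b D) \<le> refinement_const / 2 * (square_mesh D - square_mesh (D \<union> E))"
  using assms(3,4)
proof (induction E rule: finite_induct)
  case empty
  show ?case by (simp add: entry_norm_def)
next
  case (insert u E)
  show ?case
  proof (cases "u \<in> D")
    case True
    then have "D \<union> insert u E = D \<union> E" by auto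
    moreover have "E \<subseteq> {a<..<b}" using insert.prems by simp
    ultimately show ?thesis using insert.IH by metis
  next
    case False
    define zs where "zs = sorted_list_of_set ({a, b} \<union> (D \<union> E))"
    have fin: "finite ({a, b} \<union> (D \<union> E))"
      using assms(1) insert.hyps(1) by simp
    have zs: "sorted zs" "distinct zs" "set zs = {a, b} \<union> (D \<union> E)"
      unfolding zs_def using set_sorted_list_of_set[OF fin]
      by (simp_all only: sorted_sorted_list_of_set distinct_sorted_list_of_set)
    have u: "u \<notin> set zs" "a < u" "u < b"
      using insert.hyps insert.prems False zs(3) by auto
    have az: "a \<in> set zs" "b \<in> set zs"
      using zs(3) by auto
    obtain xs r s ys where z: "zs = xs @ r # s # ys" "r < u" "u < s"
      "sorted_list_of_set (insert u (set zs)) = xs @ r # u # s # ys"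
      by (rule sorted_insert_between[OF zs(1,2) u(1) az(1) u(2) az(2) u(3)])
    have ins: "{a, b} \<union> (D \<union> insert u E) = insert u (set zs)"
      using zs(3) by auto
    have sorted: "sorted (xs @ r # u # s # ys)"
      unfolding z(4)[symmetric] by (rule sorted_sorted_list_of_set)
    have set: "set (xs @ r # u # s # ys) \<subseteq> {a..b}"
    proof -
      have "set (xs @ r # u # s # ys) = insert u (set zs)"
        unfolding z(4)[symmetric] by (rule set_sorted_list_of_set) simp
      moreover have "insert u (set zs) \<subseteq> {a..b}"
        using zs(3) u insert.prems assms(2) ab greaterThanLessThan_subseteq_atLeastAtMost_iff[of a b a b]
        by auto
      ultimately show ?thesis by simp
    qed
    have "entry_norm (partition_product L a b (D \<union> insert u E) - partition_product L a b (D \<union> E))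
        \<le> refinement_const / 2 * (square_mesh (D \<union> E) - square_mesh (D \<union> insert u E))"
      unfolding partition_product_eq square_mesh_def ins z(4) zs_def[symmetric] unfolding z(1)
      by (rule chain_product_insert[OF sorted set])
    moreover have "entry_norm (partition_product L a b (D \<union> E) - partition_product L a b D) \<le> refinement_const / 2 * (square_mesh D - square_mesh (D \<union> E))"
      by (rule insert.IH) (use insert.prems in simp)
    moreover have "entry_norm (partition_product L a b (D \<union> insert u E) - partition_product L a b D) \<le>
        entry_norm (partition_product L a b (D \<union> insert u E) - partition_product L a b (D \<union> E)) +
        entry_norm (partition_product L a b (D \<union> E) - partition_product L a b D)"
      using entry_norm_add[of "partition_product L a b (D \<union> insert u E) - partition_product L a b (D \<union> E)"
        "partition_product L a b (D \<union> E) - partition_product L a b D"] by simp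
    ultimately show ?thesis
      by (simp add: right_diff_distrib)
  qed
qed

text \<open>
  The sums of squares decrease under refinement and are nonnegative, so they converge along the
  partitions; by the previous estimate the products form a Cauchy net.
\<close>

lemma has_product_integral_product_integral:
  "has_product_integral L a b (product_integral L a b)"
proof -
  let ?F = "finite_subsets_at_top {a<..<b}"
  define I where "I = Inf (square_mesh ` {D. finite D \<and> D \<subseteq> {a<..<b}})"
  have bdd: "bdd_below (square_mesh ` {D. finite D \<and> D \<subseteq> {a<..<b}})"
    by (rule bdd_belowI[of _ 0]) (auto simp: square_mesh_def square_sum_nonneg)
  have I: "I \<le> square_mesh D" if "finite D" "D \<subseteq> {a<..<b}" for D
    unfolding I_def using that by (intro cInf_lower bdd) auto
  have "cauchy_filter (filtermap (partition_product L a b) ?F)"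
    unfolding cauchy_filter_metric_filtermap
  proof (intro allI impI)
    fix e :: real assume e: "0 < e"
    \<comment> \<open>The summand \<open>1\<close> only serves to keep the denominator positive.\<close>
    define d where "d = e / (refinement_const + 1)"
    have d: "0 < d" using e refinement_const_nonneg by (simp add: d_def)
    have "Inf (square_mesh ` {D. finite D \<and> D \<subseteq> {a<..<b}}) < I + d"
      using d by (simp add: I_def)
    then obtain D0 where D0: "finite D0" "D0 \<subseteq> {a<..<b}" "square_mesh D0 < I + d"
      using bdd by (subst (asm) cInf_less_iff) auto
    have close: "dist (partition_product L a b D) (partition_product L a b D0) < e / 2"
      if D: "finite D" "D \<subseteq> {a<..<b}" "D0 \<subseteq> D" for D
    proof -
      have "D0 \<union> D = D" using D by auto
      then have "entry_norm (partition_product L a b D - partition_product L a b D0) \<le> refinement_const / 2 * (square_mesh D0 - square_mesh D)"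
        using partition_product_refine[OF D0(1,2) D(1,2)] by simp
      also have "\<dots> \<le> refinement_const / 2 * d"
        using I[OF D(1,2)] D0(3) refinement_const_nonneg by (intro mult_left_mono) auto
      also have "\<dots> < (refinement_const + 1) / 2 * d"
        using d by (simp add: field_simps)
      also have "\<dots> = e / 2"
      proof -
        have "refinement_const + 1 \<noteq> 0" using refinement_const_nonneg by simp
        then have "(refinement_const + 1) * d = e" by (simp add: d_def)
        then show ?thesis by simp
      qed
      finally show ?thesis
        using norm_le_entry_norm[of "partition_product L a b D - partition_product L a b D0"]
        by (simp add: dist_norm)
    qed
    show "\<exists>P. eventually P ?F \<and> (\<forall>x y. P x \<and> P y \<longrightarrow>
        dist (partition_product L a b x) (partition_product L a b y) < e)"
    proof (intro exI conjI allI impI)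
      show "\<forall>\<^sub>F D in ?F. finite D \<and> D \<subseteq> {a<..<b} \<and> D0 \<subseteq> D"
        unfolding eventually_finite_subsets_at_top
        by (rule exI[of _ D0]) (use D0(1,2) in simp)
      fix x y assume "(finite x \<and> x \<subseteq> {a<..<b} \<and> D0 \<subseteq> x) \<and> (finite y \<and> y \<subseteq> {a<..<b} \<and> D0 \<subseteq> y)"
      then show "dist (partition_product L a b x) (partition_product L a b y) < e"
        by (rule_tac dist_triangle_half_l[OF close close]) simp_all
    qed
  qed
  then have "convergent_filter (filtermap (partition_product L a b) ?F)"
    by (rule cauchy_filter_convergent)
  then obtain P where P: "(partition_product L a b \<longlongrightarrow> P) ?F"
    unfolding filterlim_def convergent_filter.simps by blast
  have "Lim ?F (partition_product L a b) = P"
    by (rule tendsto_Lim[OF _ P]) simp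
  with P show ?thesis
    by (simp only: has_product_integral_def product_integral_def)
qed

text \<open>
  The errors of the single steps are carried to the end by the products of the remaining factors,
  whose norms are uniformly bounded, and the weights \<open>V s - V r\<close> add up to an increment of \<open>V\<close>.
\<close>

lemma chain_product_telescope:
  assumes "sorted xs" "set xs \<subseteq> {a..b}" "xs \<noteq> []" and e: "0 \<le> e"
    and "successively (\<lambda>r s. entry_norm (W s - W r ** (mat 1 + (L s - L r))) \<le> e * (V s - V r)) xs"
  shows "entry_norm (W (last xs) - W (hd xs) ** chain_product L xs) \<le>
    e * real CARD('s) * exp (V b - V a) * (V (last xs) - V (hd xs))"
  using assms(1-3,5)
proof (induction xs rule: induct_list012)
  case (2 x)
  show ?case
    by (simp add: chain_product_single entry_norm_def)
next
  case (3 x y ys)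
  let ?P = "chain_product L (y # ys)" and ?l = "last (y # ys)"
  let ?M = "real CARD('s) * exp (V b - V a)"
  have IH: "entry_norm (W ?l - W y ** ?P) \<le> e * real CARD('s) * exp (V b - V a) * (V ?l - V y)"
    using 3 by simp
  have step: "entry_norm (W y - W x ** (mat 1 + (L y - L x))) \<le> e * (V y - V x)"
    using "3.prems"(4) by simp
  have l: "?l \<in> set (y # ys)" by (rule last_in_set) simp
  have xy: "a \<le> x" "x \<le> y" "y \<le> ?l" "?l \<le> b"
  proof -
    show "a \<le> x" "x \<le> y" "y \<le> ?l" using "3.prems"(1,2) l by auto
    show "?l \<le> b" using "3.prems"(2) l by (metis atLeastAtMost_iff list.set_intros(2) subsetD)
  qed
  have "entry_norm ?P \<le> real CARD('s) * exp (V ?l - V (hd (y # ys)))"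
    using "3.prems" by (intro chain_product_bound) auto
  also have "\<dots> \<le> ?M"
    using V_mono[of ?l b] V_mono[of a x] V_mono[of x y] xy by (intro mult_left_mono) auto
  finally have P: "entry_norm ?P \<le> ?M" .
  have "W ?l - W x ** chain_product L (x # y # ys) =
      (W ?l - W y ** ?P) + (W y - W x ** (mat 1 + (L y - L x))) ** ?P"
    by (simp add: chain_product_Cons matrix_mul_assoc matrix_mult_diff_left)
  then have "entry_norm (W ?l - W x ** chain_product L (x # y # ys)) \<le>
      entry_norm (W ?l - W y ** ?P) + entry_norm (W y - W x ** (mat 1 + (L y - L x))) * entry_norm ?P"
    by (simp only: order_trans[OF entry_norm_add add_left_mono[OF entry_norm_mult]])
  also have "\<dots> \<le> e * real CARD('s) * exp (V b - V a) * (V ?l - V y) + e * (V y - V x) * ?M"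
    using e V_mono[of x y] xy by (intro add_mono mult_mono IH step P) (auto simp: entry_norm_nonneg)
  also have "\<dots> = e * real CARD('s) * exp (V b - V a) * (V ?l - V x)"
    by (simp add: algebra_simps)
  finally show ?case by simp
qed simp

end


lemma successively_no_point_between:
  assumes "sorted xs" "distinct (xs :: real list)"
  shows "successively (\<lambda>r s. r \<in> set xs \<and> s \<in> set xs \<and> r < s \<and> {r<..<s} \<inter> set xs = {}) xs"
  using assms
proof (induction xs rule: induct_list012)
  case (3 x y ys)
  have xy: "x < y" "\<forall>w\<in>set (y # ys). y \<le> w"
    using "3.prems" by (auto simp: order_le_less)
  have "successively (\<lambda>r s. r \<in> set (x # y # ys) \<and> s \<in> set (x # y # ys) \<and> r < s \<and> {r<..<s} \<inter> set (x # y # ys) = {}) (y # ys)"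
  proof (rule successively_mono)
    show "successively (\<lambda>r s. r \<in> set (y # ys) \<and> s \<in> set (y # ys) \<and> r < s \<and> {r<..<s} \<inter> set (y # ys) = {}) (y # ys)"
      using 3 by simp
    fix r s
    assume rs: "r \<in> set (y # ys) \<and> s \<in> set (y # ys) \<and> r < s \<and> {r<..<s} \<inter> set (y # ys) = {}"
    have "y \<le> r" using rs xy(2) by blast
    then have "x \<notin> {r<..<s}" using xy(1) by simp
    then show "r \<in> set (x # y # ys) \<and> s \<in> set (x # y # ys) \<and> r < s \<and> {r<..<s} \<inter> set (x # y # ys) = {}"
      using rs by (simp add: disjoint_iff)
  qed
  moreover have "{x<..<y} \<inter> set (x # y # ys) = {}"
    using xy(2) by (auto simp: disjoint_iff not_less)
  ultimately show ?case
    using xy(1) by (simp only: successively.simps) simp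
qed simp_all

section \<open>The linear Stieltjes equation\<close>

text \<open>
  The partition points are the first times at which \<open>V\<close> reaches the levels \<open>V 0 + k e\<close>.  Between
  two of them \<open>V\<close> cannot cross a level; jumps of \<open>V\<close> occur at the right end of an interval, which
  is why \<open>u = s\<close> is excluded.
\<close>

lemma fine_partition:
  fixes V :: "real \<Rightarrow> real"
  assumes mono: "\<And>r s. 0 \<le> r \<Longrightarrow> r \<le> s \<Longrightarrow> V r \<le> V s"
    and cont: "\<And>r. 0 \<le> r \<Longrightarrow> continuous (at_right r) V"
    and e: "0 < e"
  obtains D where "finite D" "D \<subseteq> {0<..<t}"
    "\<forall>r s u. 0 \<le> r \<and> r \<le> u \<and> u < s \<and> s \<le> t \<and> {r<..<s} \<inter> D = {} \<longrightarrow> V u - V r \<le> e"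
proof -
  define S where "S k = {w \<in> {0..t}. V 0 + real k * e \<le> V w}" for k
  define x where "x k = Inf (S k)" for k
  define N where "N = nat \<lceil>(V t - V 0) / e\<rceil>"
  define D where "D = x ` {..N} \<inter> {0<..<t}"
  have bdd: "bdd_below (S k)" for k
    by (rule bdd_belowI[of _ 0]) (simp add: S_def)
  have main: "V u - V r \<le> e" if rsu: "0 \<le> r" "r \<le> u" "u < s" "s \<le> t" "{r<..<s} \<inter> D = {}" for r s u
  proof (rule ccontr)
    assume "\<not> V u - V r \<le> e"
    then have Vu: "V r + e < V u" by simp
    define y where "y = (V r - V 0) / e"
    have y: "0 \<le> y" "V r = V 0 + y * e"
      using e mono[of 0 r] rsu by (simp_all add: y_def)
    \<comment> \<open>\<open>V 0 + k e\<close> is the first level strictly above \<open>V r\<close>.\<close>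
    define k where "k = nat (\<lfloor>y\<rfloor> + 1)"
    have "real k = of_int \<lfloor>y\<rfloor> + 1"
      using y(1) by (simp add: k_def)
    then have "y < real k" "real k \<le> y + 1"
      by linarith+
    then have "y * e < real k * e" "real k * e \<le> (y + 1) * e"
      using e by simp_all
    then have k: "V r < V 0 + real k * e" "V 0 + real k * e < V u"
      using y(2) Vu by (simp_all add: distrib_right)
    have u: "u \<in> S k"
      using k rsu by (simp add: S_def)
    have x_u: "x k \<le> u"
      unfolding x_def by (rule cInf_lower[OF u bdd])
    have x_0: "0 \<le> x k"
      unfolding x_def using u by (intro cInf_greatest) (auto simp: S_def)
    have "V 0 + real k * e \<le> V (x k)"
    proof (rule ccontr)
      assume "\<not> V 0 + real k * e \<le> V (x k)"
      then have "V (x k) < V 0 + real k * e" by simp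
      then have "\<forall>\<^sub>F w in at_right (x k). V w < V 0 + real k * e"
        using cont[OF x_0] by (intro order_tendstoD(2)) (simp_all add: continuous_within)
      then obtain c where c: "x k < c" "\<forall>w>x k. w < c \<longrightarrow> V w < V 0 + real k * e"
        unfolding eventually_at_right_field by blast
      have "c \<le> w" if w: "w \<in> S k" for w
      proof (rule ccontr)
        assume "\<not> c \<le> w"
        moreover have "x k \<le> w"
          unfolding x_def by (rule cInf_lower[OF w bdd])
        moreover have "V 0 + real k * e \<le> V w"
          using w by (simp add: S_def)
        moreover have "w \<noteq> x k"
          using \<open>V (x k) < V 0 + real k * e\<close> \<open>V 0 + real k * e \<le> V w\<close> by auto
        ultimately show False
          using c(2)[rule_format, of w] by linarith
      qed
      then have "c \<le> x k"
        unfolding x_def using u by (intro cInf_greatest) auto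
      with c(1) show False by simp
    qed
    then have x_r: "r < x k"
      using mono[OF x_0, of r] k(1) by linarith
    have "real k * e \<le> V t - V 0"
      using k(2) mono[of u t] rsu by simp
    then have "real k \<le> (V t - V 0) / e"
      using e by (simp add: pos_le_divide_eq)
    then have "k \<le> N"
      unfolding N_def by linarith
    then have "x k \<in> x ` {..N}"
      by simp
    moreover have "x k \<in> {r<..<s}" "x k \<in> {0<..<t}"
      using x_r x_u rsu by simp_all
    ultimately have "x k \<in> {r<..<s} \<inter> D"
      unfolding D_def by blast
    with rsu(5) show False by blast
  qed
  show ?thesis
  proof (rule that)
    show "finite D" "D \<subseteq> {0<..<t}"
      by (auto simp: D_def)
    show "\<forall>r s u. 0 \<le> r \<and> r \<le> u \<and> u < s \<and> s \<le> t \<and> {r<..<s} \<inter> D = {} \<longrightarrow> V u - V r \<le> e"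
      using main by blast
  qed
qed

text \<open>
  Along an interval \<open>(r,s]\<close> of a partition the solution \<open>W\<close> misses the difference equation by the
  integral of \<open>W(u-) - W(r)\<close> against \<open>L(du)\<close>.  Here \<open>W(u-)\<close> involves times before \<open>s\<close> only, so
  the integrand is small as soon as \<open>V\<close> grows little on the half-open interval \<open>[r,s)\<close>, however large
  its jump at \<open>s\<close> may be.
\<close>

lemma
  fixes L W :: "real \<Rightarrow> real^'s^'s::finite"
  assumes L: "\<And>i j. rcfv (\<lambda>t. L t $ i $ j)"
    and t: "0 \<le> t"
  shows has_product_integral_rcfv: "has_product_integral L 0 t (product_integral L 0 t)"
    and linear_equation_product_integral:
      "(\<And>i j. rcfv (\<lambda>t. W t $ i $ j)) \<Longrightarrow>
       (\<And>i j t. 0 \<le> t \<Longrightarrow> W t $ i $ j - W 0 $ i $ j =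
          (\<Sum>k\<in>UNIV. ls_integral (left_lim (\<lambda>s. W s $ i $ k)) (\<lambda>s. L s $ k $ j) 0 t)) \<Longrightarrow>
       W t = W 0 ** product_integral L 0 t"
proof -
  define v where "v i j s = total_variation (\<lambda>t. L t $ i $ j) 0 s" for i j s
  define V where "V s = (\<Sum>i\<in>UNIV. \<Sum>j\<in>UNIV. v i j s)" for s
  have v_mono: "v i j r \<le> v i j s" if "0 \<le> r" "r \<le> s" for i j r s
    unfolding v_def by (rule total_variation_mono[OF L that])
  have V_diff: "V s - V r = (\<Sum>i\<in>UNIV. \<Sum>j\<in>UNIV. v i j s - v i j r)" for r s
    by (simp add: V_def sum_subtractf)
  interpret dominated_matrix_function L V 0 t
  proof
    fix r s :: real assume "0 \<le> r" "r \<le> s"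
    then show "entry_norm (L s - L r) \<le> V s - V r"
      unfolding V_diff entry_norm_def v_def
      by (intro sum_mono) (simp add: abs_diff_le_total_variation[OF L])
  qed (rule t)
  show prod: "has_product_integral L 0 t (product_integral L 0 t)"
    by (rule has_product_integral_product_integral)
  assume W: "\<And>i j. rcfv (\<lambda>t. W t $ i $ j)"
    and eq: "\<And>i j t. 0 \<le> t \<Longrightarrow> W t $ i $ j - W 0 $ i $ j =
          (\<Sum>k\<in>UNIV. ls_integral (left_lim (\<lambda>s. W s $ i $ k)) (\<lambda>s. L s $ k $ j) 0 t)"
  define w where "w i k = left_lim (\<lambda>s. W s $ i $ k)" for i k
  define C where "C = (\<Sum>i\<in>UNIV. \<Sum>k\<in>UNIV. \<bar>W 0 $ i $ k\<bar> + total_variation (\<lambda>s. W s $ i $ k) 0 t)"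
  have TV_nonneg: "0 \<le> total_variation (\<lambda>s. W s $ i $ k) 0 t" for i k
    using total_variation_mono[OF W order_refl t] by (simp add: total_variation_refl)
  have C: "0 \<le> C"
    unfolding C_def by (intro sum_nonneg add_nonneg_nonneg TV_nonneg) auto
  have w_bb: "bounded_borel T (w i k)" for T i k
    unfolding w_def by (rule bounded_borel_left_lim[OF W])
  have w_le: "\<bar>w i k s\<bar> \<le> C" if s: "s \<in> {0<..t}" for i k s
  proof -
    have "\<bar>w i k s\<bar> \<le> \<bar>W 0 $ i $ k\<bar> + total_variation (\<lambda>s. W s $ i $ k) 0 t"
      unfolding w_def by (rule left_lim_bounded[OF W s])
    also have "\<dots> \<le> (\<Sum>k\<in>UNIV. \<bar>W 0 $ i $ k\<bar> + total_variation (\<lambda>s. W s $ i $ k) 0 t)"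
      by (rule member_le_sum[where f = "\<lambda>k. \<bar>W 0 $ i $ k\<bar> + total_variation (\<lambda>s. W s $ i $ k) 0 t"])
         (simp_all add: TV_nonneg)
    also have "\<dots> \<le> C"
      unfolding C_def
      by (rule member_le_sum[where f = "\<lambda>i. \<Sum>k\<in>UNIV. \<bar>W 0 $ i $ k\<bar> + total_variation (\<lambda>s. W s $ i $ k) 0 t"])
         (simp_all add: TV_nonneg sum_nonneg)
    finally show ?thesis .
  qed
  have inc: "W s $ i $ j - W r $ i $ j = (\<Sum>k\<in>UNIV. ls_integral (w i k) (\<lambda>s. L s $ k $ j) r s)"
    if rs: "0 \<le> r" "r \<le> s" for r s i j
  proof -
    have split: "ls_integral (w i k) (\<lambda>s. L s $ k $ j) 0 s =
        ls_integral (w i k) (\<lambda>s. L s $ k $ j) 0 r + ls_integral (w i k) (\<lambda>s. L s $ k $ j) r s" for k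
      by (rule ls_integral_split[OF L rs w_bb])
    have "W s $ i $ j - W r $ i $ j = (W s $ i $ j - W 0 $ i $ j) - (W r $ i $ j - W 0 $ i $ j)"
      by simp
    also have "\<dots> = (\<Sum>k\<in>UNIV. ls_integral (w i k) (\<lambda>s. L s $ k $ j) 0 s) - (\<Sum>k\<in>UNIV. ls_integral (w i k) (\<lambda>s. L s $ k $ j) 0 r)"
      using rs eq[of s i j] eq[of r i j] by (simp add: w_def)
    also have "\<dots> = (\<Sum>k\<in>UNIV. ls_integral (w i k) (\<lambda>s. L s $ k $ j) r s)"
      unfolding split by (simp add: sum.distrib)
    finally show ?thesis .
  qed
  have column: "(\<Sum>k\<in>UNIV. v k j s - v k j r) \<le> V s - V r" if "0 \<le> r" "r \<le> s" for r s j
    unfolding V_diff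
  proof (rule sum_mono)
    fix k
    show "v k j s - v k j r \<le> (\<Sum>j\<in>UNIV. v k j s - v k j r)"
      by (rule member_le_sum[where f = "\<lambda>j. v k j s - v k j r"]) (simp_all add: v_mono[OF that])
  qed
  have W_le: "\<bar>W s $ i $ j - W r $ i $ j\<bar> \<le> C * (V s - V r)" if rs: "0 \<le> r" "r \<le> s" "s \<le> t" for r s i j
  proof -
    have "\<bar>W s $ i $ j - W r $ i $ j\<bar> \<le> (\<Sum>k\<in>UNIV. \<bar>ls_integral (w i k) (\<lambda>s. L s $ k $ j) r s\<bar>)"
      unfolding inc[OF rs(1,2)] by (rule sum_abs)
    also have "\<dots> \<le> (\<Sum>k\<in>UNIV. C * (v k j s - v k j r))"
      unfolding v_def using rs by (intro sum_mono abs_ls_integral_le[OF L rs(1,2) w_bb] w_le) simp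
    also have "\<dots> \<le> C * (V s - V r)"
      unfolding sum_distrib_left[symmetric] by (intro mult_left_mono column rs C)
    finally show ?thesis .
  qed
  define n where "n = real CARD('s)"
  have error: "entry_norm (W s - W r ** (mat 1 + (L s - L r))) \<le> n * C * e * (V s - V r)"
    if rs: "0 \<le> r" "r < s" "s \<le> t" and e: "0 \<le> e" and small: "\<And>u. r \<le> u \<Longrightarrow> u < s \<Longrightarrow> V u - V r \<le> e" for r s e
  proof -
    have osc: "\<bar>w i k u - W r $ i $ k\<bar> \<le> C * e" if u: "u \<in> {r<..s}" for i k u
    proof (rule tendsto_upperbound)
      show "((\<lambda>x. \<bar>W x $ i $ k - W r $ i $ k\<bar>) \<longlongrightarrow> \<bar>w i k u - W r $ i $ k\<bar>) (at_left u)"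
        unfolding w_def using u rs by (intro tendsto_rabs tendsto_diff tendsto_const tendsto_left_lim W) simp
      have "\<bar>W x $ i $ k - W r $ i $ k\<bar> \<le> C * e" if x: "r < x" "x < u" for x
      proof -
        have "\<bar>W x $ i $ k - W r $ i $ k\<bar> \<le> C * (V x - V r)"
          using x u rs by (intro W_le) auto
        also have "\<dots> \<le> C * e"
          using x u by (intro mult_left_mono small C) auto
        finally show ?thesis .
      qed
      then show "\<forall>\<^sub>F x in at_left u. \<bar>W x $ i $ k - W r $ i $ k\<bar> \<le> C * e"
        using u by (auto simp: eventually_at_left_field)
    qed simp
    have entry: "\<bar>(W s - W r ** (mat 1 + (L s - L r))) $ i $ j\<bar> \<le> C * e * (\<Sum>k\<in>UNIV. v k j s - v k j r)" for i j
    proof -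
      have "(W s - W r ** (mat 1 + (L s - L r))) $ i $ j =
          (W s $ i $ j - W r $ i $ j) - (\<Sum>k\<in>UNIV. W r $ i $ k * (L s $ k $ j - L r $ k $ j))"
        by (simp add: matrix_add_ldistrib) (simp add: matrix_matrix_mult_def)
      also have "\<dots> = (\<Sum>k\<in>UNIV. ls_integral (w i k) (\<lambda>s. L s $ k $ j) r s -
          ls_integral (\<lambda>_. W r $ i $ k) (\<lambda>s. L s $ k $ j) r s)"
        using rs by (simp add: inc sum_subtractf ls_integral_const[OF L])
      also have "\<dots> = (\<Sum>k\<in>UNIV. ls_integral (\<lambda>u. w i k u - W r $ i $ k) (\<lambda>s. L s $ k $ j) r s)"
        by (rule sum.cong[OF refl], rule ls_integral_diff[symmetric, OF L rs(1) w_bb bounded_borel_const])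
      finally have eq: "(W s - W r ** (mat 1 + (L s - L r))) $ i $ j =
          (\<Sum>k\<in>UNIV. ls_integral (\<lambda>u. w i k u - W r $ i $ k) (\<lambda>s. L s $ k $ j) r s)" .
      have "\<bar>(W s - W r ** (mat 1 + (L s - L r))) $ i $ j\<bar> \<le>
          (\<Sum>k\<in>UNIV. \<bar>ls_integral (\<lambda>u. w i k u - W r $ i $ k) (\<lambda>s. L s $ k $ j) r s\<bar>)"
        unfolding eq by (rule sum_abs)
      also have "\<dots> \<le> (\<Sum>k\<in>UNIV. C * e * (v k j s - v k j r))"
        unfolding v_def using rs
        by (intro sum_mono abs_ls_integral_le[OF L rs(1) less_imp_le[OF rs(2)]] osc bounded_borel_diff w_bb bounded_borel_const)
      finally show ?thesis
        by (simp add: sum_distrib_left)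
    qed
    have "entry_norm (W s - W r ** (mat 1 + (L s - L r))) \<le>
        (\<Sum>i\<in>(UNIV::'s set). \<Sum>j\<in>UNIV. C * e * (\<Sum>k\<in>UNIV. v k j s - v k j r))"
      unfolding entry_norm_def by (intro sum_mono entry)
    also have "\<dots> = n * (C * e * (\<Sum>j\<in>UNIV. \<Sum>k\<in>UNIV. v k j s - v k j r))"
      by (simp add: n_def sum_distrib_left)
    also have "(\<Sum>j\<in>UNIV. \<Sum>k\<in>UNIV. v k j s - v k j r) = V s - V r"
      unfolding V_diff by (rule sum.swap)
    finally show ?thesis by (simp add: mult.assoc)
  qed
  have V_mono': "V r \<le> V s" if "0 \<le> r" "r \<le> s" for r s
    unfolding V_def by (intro sum_mono v_mono that)
  have V_cont: "continuous (at_right r) V" if "0 \<le> r" for r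
    unfolding V_def[abs_def] v_def
    by (rule continuous_sum, rule continuous_sum, rule total_variation_right_continuous[OF L that])
  define c where "c = n * C * n * exp (V t - V 0) * (V t - V 0)"
  have c: "0 \<le> c"
    using C V_mono'[OF order_refl t] by (simp add: c_def n_def)
  have near: "\<forall>\<^sub>F D in finite_subsets_at_top {0<..<t}.
      entry_norm (W t - W 0 ** partition_product L 0 t D) \<le> c * e" if e: "0 < e" for e
  proof -
    obtain D0 where D0: "finite D0" "D0 \<subseteq> {0<..<t}"
      "\<forall>r s u. 0 \<le> r \<and> r \<le> u \<and> u < s \<and> s \<le> t \<and> {r<..<s} \<inter> D0 = {} \<longrightarrow> V u - V r \<le> e"
      by (rule fine_partition[of V e t, OF V_mono' V_cont e])
    have "entry_norm (W t - W 0 ** partition_product L 0 t D) \<le> c * e"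
      if D: "finite D" "D0 \<subseteq> D" "D \<subseteq> {0<..<t}" for D
    proof -
      define xs where "xs = sorted_list_of_set ({0, t} \<union> D)"
      have xs: "sorted xs" "distinct xs"
        by (simp_all only: xs_def sorted_sorted_list_of_set distinct_sorted_list_of_set)
      have set_xs: "set xs = {0, t} \<union> D"
        unfolding xs_def using D(1) by (intro set_sorted_list_of_set) simp
      then have ne: "xs \<noteq> []" by auto
      have xs_sub: "set xs \<subseteq> {0..t}"
        using set_xs D(3) t by (auto dest!: subsetD)
      have "hd xs \<le> 0"
      proof -
        have "0 \<in> set xs" using set_xs by simp
        then show ?thesis using xs(1) by (cases xs) auto
      qed
      moreover have "0 \<le> hd xs"
        using xs_sub hd_in_set[OF ne] by auto
      ultimately have hd: "hd xs = 0" by simp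
      have "t \<le> last xs"
      proof -
        have "t \<in> set xs" using set_xs by simp
        then show ?thesis using xs(1) ne by (cases xs rule: rev_cases) (auto simp: sorted_append)
      qed
      moreover have "last xs \<le> t"
        using xs_sub last_in_set[OF ne] by auto
      ultimately have last: "last xs = t" by simp
      have "successively (\<lambda>r s. entry_norm (W s - W r ** (mat 1 + (L s - L r))) \<le> n * C * e * (V s - V r)) xs"
      proof (rule successively_mono[OF successively_no_point_between[OF xs]])
        fix r s assume rs: "r \<in> set xs \<and> s \<in> set xs \<and> r < s \<and> {r<..<s} \<inter> set xs = {}"
        have "{r<..<s} \<inter> D0 = {}"
          using rs set_xs D(2) by blast
        moreover have "0 \<le> r" "s \<le> t"
          using rs xs_sub by (auto simp: subset_iff)
        ultimately show "entry_norm (W s - W r ** (mat 1 + (L s - L r))) \<le> n * C * e * (V s - V r)"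
          using D0(3) rs e by (intro error) auto
      qed
      then have "entry_norm (W (last xs) - W (hd xs) ** chain_product L xs) \<le>
          (n * C * e) * real CARD('s) * exp (V t - V 0) * (V (last xs) - V (hd xs))"
        using C e by (intro chain_product_telescope xs(1) xs_sub ne) (simp_all add: n_def)
      then show ?thesis
        unfolding hd last partition_product_eq xs_def[symmetric] by (simp add: c_def n_def ac_simps)
    qed
    then show ?thesis
      unfolding eventually_finite_subsets_at_top
      by (intro exI[of _ D0] conjI D0(1,2) allI impI) auto
  qed
  \<comment> \<open>The products converge to \<open>W t\<close> by the estimate above and to the right-hand side by continuity.\<close>
  show "W t = W 0 ** product_integral L 0 t"
  proof (rule vec_eq_iff[THEN iffD2], rule allI, rule vec_eq_iff[THEN iffD2], rule allI)
    fix i j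
    have "((\<lambda>D. (W 0 ** partition_product L 0 t D) $ i $ j) \<longlongrightarrow> W t $ i $ j) (finite_subsets_at_top {0<..<t})"
    proof (rule tendstoI)
      fix e :: real assume e: "0 < e"
      have "\<forall>\<^sub>F D in finite_subsets_at_top {0<..<t}. entry_norm (W t - W 0 ** partition_product L 0 t D) \<le> c * (e / (c + 1))"
        using c e by (intro near) simp
      then show "\<forall>\<^sub>F D in finite_subsets_at_top {0<..<t}. dist ((W 0 ** partition_product L 0 t D) $ i $ j) (W t $ i $ j) < e"
      proof eventually_elim
        case (elim D)
        have "dist ((W 0 ** partition_product L 0 t D) $ i $ j) (W t $ i $ j) =
            \<bar>(W t - W 0 ** partition_product L 0 t D) $ i $ j\<bar>"
          by (simp add: dist_real_def abs_minus_commute)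
        also have "\<dots> \<le> entry_norm (W t - W 0 ** partition_product L 0 t D)"
          by (rule entry_le_entry_norm)
        also have "\<dots> \<le> c * (e / (c + 1))"
          by (rule elim)
        also have "\<dots> < e"
          using c e by (simp add: pos_divide_less_eq distrib_left mult.commute)
        finally show ?case .
      qed
    qed
    moreover have "((\<lambda>D. (W 0 ** partition_product L 0 t D) $ i $ j) \<longlongrightarrow>
        (W 0 ** product_integral L 0 t) $ i $ j) (finite_subsets_at_top {0<..<t})"
    proof -
      have "((\<lambda>D. \<Sum>k\<in>UNIV. W 0 $ i $ k * partition_product L 0 t D $ k $ j) \<longlongrightarrow>
          (\<Sum>k\<in>UNIV. W 0 $ i $ k * product_integral L 0 t $ k $ j)) (finite_subsets_at_top {0<..<t})"
        using prod unfolding has_product_integral_def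
        by (intro tendsto_sum tendsto_mult tendsto_const tendsto_vec_nth)
      then show ?thesis
        by (simp add: matrix_matrix_mult_def)
    qed
    ultimately show "W t $ i $ j = (W 0 ** product_integral L 0 t) $ i $ j"
      by (rule tendsto_unique[rotated]) simp
  qed
qed

section \<open>Expectations of path integrals\<close>

lemma (in prob_space) interval_measure_Fubini:
  fixes X :: "real \<Rightarrow> 'a \<Rightarrow> real"
  assumes F: "\<And>s t. s \<le> t \<Longrightarrow> F s \<le> F t" "\<And>t. continuous (at_right t) F"
    and X: "(\<lambda>(s, \<omega>). indicator {0<..T} s * X s \<omega>) \<in> borel_measurable (borel \<Otimes>\<^sub>M M)"
    and C: "\<And>s \<omega>. s \<in> {0<..T} \<Longrightarrow> \<omega> \<in> space M \<Longrightarrow> \<bar>X s \<omega>\<bar> \<le> C"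
  shows "integrable M (\<lambda>\<omega>. LINT s:{0<..T}|interval_measure F. X s \<omega>)"
    and "(\<integral>\<omega>. (LINT s:{0<..T}|interval_measure F. X s \<omega>) \<partial>M) = (LINT s:{0<..T}|interval_measure F. (\<integral>\<omega>. X s \<omega> \<partial>M))"
proof -
  interpret N: sigma_finite_measure "interval_measure F"
    by (rule sigma_finite_interval_measure) (fact F)+
  interpret P: pair_sigma_finite "interval_measure F" M ..
  have sets: "sets (interval_measure F \<Otimes>\<^sub>M M) = sets (borel \<Otimes>\<^sub>M M)"
    by (rule sets_pair_measure_cong) simp_all
  have int: "integrable (interval_measure F \<Otimes>\<^sub>M M) (\<lambda>(s, \<omega>). indicator {0<..T} s * X s \<omega>)"
  proof (rule integrableI_bounded_set[where A = "{0<..T} \<times> space M" and B = C])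
    show "{0<..T} \<times> space M \<in> sets (interval_measure F \<Otimes>\<^sub>M M)"
      by (rule pair_measureI) simp_all
    show "(\<lambda>(s, \<omega>). indicator {0<..T} s * X s \<omega>) \<in> borel_measurable (interval_measure F \<Otimes>\<^sub>M M)"
      using X by (simp only: measurable_cong_sets[OF sets refl])
    have "emeasure (interval_measure F \<Otimes>\<^sub>M M) ({0<..T} \<times> space M) = emeasure (interval_measure F) {0<..T} * emeasure M (space M)"
      by (rule emeasure_pair_measure_Times) simp_all
    then show "emeasure (interval_measure F \<Otimes>\<^sub>M M) ({0<..T} \<times> space M) < \<infinity>"
      by (simp add: emeasure_space_1 emeasure_interval_measure_Ioc_eq[OF F])
    show "AE x in interval_measure F \<Otimes>\<^sub>M M. x \<in> {0<..T} \<times> space M \<longrightarrow> norm (case x of (s, \<omega>) \<Rightarrow> indicator {0<..T} s * X s \<omega>) \<le> C"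
      using C by (intro AE_I2) (auto simp: space_pair_measure)
    show "AE x in interval_measure F \<Otimes>\<^sub>M M. x \<notin> {0<..T} \<times> space M \<longrightarrow> (case x of (s, \<omega>) \<Rightarrow> indicator {0<..T} s * X s \<omega>) = 0"
      by (intro AE_I2) (auto simp: space_pair_measure indicator_eq_0_iff)
  qed
  show "integrable M (\<lambda>\<omega>. LINT s:{0<..T}|interval_measure F. X s \<omega>)"
    using P.integrable_snd[OF int] by (simp add: set_lebesgue_integral_def)
  have "(\<integral>\<omega>. (LINT s:{0<..T}|interval_measure F. X s \<omega>) \<partial>M) = (\<integral>s. (\<integral>\<omega>. indicator {0<..T} s * X s \<omega> \<partial>M) \<partial>interval_measure F)"
    using P.Fubini_integral[OF int] by (simp add: set_lebesgue_integral_def)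
  then show "(\<integral>\<omega>. (LINT s:{0<..T}|interval_measure F. X s \<omega>) \<partial>M) = (LINT s:{0<..T}|interval_measure F. (\<integral>\<omega>. X s \<omega> \<partial>M))"
    by (simp add: set_lebesgue_integral_def)
qed

lemma (in prob_space)
  fixes X :: "real \<Rightarrow> 'a \<Rightarrow> real"
  assumes f: "rcfv f"
    and X: "(\<lambda>(s, \<omega>). indicator {0<..T} s * X s \<omega>) \<in> borel_measurable (borel \<Otimes>\<^sub>M M)"
    and C: "\<And>s \<omega>. s \<in> {0<..T} \<Longrightarrow> \<omega> \<in> space M \<Longrightarrow> \<bar>X s \<omega>\<bar> \<le> C"
  shows integrable_ls_integral: "integrable M (\<lambda>\<omega>. ls_integral (\<lambda>s. X s \<omega>) f 0 T)"
    and integral_ls_integral: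
      "(\<integral>\<omega>. ls_integral (\<lambda>s. X s \<omega>) f 0 T \<partial>M) = ls_integral (\<lambda>s. \<integral>\<omega>. X s \<omega> \<partial>M) f 0 T"
proof -
  have p: "integrable M (\<lambda>\<omega>. LINT s:{0<..T}|interval_measure (pos_var f). X s \<omega>)"
    "(\<integral>\<omega>. (LINT s:{0<..T}|interval_measure (pos_var f). X s \<omega>) \<partial>M) = (LINT s:{0<..T}|interval_measure (pos_var f). (\<integral>\<omega>. X s \<omega> \<partial>M))"
    by (rule interval_measure_Fubini[OF pos_var_mono[OF f] pos_var_right_continuous[OF f] X C]; assumption)+
  have n: "integrable M (\<lambda>\<omega>. LINT s:{0<..T}|interval_measure (neg_var f). X s \<omega>)"
    "(\<integral>\<omega>. (LINT s:{0<..T}|interval_measure (neg_var f). X s \<omega>) \<partial>M) = (LINT s:{0<..T}|interval_measure (neg_var f). (\<integral>\<omega>. X s \<omega> \<partial>M))"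
    by (rule interval_measure_Fubini[OF neg_var_mono[OF f] neg_var_right_continuous[OF f] X C]; assumption)+
  show "integrable M (\<lambda>\<omega>. ls_integral (\<lambda>s. X s \<omega>) f 0 T)"
    unfolding ls_integral_def by (intro Bochner_Integration.integrable_diff p(1) n(1))
  show "(\<integral>\<omega>. ls_integral (\<lambda>s. X s \<omega>) f 0 T \<partial>M) = ls_integral (\<lambda>s. \<integral>\<omega>. X s \<omega> \<partial>M) f 0 T"
    unfolding ls_integral_def
    by (subst Bochner_Integration.integral_diff[OF p(1) n(1)]) (simp only: p(2) n(2))
qed

section \<open>The weighted jump process\<close>

text \<open>
  The rates enter through the relation \<open>p(t-) F(dt) = G(dt)\<close> expressed by \<open>ls_quotient_wf\<close>; integrands
  are then bounded throughout, whereas \<open>1 / p(t-)\<close> may be unbounded.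
\<close>

locale weighted_jump_process = prob_space M for M :: "'a measure" +
  fixes Z :: "real \<Rightarrow> 'a \<Rightarrow> 's::finite" and z0 :: 's and H :: "real \<Rightarrow> 'a \<Rightarrow> real"
  assumes Z_rv: "\<And>t. 0 \<le> t \<Longrightarrow> Z t \<in> M \<rightarrow>\<^sub>M count_space UNIV"
    and Z_path: "\<And>\<omega>. \<omega> \<in> space M \<Longrightarrow> jump_path (\<lambda>t. Z t \<omega>)"
    and Z_init: "\<And>\<omega>. \<omega> \<in> space M \<Longrightarrow> Z 0 \<omega> = z0"
    and N_int: "\<And>j k t. j \<noteq> k \<Longrightarrow> 0 \<le> t \<Longrightarrow> integrable M (jump_count Z j k t)"
    and H_rv: "\<And>t. 0 \<le> t \<Longrightarrow> H t \<in> borel_measurable M"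
    and H_path: "\<And>\<omega>. \<omega> \<in> space M \<Longrightarrow> rcfv (\<lambda>t. H t \<omega>)"
    and H_bounded: "\<And>T. 0 \<le> T \<Longrightarrow> \<exists>C. \<forall>t\<in>{0..T}. \<forall>\<omega>\<in>space M. \<bar>H t \<omega>\<bar> \<le> C"
    and stay_int: "\<And>j t. 0 \<le> t \<Longrightarrow> integrable M (stay_integral Z H j t)"
    and jump_int: "\<And>j k t. j \<noteq> k \<Longrightarrow> 0 \<le> t \<Longrightarrow> integrable M (jump_integral Z H j k t)"
    and H_bar_wf: "\<And>j. ls_quotient_wf (p_bar M Z H j) (expected_stay M Z H j)"
    and Lambda_bar_wf:
      "\<And>j k. j \<noteq> k \<Longrightarrow> ls_quotient_wf (p_bar M Z H j) (expected_jump M Z H j k)"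
begin

abbreviation "jumps \<omega> j k \<equiv> jump_times (\<lambda>u. Z u \<omega>) j k"
abbreviation "occupied j s \<omega> \<equiv> of_bool (left_state (\<lambda>u. Z u \<omega>) s = j) :: real"
abbreviation "p \<equiv> p_bar M Z H"

lemma rcfv_jump_count:
  assumes "\<omega> \<in> space M" "j \<noteq> k"
  shows "rcfv (\<lambda>s. jump_count Z j k s \<omega>)"
  unfolding jump_count_eq_card by (rule rcfv_counting) (rule finite_jump_times[OF Z_path[OF assms(1)] assms(2)])

lemma ls_integral_jump_count:
  assumes "\<omega> \<in> space M" "j \<noteq> k" "0 \<le> T" "bounded_borel T g"
  shows "ls_integral g (\<lambda>s. jump_count Z j k s \<omega>) 0 T = (\<Sum>s\<in>jumps \<omega> j k \<inter> {0<..T}. g s)"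
  unfolding jump_count_eq_card
  by (rule ls_integral_counting[OF _ assms(3,4)]) (rule finite_jump_times[OF Z_path[OF assms(1)] assms(2)])

lemma jump_integral_eq:
  assumes "\<omega> \<in> space M" "j \<noteq> k" "0 \<le> T"
  shows "jump_integral Z H j k T \<omega> = (\<Sum>s\<in>jumps \<omega> j k \<inter> {0<..T}. H s \<omega>)"
  unfolding jump_integral_def
  by (rule ls_integral_jump_count[OF assms bounded_borel_rcfv[OF H_path[OF assms(1)]]])

lemma abs_sum_jumps_le:
  assumes "\<And>s. s \<in> {0<..T} \<Longrightarrow> \<bar>g s\<bar> \<le> C"
  shows "\<bar>\<Sum>s\<in>jumps \<omega> j k \<inter> {0<..T}. g s\<bar> \<le> C * jump_count Z j k T \<omega>"
proof -
  have "\<bar>\<Sum>s\<in>jumps \<omega> j k \<inter> {0<..T}. g s\<bar> \<le> (\<Sum>s\<in>jumps \<omega> j k \<inter> {0<..T}. \<bar>g s\<bar>)"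
    by (rule sum_abs)
  also have "\<dots> \<le> (\<Sum>s\<in>jumps \<omega> j k \<inter> {0<..T}. C)"
    using assms by (intro sum_mono) auto
  finally show ?thesis
    by (simp add: jump_count_eq_card mult.commute)
qed

lemma H_bound:
  assumes "0 \<le> T"
  obtains C where "0 \<le> C" "\<forall>t\<in>{0..T}. \<forall>\<omega>\<in>space M. \<bar>H t \<omega>\<bar> \<le> C"
proof -
  obtain C where C: "\<forall>t\<in>{0..T}. \<forall>\<omega>\<in>space M. \<bar>H t \<omega>\<bar> \<le> C"
    using H_bounded[OF assms] by (rule exE)
  show ?thesis
  proof (rule that[of "\<bar>C\<bar>"])
    show "\<forall>t\<in>{0..T}. \<forall>\<omega>\<in>space M. \<bar>H t \<omega>\<bar> \<le> \<bar>C\<bar>"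
      using C abs_ge_self[of C] order_trans by blast
  qed simp
qed

lemma measurable_weighted_state:
  "0 \<le> t \<Longrightarrow> (\<lambda>\<omega>. H t \<omega> * of_bool (Z t \<omega> = j)) \<in> borel_measurable M"
  by (intro borel_measurable_times H_rv measurable_compose[OF Z_rv]) simp_all

lemma integrable_weighted_state:
  assumes t: "0 \<le> t"
  shows "integrable M (\<lambda>\<omega>. H t \<omega> * of_bool (Z t \<omega> = j))"
proof -
  obtain C where C: "0 \<le> C" "\<forall>s\<in>{0..t}. \<forall>\<omega>\<in>space M. \<bar>H s \<omega>\<bar> \<le> C"
    by (rule H_bound[OF t])
  show ?thesis
  proof (rule integrable_const_bound[where B = C])
    show "AE \<omega> in M. norm (H t \<omega> * of_bool (Z t \<omega> = j)) \<le> C"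
      using C t by (intro AE_I2) (simp add: abs_mult of_bool_def)
  qed (rule measurable_weighted_state[OF t])
qed

lemma weighted_state_decomposition:
  assumes w: "\<omega> \<in> space M" and t: "0 \<le> t"
  shows "H t \<omega> * of_bool (Z t \<omega> = j) - H 0 \<omega> * of_bool (Z 0 \<omega> = j) =
    stay_integral Z H j t \<omega> + (\<Sum>k\<in>UNIV - {j}. jump_integral Z H k j t \<omega>) -
    (\<Sum>k\<in>UNIV - {j}. jump_integral Z H j k t \<omega>)"
proof -
  have 1: "(\<Sum>k\<in>UNIV - {j}. jump_integral Z H k j t \<omega>) = (\<Sum>k\<in>UNIV - {j}. \<Sum>s\<in>jumps \<omega> k j \<inter> {0<..t}. H s \<omega>)"
    by (rule sum.cong[OF refl], rule jump_integral_eq[OF w _ t]) simp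
  have 2: "(\<Sum>k\<in>UNIV - {j}. jump_integral Z H j k t \<omega>) = (\<Sum>k\<in>UNIV - {j}. \<Sum>s\<in>jumps \<omega> j k \<inter> {0<..t}. H s \<omega>)"
    by (rule sum.cong[OF refl], rule jump_integral_eq[OF w _ t]) auto
  show ?thesis
    unfolding 1 2 stay_integral_def
    by (rule weighted_indicator_decomposition[OF Z_path[OF w] H_path[OF w] t])
qed

lemma p_bar_decomposition:
  assumes t: "0 \<le> t"
  shows "p j t - p j 0 = expected_stay M Z H j t + (\<Sum>k\<in>UNIV - {j}. expected_jump M Z H k j t) -
    (\<Sum>k\<in>UNIV - {j}. expected_jump M Z H j k t)"
proof -
  have int1: "integrable M (\<lambda>\<omega>. \<Sum>k\<in>UNIV - {j}. jump_integral Z H k j t \<omega>)"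
    by (intro Bochner_Integration.integrable_sum jump_int t) auto
  have int2: "integrable M (\<lambda>\<omega>. \<Sum>k\<in>UNIV - {j}. jump_integral Z H j k t \<omega>)"
    by (intro Bochner_Integration.integrable_sum jump_int t) auto
  have sum1: "(\<integral>\<omega>. (\<Sum>k\<in>UNIV - {j}. jump_integral Z H k j t \<omega>) \<partial>M) = (\<Sum>k\<in>UNIV - {j}. expected_jump M Z H k j t)"
    unfolding expected_jump_def by (intro Bochner_Integration.integral_sum jump_int t) auto
  have sum2: "(\<integral>\<omega>. (\<Sum>k\<in>UNIV - {j}. jump_integral Z H j k t \<omega>) \<partial>M) = (\<Sum>k\<in>UNIV - {j}. expected_jump M Z H j k t)"
    unfolding expected_jump_def by (intro Bochner_Integration.integral_sum jump_int t) auto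
  have "p j t - p j 0 = (\<integral>\<omega>. H t \<omega> * of_bool (Z t \<omega> = j) - H 0 \<omega> * of_bool (Z 0 \<omega> = j) \<partial>M)"
    unfolding p_bar_def
    by (rule Bochner_Integration.integral_diff[symmetric]; rule integrable_weighted_state) (use t in simp_all)
  also have "\<dots> = (\<integral>\<omega>. stay_integral Z H j t \<omega> + (\<Sum>k\<in>UNIV - {j}. jump_integral Z H k j t \<omega>) -
      (\<Sum>k\<in>UNIV - {j}. jump_integral Z H j k t \<omega>) \<partial>M)"
    by (rule Bochner_Integration.integral_cong[OF refl], rule weighted_state_decomposition[OF _ t])
  also have "\<dots> = (\<integral>\<omega>. stay_integral Z H j t \<omega> + (\<Sum>k\<in>UNIV - {j}. jump_integral Z H k j t \<omega>) \<partial>M) -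
      (\<integral>\<omega>. (\<Sum>k\<in>UNIV - {j}. jump_integral Z H j k t \<omega>) \<partial>M)"
    by (rule Bochner_Integration.integral_diff[OF Bochner_Integration.integrable_add[OF stay_int[OF t] int1] int2])
  also have "(\<integral>\<omega>. stay_integral Z H j t \<omega> + (\<Sum>k\<in>UNIV - {j}. jump_integral Z H k j t \<omega>) \<partial>M) =
      expected_stay M Z H j t + (\<Sum>k\<in>UNIV - {j}. expected_jump M Z H k j t)"
    unfolding Bochner_Integration.integral_add[OF stay_int[OF t] int1] sum1 expected_stay_def ..
  finally show ?thesis
    unfolding sum2 .
qed

lemma p_bar_0: "p j 0 = of_bool (j = z0) * (\<integral>\<omega>. H 0 \<omega> \<partial>M)"
proof -
  have "p j 0 = (\<integral>\<omega>. of_bool (j = z0) * H 0 \<omega> \<partial>M)"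
    unfolding p_bar_def by (rule Bochner_Integration.integral_cong) (auto simp: Z_init)
  then show ?thesis by simp
qed

lemma rcfv_expected_stay: "rcfv (expected_stay M Z H j)"
  using H_bar_wf by (simp add: ls_quotient_wf_def)

lemma rcfv_expected_jump: "j \<noteq> k \<Longrightarrow> rcfv (expected_jump M Z H j k)"
  using Lambda_bar_wf by (simp add: ls_quotient_wf_def)

lemma rcfv_H_bar: "rcfv (H_bar M Z H j)"
  using H_bar_wf by (simp add: ls_quotient_wf_def H_bar_def)

lemma rcfv_transition_bar: "j \<noteq> k \<Longrightarrow> rcfv (transition_bar M Z H j k)"
  using Lambda_bar_wf by (simp add: ls_quotient_wf_def transition_bar_def)

lemma ls_integral_H_bar:
  assumes "0 \<le> t"
  shows "ls_integral (left_lim (p j)) (H_bar M Z H j) 0 t = expected_stay M Z H j t"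
proof -
  have "expected_stay M Z H j 0 = 0"
    by (simp add: expected_stay_def stay_integral_def)
  then show ?thesis
    using H_bar_wf[of j] assms by (simp add: ls_quotient_wf_def H_bar_def)
qed

lemma ls_integral_transition_bar:
  assumes "j \<noteq> k" "0 \<le> t"
  shows "ls_integral (left_lim (p j)) (transition_bar M Z H j k) 0 t = expected_jump M Z H j k t"
proof -
  have "expected_jump M Z H j k 0 = 0"
    by (simp add: expected_jump_def jump_integral_def)
  then show ?thesis
    using Lambda_bar_wf[OF assms(1)] assms(2) by (simp add: ls_quotient_wf_def transition_bar_def)
qed

lemma rcfv_p_bar: "rcfv (p j)"
proof (rule rcfv_cong)
  show "rcfv (\<lambda>t. (p j 0 + (expected_stay M Z H j t + (\<Sum>k\<in>UNIV - {j}. expected_jump M Z H k j t))) -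
    (\<Sum>k\<in>UNIV - {j}. expected_jump M Z H j k t))"
    by (intro rcfv_diff rcfv_add rcfv_sum rcfv_const rcfv_expected_stay rcfv_expected_jump) auto
  show "p j t = (p j 0 + (expected_stay M Z H j t + (\<Sum>k\<in>UNIV - {j}. expected_jump M Z H k j t))) -
    (\<Sum>k\<in>UNIV - {j}. expected_jump M Z H j k t)" if "0 \<le> t" for t
    using p_bar_decomposition[OF that, of j] by linarith
qed

lemma bounded_borel_left_p: "bounded_borel T (left_lim (p j))"
  by (rule bounded_borel_left_lim[OF rcfv_p_bar])

section \<open>The forward equation\<close>

lemma Lambda_bar_off_diagonal: "j \<noteq> k \<Longrightarrow> (\<lambda>t. Lambda_bar M Z H t $ j $ k) = transition_bar M Z H j k"
  by (auto simp: Lambda_bar_def fun_eq_iff)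

lemma Lambda_bar_diagonal:
  "(\<lambda>t. Lambda_bar M Z H t $ j $ j) = (\<lambda>t. 1 * H_bar M Z H j t + (-1) * (\<Sum>l\<in>UNIV - {j}. transition_bar M Z H j l t))"
  by (simp add: Lambda_bar_def)

lemma rcfv_outgoing: "rcfv (\<lambda>t. \<Sum>l\<in>UNIV - {j}. transition_bar M Z H j l t)"
  by (rule rcfv_sum, rule rcfv_transition_bar) auto

lemma rcfv_Lambda_bar: "rcfv (\<lambda>t. Lambda_bar M Z H t $ j $ k)"
proof (cases "j = k")
  case True
  show ?thesis
    unfolding True[symmetric] Lambda_bar_diagonal by (rule rcfv_linear[OF rcfv_H_bar rcfv_outgoing])
next
  case False
  show ?thesis
    unfolding Lambda_bar_off_diagonal[OF False] by (rule rcfv_transition_bar[OF False])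
qed

lemma forward_equation:
  assumes t: "0 \<le> t"
  shows "p j t - p j 0 = (\<Sum>k\<in>UNIV. ls_integral (left_lim (p k)) (\<lambda>s. Lambda_bar M Z H s $ k $ j) 0 t)"
proof -
  have "ls_integral (left_lim (p j)) (\<lambda>s. Lambda_bar M Z H s $ j $ j) 0 t =
      1 * ls_integral (left_lim (p j)) (H_bar M Z H j) 0 t +
      (-1) * ls_integral (left_lim (p j)) (\<lambda>t. \<Sum>l\<in>UNIV - {j}. transition_bar M Z H j l t) 0 t"
    unfolding Lambda_bar_diagonal
    by (rule ls_integral_linear_integrator[OF rcfv_H_bar rcfv_outgoing t bounded_borel_left_p])
  also have "ls_integral (left_lim (p j)) (\<lambda>t. \<Sum>l\<in>UNIV - {j}. transition_bar M Z H j l t) 0 t =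
      (\<Sum>l\<in>UNIV - {j}. ls_integral (left_lim (p j)) (transition_bar M Z H j l) 0 t)"
    by (rule ls_integral_sum_integrator[OF rcfv_transition_bar t bounded_borel_left_p]) auto
  also have "\<dots> = (\<Sum>l\<in>UNIV - {j}. expected_jump M Z H j l t)"
    by (rule sum.cong[OF refl], rule ls_integral_transition_bar[OF _ t]) auto
  finally have diag: "ls_integral (left_lim (p j)) (\<lambda>s. Lambda_bar M Z H s $ j $ j) 0 t =
      expected_stay M Z H j t - (\<Sum>l\<in>UNIV - {j}. expected_jump M Z H j l t)"
    by (simp add: ls_integral_H_bar[OF t])
  have off: "(\<Sum>k\<in>UNIV - {j}. ls_integral (left_lim (p k)) (\<lambda>s. Lambda_bar M Z H s $ k $ j) 0 t) =
      (\<Sum>k\<in>UNIV - {j}. expected_jump M Z H k j t)"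
  proof (rule sum.cong[OF refl])
    fix k assume "k \<in> UNIV - {j}"
    then have kj: "k \<noteq> j" by simp
    show "ls_integral (left_lim (p k)) (\<lambda>s. Lambda_bar M Z H s $ k $ j) 0 t = expected_jump M Z H k j t"
      unfolding Lambda_bar_off_diagonal[OF kj] by (rule ls_integral_transition_bar[OF kj t])
  qed
  have "(\<Sum>k\<in>UNIV. ls_integral (left_lim (p k)) (\<lambda>s. Lambda_bar M Z H s $ k $ j) 0 t) =
      ls_integral (left_lim (p j)) (\<lambda>s. Lambda_bar M Z H s $ j $ j) 0 t +
      (\<Sum>k\<in>UNIV - {j}. ls_integral (left_lim (p k)) (\<lambda>s. Lambda_bar M Z H s $ k $ j) 0 t)"
    by (rule sum.remove) simp_all
  then show ?thesis
    unfolding diag off p_bar_decomposition[OF t] by simp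
qed

text \<open>
  The row vector \<open>p\<close> becomes a matrix solution of the equation by repeating it in every row.  At time
  \<open>0\<close> its only nonzero entry belongs to the initial state.
\<close>

lemma p_bar_product_integral:
  assumes t: "0 \<le> t"
  shows "p j t = (\<integral>\<omega>. H 0 \<omega> \<partial>M) * product_integral (Lambda_bar M Z H) 0 t $ z0 $ j"
proof -
  define W :: "real \<Rightarrow> real^'s^'s" where "W s = (\<chi> i j. p j s)" for s
  have W: "(\<lambda>s. W s $ i $ k) = p k" for i k
    by (simp add: W_def)
  have "W t = W 0 ** product_integral (Lambda_bar M Z H) 0 t"
  proof (rule linear_equation_product_integral[OF rcfv_Lambda_bar t])
    show "rcfv (\<lambda>t. W t $ i $ k)" for i k
      unfolding W by (rule rcfv_p_bar)
    show "W t $ i $ j - W 0 $ i $ j =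
        (\<Sum>k\<in>UNIV. ls_integral (left_lim (\<lambda>s. W s $ i $ k)) (\<lambda>s. Lambda_bar M Z H s $ k $ j) 0 t)"
      if "0 \<le> t" for i j t
      unfolding W using forward_equation[OF that, of j] by (simp add: W_def)
  qed
  then have "W t $ z0 $ j = (W 0 ** product_integral (Lambda_bar M Z H) 0 t) $ z0 $ j"
    by (rule arg_cong)
  also have "\<dots> = (\<Sum>k\<in>UNIV. p k 0 * product_integral (Lambda_bar M Z H) 0 t $ k $ j)"
    by (simp add: matrix_matrix_mult_def W_def)
  also have "\<dots> = (\<Sum>k\<in>UNIV. if k = z0 then (\<integral>\<omega>. H 0 \<omega> \<partial>M) * product_integral (Lambda_bar M Z H) 0 t $ k $ j else 0)"
    by (rule sum.cong) (auto simp: p_bar_0)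
  also have "\<dots> = (\<integral>\<omega>. H 0 \<omega> \<partial>M) * product_integral (Lambda_bar M Z H) 0 t $ z0 $ j"
    by simp
  finally show ?thesis
    by (simp add: W_def)
qed

section \<open>Expected payments\<close>

lemma abs_jump_integral_le:
  assumes w: "\<omega> \<in> space M" and jk: "j \<noteq> k" and t: "0 \<le> t" "t \<le> T" and C: "0 \<le> C" "\<forall>t\<in>{0..T}. \<forall>\<omega>\<in>space M. \<bar>H t \<omega>\<bar> \<le> C"
  shows "\<bar>jump_integral Z H j k t \<omega>\<bar> \<le> C * jump_count Z j k T \<omega>"
proof -
  have "\<bar>jump_integral Z H j k t \<omega>\<bar> \<le> C * jump_count Z j k t \<omega>"
    unfolding jump_integral_eq[OF w jk t(1)] using C w t by (intro abs_sum_jumps_le) simp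
  also have "jump_count Z j k t \<omega> \<le> jump_count Z j k T \<omega>"
    unfolding jump_count_eq_card of_nat_le_iff
    by (rule card_mono[OF finite_jump_times[OF Z_path[OF w] jk]]) (use t in auto)
  then have "C * jump_count Z j k t \<omega> \<le> C * jump_count Z j k T \<omega>"
    using C(1) by (rule mult_left_mono)
  finally show ?thesis .
qed

text \<open>
  The variation of \<open>H\<close> need not be integrable; the integrals of the occupation indicators against
  \<open>H\<close> are nevertheless dominated, because they differ from bounded terms by sums over jumps only.
\<close>

lemma stay_integral_dominated:
  assumes T: "0 \<le> T"
  obtains w where "integrable M w" "\<forall>t\<in>{0..T}. \<forall>\<omega>\<in>space M. \<bar>stay_integral Z H j t \<omega>\<bar> \<le> w \<omega>"
proof -
  obtain C where C: "0 \<le> C" "\<forall>t\<in>{0..T}. \<forall>\<omega>\<in>space M. \<bar>H t \<omega>\<bar> \<le> C"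
    by (rule H_bound[OF T])
  define w where "w \<omega> = 2 * C + (\<Sum>k\<in>UNIV - {j}. C * jump_count Z k j T \<omega>) + (\<Sum>k\<in>UNIV - {j}. C * jump_count Z j k T \<omega>)" for \<omega>
  have "integrable M w"
    unfolding w_def[abs_def]
    by (intro Bochner_Integration.integrable_add Bochner_Integration.integrable_sum integrable_mult_right N_int T integrable_const) auto
  moreover have "\<bar>stay_integral Z H j t \<omega>\<bar> \<le> w \<omega>" if t: "t \<in> {0..T}" and w: "\<omega> \<in> space M" for t \<omega>
  proof -
    have t': "0 \<le> t" "t \<le> T" using t by auto
    have "\<bar>H t \<omega> * of_bool (Z t \<omega> = j)\<bar> \<le> C" "\<bar>H 0 \<omega> * of_bool (Z 0 \<omega> = j)\<bar> \<le> C"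
      using C t w T by (simp_all add: of_bool_def)
    moreover have "\<bar>\<Sum>k\<in>UNIV - {j}. jump_integral Z H k j t \<omega>\<bar> \<le> (\<Sum>k\<in>UNIV - {j}. C * jump_count Z k j T \<omega>)"
      by (rule order_trans[OF sum_abs sum_mono], rule abs_jump_integral_le[OF w _ t' C]) auto
    moreover have "\<bar>\<Sum>k\<in>UNIV - {j}. jump_integral Z H j k t \<omega>\<bar> \<le> (\<Sum>k\<in>UNIV - {j}. C * jump_count Z j k T \<omega>)"
      by (rule order_trans[OF sum_abs sum_mono], rule abs_jump_integral_le[OF w _ t' C]) auto
    ultimately show ?thesis
      using weighted_state_decomposition[OF w t'(1), of j] unfolding w_def by linarith
  qed
  ultimately show ?thesis
    by (intro that) auto
qed

lemma occupied_H_measurable: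
  "(\<lambda>(s, \<omega>). indicator {0<..T} s * (occupied j s \<omega> * H s \<omega>)) \<in> borel_measurable (borel \<Otimes>\<^sub>M M)"
proof -
  have 1: "(\<lambda>(s, \<omega>). indicator {0<..T} s * occupied j s \<omega>) \<in> borel_measurable (borel \<Otimes>\<^sub>M M)"
  proof (rule jointly_measurable_left_limits[where X = "\<lambda>t \<omega>. of_bool (Z t \<omega> = j)"])
    show "(\<lambda>\<omega>. of_bool (Z t \<omega> = j)) \<in> borel_measurable M" if "0 \<le> t" for t
      by (rule measurable_compose[OF Z_rv[OF that]]) simp
    show "((\<lambda>t. of_bool (Z t \<omega> = j)) \<longlongrightarrow> occupied j s \<omega>) (at_left s)" if "0 < s" "\<omega> \<in> space M" for s \<omega>
      by (rule tendsto_left_state[OF Z_path[OF that(2)] that(1)])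
  qed
  have 2: "(\<lambda>(s, \<omega>). indicator {0<..T} s * H s \<omega>) \<in> borel_measurable (borel \<Otimes>\<^sub>M M)"
    by (rule jointly_measurable_right_limits[where X = H]) (auto intro: H_rv rcfv_tendsto_right H_path)
  have "(\<lambda>x. (case x of (s, \<omega>) \<Rightarrow> indicator {0<..T} s * occupied j s \<omega>) * (case x of (s, \<omega>) \<Rightarrow> indicator {0<..T} s * H s \<omega>)) \<in> borel_measurable (borel \<Otimes>\<^sub>M M)"
    by (rule borel_measurable_times[OF 1 2])
  also have "(\<lambda>x. (case x of (s, \<omega>) \<Rightarrow> indicator {0<..T} s * occupied j s \<omega>) * (case x of (s, \<omega>) \<Rightarrow> indicator {0<..T} s * H s \<omega>)) =
      (\<lambda>(s, \<omega>). indicator {0<..T} s * (occupied j s \<omega> * H s \<omega>))"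
    by (auto simp: fun_eq_iff indicator_def)
  finally show ?thesis .
qed

lemma occupied_H_bounded:
  assumes "0 \<le> T"
  obtains C where "\<And>s \<omega>. s \<in> {0<..T} \<Longrightarrow> \<omega> \<in> space M \<Longrightarrow> \<bar>occupied j s \<omega> * H s \<omega>\<bar> \<le> C"
proof -
  obtain C where "0 \<le> C" "\<forall>t\<in>{0..T}. \<forall>\<omega>\<in>space M. \<bar>H t \<omega>\<bar> \<le> C"
    by (rule H_bound[OF assms])
  then show ?thesis
    by (intro that[of C]) (auto simp: of_bool_def)
qed

text \<open>
  Pathwise, \<open>1{Z(s-) = j} H(s)\<close> is the left limit of \<open>1{Z(r) = j} H(r)\<close> plus the jump at \<open>s\<close> of the
  integral of the occupation indicator against \<open>H\<close>.  Taking expectations turns the first term into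
  the left limit of the weighted occupation probability and the second one into its multiple by the
  jump of \<open>H_bar\<close>.
\<close>

lemma integral_occupied_H:
  assumes s: "0 < s"
  shows "(\<integral>\<omega>. occupied j s \<omega> * H s \<omega> \<partial>M) =
    left_lim (p j) s * (1 + (H_bar M Z H j s - left_lim (H_bar M Z H j) s))"
proof -
  define r where "r n = grid (-1) n s" for n
  have r: "0 \<le> r n" "r n < s" for n
    unfolding r_def by (rule grid_nonneg[OF s], rule grid_less)
  have r_lim: "filterlim r (at_left s) sequentially"
    unfolding r_def[abs_def] by (rule filterlim_grid_left)
  then have r_tendsto: "r \<longlonglongrightarrow> s"
    by (simp add: filterlim_at)
  define Y where "Y n \<omega> = H (r n) \<omega> * of_bool (Z (r n) \<omega> = j) + (stay_integral Z H j s \<omega> - stay_integral Z H j (r n) \<omega>)" for n \<omega>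
  obtain C where C: "0 \<le> C" "\<forall>t\<in>{0..s}. \<forall>\<omega>\<in>space M. \<bar>H t \<omega>\<bar> \<le> C"
    by (rule H_bound[OF less_imp_le[OF s]])
  obtain w where w: "integrable M w" "\<forall>t\<in>{0..s}. \<forall>\<omega>\<in>space M. \<bar>stay_integral Z H j t \<omega>\<bar> \<le> w \<omega>"
    by (rule stay_integral_dominated[OF less_imp_le[OF s]])
  have Y_int: "integrable M (Y n)" for n
    unfolding Y_def[abs_def] using r[of n] s
    by (intro Bochner_Integration.integrable_add Bochner_Integration.integrable_diff integrable_weighted_state stay_int) auto
  have Y_lim: "(\<lambda>n. Y n \<omega>) \<longlonglongrightarrow> occupied j s \<omega> * H s \<omega>" if om: "\<omega> \<in> space M" for \<omega>
  proof -
    have "(\<lambda>n. H (r n) \<omega> * of_bool (Z (r n) \<omega> = j)) \<longlonglongrightarrow> left_lim (\<lambda>t. H t \<omega>) s * occupied j s \<omega>"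
      by (rule filterlim_compose[OF _ r_lim], rule tendsto_mult[OF tendsto_left_lim[OF H_path[OF om] s] tendsto_left_state[OF Z_path[OF om] s]])
    moreover have "(\<lambda>n. stay_integral Z H j s \<omega> - stay_integral Z H j (r n) \<omega>) \<longlonglongrightarrow>
        occupied j s \<omega> * (H s \<omega> - left_lim (\<lambda>t. H t \<omega>) s)"
      unfolding stay_integral_def
      by (rule ls_integral_jump[OF H_path[OF om] s bounded_borel_left_state[OF Z_path[OF om]] r r_tendsto])
    ultimately have "(\<lambda>n. Y n \<omega>) \<longlonglongrightarrow> left_lim (\<lambda>t. H t \<omega>) s * occupied j s \<omega> + occupied j s \<omega> * (H s \<omega> - left_lim (\<lambda>t. H t \<omega>) s)"
      unfolding Y_def by (rule tendsto_add)
    then show ?thesis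
      by (simp add: algebra_simps)
  qed
  have "(\<lambda>n. \<integral>\<omega>. Y n \<omega> \<partial>M) \<longlonglongrightarrow> (\<integral>\<omega>. occupied j s \<omega> * H s \<omega> \<partial>M)"
  proof (rule integral_dominated_convergence)
    show "(\<lambda>\<omega>. occupied j s \<omega> * H s \<omega>) \<in> borel_measurable M"
      by (rule borel_measurable_LIMSEQ_real[OF Y_lim]) (use Y_int in auto)
    show "integrable M (\<lambda>\<omega>. C + (w \<omega> + w \<omega>))"
      using w(1) by (intro Bochner_Integration.integrable_add integrable_const)
    show "AE \<omega> in M. (\<lambda>n. Y n \<omega>) \<longlonglongrightarrow> occupied j s \<omega> * H s \<omega>"
      using Y_lim by (rule AE_I2)
    show "AE \<omega> in M. norm (Y n \<omega>) \<le> C + (w \<omega> + w \<omega>)" for n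
    proof (rule AE_I2)
      fix \<omega> assume om: "\<omega> \<in> space M"
      have "\<bar>H (r n) \<omega> * of_bool (Z (r n) \<omega> = j)\<bar> \<le> C"
        using C om r[of n] by (simp add: of_bool_def)
      moreover have "\<bar>stay_integral Z H j s \<omega>\<bar> \<le> w \<omega>" "\<bar>stay_integral Z H j (r n) \<omega>\<bar> \<le> w \<omega>"
        using w(2) om r[of n] s by simp_all
      ultimately show "norm (Y n \<omega>) \<le> C + (w \<omega> + w \<omega>)"
        unfolding Y_def real_norm_def by linarith
    qed
  qed (use Y_int in auto)
  moreover have "(\<integral>\<omega>. Y n \<omega> \<partial>M) = p j (r n) + (expected_stay M Z H j s - expected_stay M Z H j (r n))" for n
  proof -
    have st: "integrable M (stay_integral Z H j s)" "integrable M (stay_integral Z H j (r n))"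
      using stay_int r[of n] s by auto
    have "(\<integral>\<omega>. Y n \<omega> \<partial>M) = (\<integral>\<omega>. H (r n) \<omega> * of_bool (Z (r n) \<omega> = j) \<partial>M) +
        (\<integral>\<omega>. stay_integral Z H j s \<omega> - stay_integral Z H j (r n) \<omega> \<partial>M)"
      unfolding Y_def
      by (rule Bochner_Integration.integral_add[OF integrable_weighted_state[OF r(1)] Bochner_Integration.integrable_diff[OF st]])
    also have "(\<integral>\<omega>. stay_integral Z H j s \<omega> - stay_integral Z H j (r n) \<omega> \<partial>M) = expected_stay M Z H j s - expected_stay M Z H j (r n)"
      unfolding expected_stay_def by (rule Bochner_Integration.integral_diff[OF st])
    finally show ?thesis
      by (simp only: p_bar_def)
  qed
  moreover have "(\<lambda>n. p j (r n) + (expected_stay M Z H j s - expected_stay M Z H j (r n))) \<longlonglongrightarrow>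
      left_lim (p j) s + left_lim (p j) s * (H_bar M Z H j s - left_lim (H_bar M Z H j) s)"
  proof (rule tendsto_add)
    show "(\<lambda>n. p j (r n)) \<longlonglongrightarrow> left_lim (p j) s"
      by (rule filterlim_compose[OF tendsto_left_lim[OF rcfv_p_bar s] r_lim])
    show "(\<lambda>n. expected_stay M Z H j s - expected_stay M Z H j (r n)) \<longlonglongrightarrow> left_lim (p j) s * (H_bar M Z H j s - left_lim (H_bar M Z H j) s)"
      using ls_integral_jump[OF rcfv_H_bar s bounded_borel_left_p r r_tendsto, of j j]
      unfolding ls_integral_H_bar[OF less_imp_le[OF s]] ls_integral_H_bar[OF r(1)] .
  qed
  ultimately have "(\<integral>\<omega>. occupied j s \<omega> * H s \<omega> \<partial>M) =
      left_lim (p j) s + left_lim (p j) s * (H_bar M Z H j s - left_lim (H_bar M Z H j) s)"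
    using LIMSEQ_unique by simp
  then show ?thesis
    by (simp add: distrib_left)
qed

text \<open>
  For the indicator of \<open>(0,u]\<close> the sum is the integral of \<open>H\<close> against the jump count, which is
  integrable by assumption; the general case is a monotone class argument.
\<close>

lemma measurable_sum_jumps:
  assumes jk: "j \<noteq> k" and t: "0 \<le> t" and g: "bounded_borel t g"
  shows "(\<lambda>\<omega>. \<Sum>s\<in>jumps \<omega> j k \<inter> {0<..t}. g s * H s \<omega>) \<in> borel_measurable M"
  using g t
proof (induction rule: bounded_borel_induct)
  case (interval u)
  have "(\<Sum>s\<in>jumps \<omega> j k \<inter> {0<..t}. indicator {0<..u} s * H s \<omega>) = jump_integral Z H j k u \<omega>" if w: "\<omega> \<in> space M" for \<omega>
  proof -
    have "(\<Sum>s\<in>jumps \<omega> j k \<inter> {0<..t}. indicator {0<..u} s * H s \<omega>) = (\<Sum>s\<in>jumps \<omega> j k \<inter> {0<..u}. H s \<omega>)"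
      using finite_jump_times[OF Z_path[OF w] jk] interval
      by (intro sum.mono_neutral_cong_right) (auto simp: indicator_def)
    then show ?thesis
      by (simp only: jump_integral_eq[OF w jk interval(1)])
  qed
  then have "(\<lambda>\<omega>. \<Sum>s\<in>jumps \<omega> j k \<inter> {0<..t}. indicator {0<..u} s * H s \<omega>) \<in> borel_measurable M \<longleftrightarrow>
      jump_integral Z H j k u \<in> borel_measurable M"
    by (rule measurable_cong)
  then show ?case
    using borel_measurable_integrable[OF jump_int[OF jk interval(1)]] by simp
next
  case (add g h)
  then show ?case
    by (simp only: distrib_right sum.distrib borel_measurable_add)
next
  case (scale g c)
  have "(\<lambda>\<omega>. c * (\<Sum>s\<in>jumps \<omega> j k \<inter> {0<..t}. g s * H s \<omega>)) \<in> borel_measurable M"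
    using scale(2) by (rule borel_measurable_times[OF borel_measurable_const])
  then show ?case
    by (simp only: sum_distrib_left mult.assoc)
next
  case (limit U u C)
  show ?case
  proof (rule borel_measurable_LIMSEQ_real)
    show "(\<lambda>n. \<Sum>s\<in>jumps \<omega> j k \<inter> {0<..t}. U n s * H s \<omega>) \<longlonglongrightarrow> (\<Sum>s\<in>jumps \<omega> j k \<inter> {0<..t}. u s * H s \<omega>)" for \<omega>
      by (rule tendsto_sum, rule tendsto_mult[OF limit(3) tendsto_const]) simp
  qed (rule limit(4))
qed

lemma
  assumes jk: "j \<noteq> k" and t: "0 \<le> t" and g: "bounded_borel t g"
  shows integrable_sum_jumps: "integrable M (\<lambda>\<omega>. \<Sum>s\<in>jumps \<omega> j k \<inter> {0<..t}. g s * H s \<omega>)"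
    and integral_sum_jumps: "(\<integral>\<omega>. (\<Sum>s\<in>jumps \<omega> j k \<inter> {0<..t}. g s * H s \<omega>) \<partial>M) =
      ls_integral (\<lambda>s. g s * left_lim (p j) s) (transition_bar M Z H j k) 0 t"
proof -
  let ?S = "\<lambda>g \<omega>. \<Sum>s\<in>jumps \<omega> j k \<inter> {0<..t}. g s * H s \<omega>"
  define \<Phi> where "\<Phi> g = (\<integral>\<omega>. (?S g \<omega>) \<partial>M)" for g
  obtain C where C: "0 \<le> C" "\<forall>t\<in>{0..t}. \<forall>\<omega>\<in>space M. \<bar>H t \<omega>\<bar> \<le> C"
    by (rule H_bound[OF t])
  have dom: "\<bar>?S g \<omega>\<bar> \<le> \<bar>D\<bar> * C * jump_count Z j k t \<omega>"
    if D: "\<And>s. s \<in> {0<..t} \<Longrightarrow> \<bar>g s\<bar> \<le> D" and w: "\<omega> \<in> space M" for g D \<omega>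
  proof (rule abs_sum_jumps_le)
    fix s assume s: "s \<in> {0<..t}"
    have "\<bar>g s\<bar> \<le> \<bar>D\<bar>" using D[OF s] by simp
    moreover have "\<bar>H s \<omega>\<bar> \<le> C" using C(2) s w by simp
    ultimately show "\<bar>g s * H s \<omega>\<bar> \<le> \<bar>D\<bar> * C"
      unfolding abs_mult by (intro mult_mono) simp_all
  qed
  have N: "integrable M (\<lambda>\<omega>. c * jump_count Z j k t \<omega>)" for c
    by (intro integrable_mult_right N_int jk t)
  have int: "integrable M (?S g)" if g: "bounded_borel t g" for g
  proof -
    obtain D where D: "0 \<le> D" "\<forall>s\<in>{0<..t}. \<bar>g s\<bar> \<le> D"
      using g by (rule bounded_borel_bound)
    show ?thesis
    proof (rule Bochner_Integration.integrable_bound[OF N[of "\<bar>D\<bar> * C"] measurable_sum_jumps[OF jk t g]], rule AE_I2)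
      fix \<omega> assume "\<omega> \<in> space M"
      then show "norm (?S g \<omega>) \<le> norm (\<bar>D\<bar> * C * jump_count Z j k t \<omega>)"
        unfolding real_norm_def using dom[of g D \<omega>] D(2) by force
    qed
  qed
  show "integrable M (?S g)"
    using g by (rule int)
  have functional: "bounded_convergence_functional t \<Phi>"
  proof (rule bounded_convergence_functionalI)
    fix g h :: "real \<Rightarrow> real" assume "bounded_borel t g" "bounded_borel t h"
    then show "\<Phi> (\<lambda>s. g s + h s) = \<Phi> g + \<Phi> h"
      unfolding \<Phi>_def distrib_right sum.distrib by (intro Bochner_Integration.integral_add int)
  next
    fix g :: "real \<Rightarrow> real" and c assume "bounded_borel t g"
    show "\<Phi> (\<lambda>s. c * g s) = c * \<Phi> g"
      unfolding \<Phi>_def mult.assoc sum_distrib_left[symmetric] by (rule integral_mult_right_zero)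
  next
    fix U u D
    assume U: "\<And>n. bounded_borel t (U n)" "\<And>n s. s \<in> {0<..t} \<Longrightarrow> \<bar>U n s\<bar> \<le> D"
      "\<And>s. s \<in> {0<..t} \<Longrightarrow> (\<lambda>n. U n s) \<longlonglongrightarrow> u s" and u: "bounded_borel t u"
    show "(\<lambda>n. \<Phi> (U n)) \<longlonglongrightarrow> \<Phi> u"
      unfolding \<Phi>_def
    proof (rule integral_dominated_convergence)
      show "AE \<omega> in M. (\<lambda>n. ?S (U n) \<omega>) \<longlonglongrightarrow> (?S u \<omega>)"
        by (rule AE_I2, rule tendsto_sum, rule tendsto_mult[OF U(3) tendsto_const]) simp
      show "AE \<omega> in M. norm (?S (U n) \<omega>) \<le> \<bar>D\<bar> * C * jump_count Z j k t \<omega>" for n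
        unfolding real_norm_def by (rule AE_I2, rule dom[OF U(2)])
    qed (use measurable_sum_jumps[OF jk t] U(1) u N in auto)
  qed
  have "ls_integral g (expected_jump M Z H j k) 0 t = \<Phi> g"
  proof (rule ls_integral_eqI[OF rcfv_expected_jump[OF jk] t functional _ g])
    fix u assume u: "0 \<le> u" "u \<le> t"
    have "\<Phi> (indicator {0<..u}) = expected_jump M Z H j k u"
      unfolding \<Phi>_def expected_jump_def
    proof (rule Bochner_Integration.integral_cong[OF refl])
      fix \<omega> assume w: "\<omega> \<in> space M"
      have "(\<Sum>s\<in>jumps \<omega> j k \<inter> {0<..t}. indicator {0<..u} s * H s \<omega>) = (\<Sum>s\<in>jumps \<omega> j k \<inter> {0<..u}. H s \<omega>)"
        using finite_jump_times[OF Z_path[OF w] jk] u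
        by (intro sum.mono_neutral_cong_right) (auto simp: indicator_def)
      then show "(\<Sum>s\<in>jumps \<omega> j k \<inter> {0<..t}. indicator {0<..u} s * H s \<omega>) = jump_integral Z H j k u \<omega>"
        by (simp only: jump_integral_eq[OF w jk u(1)])
    qed
    moreover have "expected_jump M Z H j k 0 = 0"
      by (simp add: expected_jump_def jump_integral_def)
    ultimately show "\<Phi> (indicator {0<..u}) = expected_jump M Z H j k u - expected_jump M Z H j k 0"
      by simp
  qed
  moreover have "ls_integral g (expected_jump M Z H j k) 0 t = ls_integral (\<lambda>s. g s * left_lim (p j) s) (transition_bar M Z H j k) 0 t"
  proof (rule ls_integral_density[OF rcfv_transition_bar[OF jk] rcfv_expected_jump[OF jk] t bounded_borel_left_p g])
    fix u :: real assume "0 \<le> u"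
    then show "expected_jump M Z H j k u - expected_jump M Z H j k 0 = ls_integral (left_lim (p j)) (transition_bar M Z H j k) 0 u"
      using ls_integral_transition_bar[OF jk, of u] ls_integral_transition_bar[OF jk, of 0] by simp
  qed
  ultimately show "(\<integral>\<omega>. (?S g \<omega>) \<partial>M) =
      ls_integral (\<lambda>s. g s * left_lim (p j) s) (transition_bar M Z H j k) 0 t"
    by (simp only: \<Phi>_def)
qed

abbreviation "q j s \<equiv> left_lim (p j) s * (1 + (H_bar M Z H j s - left_lim (H_bar M Z H j) s))"

lemma bounded_borel_q: "bounded_borel T (q j)"
  by (intro bounded_borel_mult bounded_borel_add bounded_borel_diff bounded_borel_const
      bounded_borel_left_lim bounded_borel_rcfv rcfv_H_bar bounded_borel_left_p)

context
  fixes B :: "'s \<Rightarrow> real \<Rightarrow> real" and b :: "'s \<Rightarrow> 's \<Rightarrow> real \<Rightarrow> real" and b0 :: real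
  assumes B: "\<And>j. rcfv (B j)"
    and b: "\<And>j k T. j \<noteq> k \<Longrightarrow> 0 \<le> T \<Longrightarrow> bounded_borel T (b j k)"
begin

abbreviation "sojourn_payments j t \<omega> \<equiv> ls_integral (\<lambda>s. occupied j s \<omega> * H s \<omega>) (B j) 0 t"
abbreviation "jump_payments j k t \<omega> \<equiv> \<Sum>s\<in>jumps \<omega> j k \<inter> {0<..t}. b j k s * H s \<omega>"
abbreviation "expected_jump_payments j k s t \<equiv>
  ls_integral (\<lambda>u. left_lim (p j) u * b j k u) (\<lambda>u. Lambda_bar M Z H u $ j $ k) s t"

text \<open>
  The undiscounted payments are a sum of integrals; integrating \<open>H\<close> against them amounts to
  multiplying each integrand by \<open>H\<close>.
\<close>

lemma payments_eq:
  assumes w: "\<omega> \<in> space M" and t: "0 \<le> t"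
  shows "payments Z H b0 B b t \<omega> = b0 +
    (\<Sum>j\<in>UNIV. sojourn_payments j t \<omega>) +
    (\<Sum>j\<in>UNIV. \<Sum>k\<in>UNIV - {j}. jump_payments j k t \<omega>)"
proof -
  let ?u = "\<lambda>s. undiscounted_payments Z b0 B b s \<omega>"
  let ?N = "\<lambda>j k s. jump_count Z j k s \<omega>"
  define \<Phi> where "\<Phi> g = 1 * (\<Sum>j\<in>UNIV. ls_integral (\<lambda>s. g s * occupied j s \<omega>) (B j) 0 t) +
    1 * (\<Sum>j\<in>UNIV. \<Sum>k\<in>UNIV - {j}. ls_integral (\<lambda>s. g s * b j k s) (?N j k) 0 t)" for g
  have occ: "bounded_borel T (\<lambda>s. occupied j s \<omega>)" for T j
    by (rule bounded_borel_left_state[OF Z_path[OF w]])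
  have rcfv: "rcfv ?u"
    unfolding undiscounted_payments_def
    by (intro rcfv_add rcfv_const rcfv_sum rcfv_ls_integral B occ b rcfv_jump_count w) auto
  have functional: "bounded_convergence_functional t \<Phi>"
    unfolding \<Phi>_def[abs_def]
  proof (rule functional_linear; rule functional_sum)
    show "bounded_convergence_functional t (\<lambda>g. ls_integral (\<lambda>s. g s * occupied j s \<omega>) (B j) 0 t)" for j
      by (rule functional_density[OF ls_integral_functional[OF B order_refl order_refl] occ])
    show "bounded_convergence_functional t (\<lambda>g. \<Sum>k\<in>UNIV - {j}. ls_integral (\<lambda>s. g s * b j k s) (?N j k) 0 t)" for j
    proof (rule functional_sum)
      fix k assume "k \<in> UNIV - {j}"
      then have jk: "j \<noteq> k" by auto
      show "bounded_convergence_functional t (\<lambda>g. ls_integral (\<lambda>s. g s * b j k s) (?N j k) 0 t)"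
        by (rule functional_density[OF ls_integral_functional[OF rcfv_jump_count[OF w jk] order_refl order_refl] b[OF jk t]])
    qed
  qed
  have "payments Z H b0 B b t \<omega> = b0 + \<Phi> (\<lambda>s. H s \<omega>)"
    unfolding payments_def
  proof (subst ls_integral_eqI[OF rcfv t functional _ bounded_borel_rcfv[OF H_path[OF w]]])
    fix u :: real assume u: "0 \<le> u" "u \<le> t"
    show "\<Phi> (indicator {0<..u}) = ?u u - ?u 0"
      using u by (simp add: \<Phi>_def undiscounted_payments_def ls_integral_restrict)
  qed (rule refl)
  also have "\<Phi> (\<lambda>s. H s \<omega>) = (\<Sum>j\<in>UNIV. sojourn_payments j t \<omega>) +
    (\<Sum>j\<in>UNIV. \<Sum>k\<in>UNIV - {j}. ls_integral (\<lambda>s. b j k s * H s \<omega>) (?N j k) 0 t)"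
    by (simp add: \<Phi>_def mult.commute)
  also have "(\<Sum>j\<in>UNIV. \<Sum>k\<in>UNIV - {j}. ls_integral (\<lambda>s. b j k s * H s \<omega>) (?N j k) 0 t) =
    (\<Sum>j\<in>UNIV. \<Sum>k\<in>UNIV - {j}. jump_payments j k t \<omega>)"
  proof (rule sum.cong[OF refl], rule sum.cong[OF refl])
    fix j k :: 's assume "k \<in> UNIV - {j}"
    then have jk: "j \<noteq> k" by auto
    show "ls_integral (\<lambda>s. b j k s * H s \<omega>) (?N j k) 0 t = jump_payments j k t \<omega>"
      by (rule ls_integral_jump_count[OF w jk t bounded_borel_mult[OF b[OF jk t] bounded_borel_rcfv[OF H_path[OF w]]]])
  qed
  finally show ?thesis by simp
qed

lemma bounded_borel_left_p_b: "j \<noteq> k \<Longrightarrow> 0 \<le> T \<Longrightarrow> bounded_borel T (\<lambda>s. left_lim (p j) s * b j k s)"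
  by (intro bounded_borel_mult bounded_borel_left_p b)

lemma
  assumes t: "0 \<le> t"
  shows integrable_payments: "integrable M (payments Z H b0 B b t)"
    and expected_payments_eq: "expected_payments M Z H b0 B b t = b0 +
      (\<Sum>j\<in>UNIV. ls_integral (q j) (B j) 0 t +
        (\<Sum>k\<in>UNIV - {j}. expected_jump_payments j k 0 t))"
proof -
  have stay: "integrable M (\<lambda>\<omega>. sojourn_payments j t \<omega>)"
    "(\<integral>\<omega>. sojourn_payments j t \<omega> \<partial>M) = ls_integral (q j) (B j) 0 t" for j
  proof -
    obtain C where C: "\<And>s \<omega>. s \<in> {0<..t} \<Longrightarrow> \<omega> \<in> space M \<Longrightarrow> \<bar>occupied j s \<omega> * H s \<omega>\<bar> \<le> C"
      using occupied_H_bounded[OF t, of j] by blast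
    show "integrable M (\<lambda>\<omega>. sojourn_payments j t \<omega>)"
      by (rule integrable_ls_integral[OF B occupied_H_measurable C])
    have "(\<integral>\<omega>. sojourn_payments j t \<omega> \<partial>M) =
        ls_integral (\<lambda>s. \<integral>\<omega>. occupied j s \<omega> * H s \<omega> \<partial>M) (B j) 0 t"
      by (rule integral_ls_integral[OF B occupied_H_measurable C])
    also have "\<dots> = ls_integral (q j) (B j) 0 t"
      by (rule ls_integral_cong, rule integral_occupied_H) simp
    finally show "(\<integral>\<omega>. sojourn_payments j t \<omega> \<partial>M) = ls_integral (q j) (B j) 0 t" .
  qed
  have jump: "integrable M (\<lambda>\<omega>. jump_payments j k t \<omega>)"
    "(\<integral>\<omega>. jump_payments j k t \<omega> \<partial>M) =
      expected_jump_payments j k 0 t" if "k \<in> UNIV - {j}" for j k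
  proof -
    have jk: "j \<noteq> k" using that by auto
    show "integrable M (\<lambda>\<omega>. jump_payments j k t \<omega>)"
      by (rule integrable_sum_jumps[OF jk t b[OF jk t]])
    show "(\<integral>\<omega>. jump_payments j k t \<omega> \<partial>M) =
        expected_jump_payments j k 0 t"
      unfolding Lambda_bar_off_diagonal[OF jk] integral_sum_jumps[OF jk t b[OF jk t]]
      by (rule ls_integral_cong) (rule mult.commute)
  qed
  have S1: "integrable M (\<lambda>\<omega>. \<Sum>j\<in>UNIV. sojourn_payments j t \<omega>)"
    by (rule Bochner_Integration.integrable_sum) (rule stay(1))
  have S2: "integrable M (\<lambda>\<omega>. \<Sum>k\<in>UNIV - {j}. jump_payments j k t \<omega>)" for j
    by (rule Bochner_Integration.integrable_sum) (rule jump(1))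
  have S3: "integrable M (\<lambda>\<omega>. \<Sum>j\<in>UNIV. \<Sum>k\<in>UNIV - {j}. jump_payments j k t \<omega>)"
    by (rule Bochner_Integration.integrable_sum) (rule S2)
  have b0: "integrable M (\<lambda>\<omega>. b0)" by simp
  let ?P = "\<lambda>\<omega>. b0 + (\<Sum>j\<in>UNIV. sojourn_payments j t \<omega>) +
    (\<Sum>j\<in>UNIV. \<Sum>k\<in>UNIV - {j}. jump_payments j k t \<omega>)"
  note S12 = Bochner_Integration.integrable_add[OF b0 S1]
  have "integrable M ?P"
    by (rule Bochner_Integration.integrable_add[OF S12 S3])
  moreover have "integrable M (payments Z H b0 B b t) \<longleftrightarrow> integrable M ?P"
    by (rule Bochner_Integration.integrable_cong[OF refl], rule payments_eq[OF _ t])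
  ultimately show "integrable M (payments Z H b0 B b t)"
    by simp
  have "expected_payments M Z H b0 B b t = (\<integral>\<omega>. ?P \<omega> \<partial>M)"
    unfolding expected_payments_def
    by (rule Bochner_Integration.integral_cong[OF refl], rule payments_eq[OF _ t])
  also have "\<dots> = b0 + (\<Sum>j\<in>UNIV. ls_integral (q j) (B j) 0 t) +
    (\<Sum>j\<in>UNIV. \<Sum>k\<in>UNIV - {j}. expected_jump_payments j k 0 t)"
  proof -
    have 1: "(\<integral>\<omega>. (\<Sum>j\<in>UNIV. sojourn_payments j t \<omega>) \<partial>M) = (\<Sum>j\<in>UNIV. ls_integral (q j) (B j) 0 t)"
      by (subst Bochner_Integration.integral_sum[OF stay(1)]) (simp only: stay(2))
    have 2: "(\<integral>\<omega>. (\<Sum>k\<in>UNIV - {j}. jump_payments j k t \<omega>) \<partial>M) =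
        (\<Sum>k\<in>UNIV - {j}. expected_jump_payments j k 0 t)" for j
      by (subst Bochner_Integration.integral_sum[OF jump(1)], assumption) (rule sum.cong[OF refl jump(2)])
    have 3: "(\<integral>\<omega>. (\<Sum>j\<in>UNIV. \<Sum>k\<in>UNIV - {j}. jump_payments j k t \<omega>) \<partial>M) =
        (\<Sum>j\<in>UNIV. \<Sum>k\<in>UNIV - {j}. expected_jump_payments j k 0 t)"
      by (subst Bochner_Integration.integral_sum[OF S2]) (simp only: 2)
    show ?thesis
      unfolding Bochner_Integration.integral_add[OF S12 S3] Bochner_Integration.integral_add[OF b0 S1] 1 3
      by (simp add: prob_space)
  qed
  finally show "expected_payments M Z H b0 B b t = b0 +
      (\<Sum>j\<in>UNIV. ls_integral (q j) (B j) 0 t +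
        (\<Sum>k\<in>UNIV - {j}. expected_jump_payments j k 0 t))"
    by (simp add: sum.distrib)
qed

lemma rcfv_expected_payments: "rcfv (expected_payments M Z H b0 B b)"
proof (rule rcfv_cong[OF _ expected_payments_eq])
  show "rcfv (\<lambda>t. b0 + (\<Sum>j\<in>UNIV. ls_integral (q j) (B j) 0 t +
        (\<Sum>k\<in>UNIV - {j}. expected_jump_payments j k 0 t)))"
    by (intro rcfv_add rcfv_const rcfv_sum rcfv_ls_integral B rcfv_Lambda_bar bounded_borel_q bounded_borel_left_p_b) auto
qed

lemma expected_payments_increment:
  assumes st: "0 \<le> s" "s \<le> t"
  shows "expected_payments M Z H b0 B b t - expected_payments M Z H b0 B b s =
    (\<Sum>j\<in>UNIV. ls_integral (q j) (B j) s t +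
      (\<Sum>k\<in>UNIV - {j}. expected_jump_payments j k s t))"
proof -
  have t: "0 \<le> t" using st by simp
  have 1: "ls_integral (q j) (B j) 0 t = ls_integral (q j) (B j) 0 s + ls_integral (q j) (B j) s t" for j
    by (rule ls_integral_split[OF B st bounded_borel_q])
  have 2: "(\<Sum>k\<in>UNIV - {j}. expected_jump_payments j k 0 t) =
      (\<Sum>k\<in>UNIV - {j}. expected_jump_payments j k 0 s) +
      (\<Sum>k\<in>UNIV - {j}. expected_jump_payments j k s t)" for j
    unfolding sum.distrib[symmetric]
    by (rule sum.cong[OF refl], rule ls_integral_split[OF rcfv_Lambda_bar st bounded_borel_left_p_b[OF _ t]]) auto
  show ?thesis
    unfolding expected_payments_eq[OF st(1)] expected_payments_eq[OF t] 1 2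
    by (simp add: sum.distrib)
qed

end

end

theorem proposition7p1:
  fixes M :: "'a measure"
    and F :: "real \<Rightarrow> 'a measure"
    and Z :: "real \<Rightarrow> 'a \<Rightarrow> 's::finite"
    and z0 :: 's
    and H :: "real \<Rightarrow> 'a \<Rightarrow> real"
    and b0 :: real
    and B :: "'s \<Rightarrow> real \<Rightarrow> real"
    and b :: "'s \<Rightarrow> 's \<Rightarrow> real \<Rightarrow> real"
  assumes prob: "prob_space M"
    and filt: "filtration (space M) (\<lambda>t. F (max 0 t))"
    and filt_sub: "\<And>t. 0 \<le> t \<Longrightarrow> subalgebra M (F t)"
    and Z_rv: "\<And>t. 0 \<le> t \<Longrightarrow> Z t \<in> M \<rightarrow>\<^sub>M count_space UNIV"
    and Z_path: "\<And>\<omega>. \<omega> \<in> space M \<Longrightarrow> jump_path (\<lambda>t. Z t \<omega>)"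
    and Z_init: "\<And>\<omega>. \<omega> \<in> space M \<Longrightarrow> Z 0 \<omega> = z0"
    and N_int: "\<And>j k t. j \<noteq> k \<Longrightarrow> 0 \<le> t \<Longrightarrow> integrable M (jump_count Z j k t)"
    and H_adapted: "\<And>t. 0 \<le> t \<Longrightarrow> H t \<in> borel_measurable (F t)"
    and H_path: "\<And>\<omega>. \<omega> \<in> space M \<Longrightarrow> rcfv (\<lambda>t. H t \<omega>)"
    and H_bounded: "\<And>T. 0 \<le> T \<Longrightarrow> \<exists>C. \<forall>t\<in>{0..T}. \<forall>\<omega>\<in>space M. \<bar>H t \<omega>\<bar> \<le> C"
    and B_rcfv: "\<And>j. rcfv (B j)"
    and b_meas: "\<And>j k. j \<noteq> k \<Longrightarrow> set_borel_measurable borel {0..} (b j k)"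
    and b_bounded: "\<And>j k T. j \<noteq> k \<Longrightarrow> 0 \<le> T \<Longrightarrow> \<exists>C. \<forall>t\<in>{0..T}. \<bar>b j k t\<bar> \<le> C"
    and stay_int: "\<And>j t. 0 \<le> t \<Longrightarrow> integrable M (stay_integral Z H j t)"
    and jump_int: "\<And>j k t. j \<noteq> k \<Longrightarrow> 0 \<le> t \<Longrightarrow> integrable M (jump_integral Z H j k t)"
    and H0_nonzero: "(\<integral>\<omega>. H 0 \<omega> \<partial>M) \<noteq> 0"
    and H_bar_wf: "\<And>j. ls_quotient_wf (p_bar M Z H j) (expected_stay M Z H j)"
    and Lambda_bar_wf:
      "\<And>j k. j \<noteq> k \<Longrightarrow> ls_quotient_wf (p_bar M Z H j) (expected_jump M Z H j k)"
  shows
    "(\<forall>t\<ge>0. integrable M (payments Z H b0 B b t)) \<and>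
     rcfv (expected_payments M Z H b0 B b) \<and>
     (\<forall>j t. 0 \<le> t \<longrightarrow>
        ls_integrable
          (\<lambda>u. left_lim (p_bar M Z H j) u * (1 + (H_bar M Z H j u - left_lim (H_bar M Z H j) u)))
          (B j) 0 t) \<and>
     (\<forall>j k t. j \<noteq> k \<and> 0 \<le> t \<longrightarrow>
        ls_integrable (\<lambda>u. left_lim (p_bar M Z H j) u * b j k u)
          (\<lambda>u. Lambda_bar M Z H u $ j $ k) 0 t) \<and>
     (\<forall>s t. 0 \<le> s \<and> s \<le> t \<longrightarrow>
        expected_payments M Z H b0 B b t - expected_payments M Z H b0 B b s =
          (\<Sum>j\<in>UNIV.
             ls_integral
               (\<lambda>u. left_lim (p_bar M Z H j) u *
                    (1 + (H_bar M Z H j u - left_lim (H_bar M Z H j) u)))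
               (B j) s t +
             (\<Sum>k\<in>UNIV - {j}.
                ls_integral (\<lambda>u. left_lim (p_bar M Z H j) u * b j k u)
                  (\<lambda>u. Lambda_bar M Z H u $ j $ k) s t))) \<and>
     (\<forall>t\<ge>0. has_product_integral (Lambda_bar M Z H) 0 t
               (product_integral (Lambda_bar M Z H) 0 t)) \<and>
     (\<forall>t\<ge>0. \<forall>j. p_bar M Z H j t / (\<integral>\<omega>. H 0 \<omega> \<partial>M) =
               product_integral (Lambda_bar M Z H) 0 t $ z0 $ j)"
proof -
  interpret prob_space M by (rule prob)
  have H_rv: "H t \<in> borel_measurable M" if "0 \<le> t" for t
    by (rule measurable_from_subalg[OF filt_sub[OF that] H_adapted[OF that]])
  interpret weighted_jump_process M Z z0 H
    by unfold_locales (fact Z_rv Z_path Z_init N_int H_rv H_path H_bounded stay_int jump_int H_bar_wf Lambda_bar_wf)+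
  have b: "bounded_borel T (b j k)" if jk: "j \<noteq> k" and T: "0 \<le> T" for j k T
  proof -
    obtain C where C: "\<forall>t\<in>{0..T}. \<bar>b j k t\<bar> \<le> C"
      using b_bounded[OF jk T] by (rule exE)
    have "(\<lambda>s. indicator {0<..T} s * (indicator {0..} s *\<^sub>R b j k s)) \<in> borel_measurable borel"
      using b_meas[OF jk] unfolding set_borel_measurable_def by (intro borel_measurable_times) simp_all
    also have "(\<lambda>s. indicator {0<..T} s * (indicator {0..} s *\<^sub>R b j k s)) = (\<lambda>s. indicator {0<..T} s * b j k s)"
      by (auto simp: fun_eq_iff indicator_def)
    finally show ?thesis
      by (rule bounded_borelI[where C = C]) (use C in simp)
  qed
  have 1: "integrable M (payments Z H b0 B b t)" if "0 \<le> t" for t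
    by (rule integrable_payments; (rule B_rcfv | rule b | rule that); assumption?)
  have 2: "rcfv (expected_payments M Z H b0 B b)"
    by (rule rcfv_expected_payments; (rule B_rcfv | rule b); assumption?)
  have 3: "ls_integrable (q j) (B j) 0 t" for j t
    by (rule ls_integrable_bounded_borel[OF B_rcfv order_refl bounded_borel_q])
  have 4: "ls_integrable (\<lambda>u. left_lim (p j) u * b j k u) (\<lambda>u. Lambda_bar M Z H u $ j $ k) 0 t"
    if "j \<noteq> k" "0 \<le> t" for j k t
    by (rule ls_integrable_bounded_borel[OF rcfv_Lambda_bar order_refl bounded_borel_mult[OF bounded_borel_left_p b[OF that]]])
  have 5: "expected_payments M Z H b0 B b t - expected_payments M Z H b0 B b s =
      (\<Sum>j\<in>UNIV. ls_integral (q j) (B j) s t +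
        (\<Sum>k\<in>UNIV - {j}. ls_integral (\<lambda>u. left_lim (p j) u * b j k u) (\<lambda>u. Lambda_bar M Z H u $ j $ k) s t))"
    if "0 \<le> s" "s \<le> t" for s t
    by (rule expected_payments_increment; (rule B_rcfv | rule b | rule that); assumption?)
  have 6: "has_product_integral (Lambda_bar M Z H) 0 t (product_integral (Lambda_bar M Z H) 0 t)" if "0 \<le> t" for t
    by (rule has_product_integral_rcfv[OF rcfv_Lambda_bar that])
  have 7: "p j t / (\<integral>\<omega>. H 0 \<omega> \<partial>M) = product_integral (Lambda_bar M Z H) 0 t $ z0 $ j" if "0 \<le> t" for j t
    using p_bar_product_integral[OF that, of j] H0_nonzero by simp
  show ?thesis
    by (intro conjI allI impI; (elim conjE)?; (rule 1 2 3 4 5 6 7; assumption?))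
qed

end
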